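(* Let $H$ be a Lagrangian harmonic function on a connected open set $X\subset\mathbb C^n$. Suppose $f$ is Lagrangian pluriharmonic (a traceless hermitian degree-2 polynomial) with $f\le H$ on a compact set $K\subset X$. Consider the contact set $\Sigma\equiv\{x\in K:f(x)=H(x)\}$. Then $$\Sigma\subset\widehat{\Sigma\cap\partial K}.$$ In particular, if $K$ is Lagrangian convex in $X$, then $$\Sigma=\widehat{\Sigma\cap\partial K}.$$
   Context: A real $n$-plane $W\subset\mathbb C^n=(\mathbb R^{2n},J,\langle\cdot,\cdot\rangle)$ is Lagrangian if $JW=W^\perp$; $\mathrm{LAG}$ is the set of these. $\mathcal P(\mathrm{LAG})=\{A\in\mathrm{Sym}^2_{\mathbb R}(\mathbb C^n):\mathrm{tr}(A|_W)\ge0\ \forall\,W\in\mathrm{LAG}\}$ and $\widetilde{\mathcal P}(\mathrm{LAG})=\{A:\exists\,W\in\mathrm{LAG},\ \mathrm{tr}(A|_W)\ge0\}$. An upper semi-continuous $u:X\to[-\infty,\infty)$ is Lagrangian plurisubharmonic (resp. dually Lagrangian plurisubharmonic) if for each $x\in X$ and each smooth $\varphi$ defined near $x$ with $u\le\varphi$ near $x$ and equality at $x$, one has $D_x^2\varphi\in\mathcal P(\mathrm{LAG})$ (resp. $\widetilde{\mathcal P}(\mathrm{LAG})$). A continuous $H$ is Lagrangian harmonic if $H$ is Lagrangian plurisubharmonic and $-H$ is dually Lagrangian plurisubharmonic. A continuous $f$ is Lagrangian pluriharmonic if $f$ and $-f$ are both Lagrangian plurisubharmonic; equivalently $f(z)=c+\sum_k(b_kz_k+\overline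 b_k\overline z_k)+\frac12\sum a_{ij}z_i\overline z_j$ with $c\in\mathbb R$, $b\in\mathbb C^n$, $(a_{ij})$ hermitian of trace $0$. For a compact $L\subset X$, the Lagrangian hull in $X$ is $\widehat L=\{x\in X:g(x)\le\sup_Lg\text{ for all smooth Lagrangian plurisubharmonic functions }g\text{ on }X\}$ (with $\sup_\emptyset=-\infty$). $L$ is Lagrangian convex in $X$ if $\widehat L=L$. *)

theory Defs
  imports "HOL-Analysis.Analysis"
begin

text \<open>
  The space \<open>\<complex>\<^sup>n\<close> is the type \<open>complex^'n\<close> with its library structure as a real Euclidean space;
  the real inner product is \<open>\<langle>z, w\<rangle> = Re (\<Sum>k. z\<^sub>k * cnj w\<^sub>k)\<close>.  The words subspace, span,
  dimension and linear below are always over the reals.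
\<close>

text \<open>\<open>C\<^sup>k\<close> functions on an open set, via iterated directional derivatives.\<close>

primrec C_k_on :: "nat \<Rightarrow> ('a::euclidean_space \<Rightarrow> real) \<Rightarrow> 'a set \<Rightarrow> bool" where
  "C_k_on 0 f U \<longleftrightarrow> continuous_on U f"
| "C_k_on (Suc k) f U \<longleftrightarrow> (\<forall>x\<in>U. f differentiable (at x)) \<and>
     (\<forall>v. C_k_on k (\<lambda>x. frechet_derivative f (at x) v) U)"

definition smooth_on :: "('a::euclidean_space \<Rightarrow> real) \<Rightarrow> 'a set \<Rightarrow> bool" where
  "smooth_on f U \<longleftrightarrow> (\<forall>k. C_k_on k f U)"

definition hessian :: "('a::euclidean_space \<Rightarrow> real) \<Rightarrow> 'a \<Rightarrow> 'a \<Rightarrow> 'a \<Rightarrow> real" where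
  "hessian f x u v = frechet_derivative (\<lambda>y. frechet_derivative f (at y) v) (at x) u"

definition Sym2 :: "('a::euclidean_space \<Rightarrow> 'a \<Rightarrow> real) set" where
  "Sym2 = {A. bilinear A \<and> (\<forall>u v. A u v = A v u)}"

definition orthonormal_basis_of :: "'a::euclidean_space set \<Rightarrow> 'a set \<Rightarrow> bool" where
  "orthonormal_basis_of W B \<longleftrightarrow>
     pairwise orthogonal B \<and> (\<forall>b\<in>B. norm b = 1) \<and> span B = W"

definition trace_on :: "('a::euclidean_space \<Rightarrow> 'a \<Rightarrow> real) \<Rightarrow> 'a set \<Rightarrow> real" where
  "trace_on A W = (\<Sum>b\<in>(SOME B. orthonormal_basis_of W B). A b b)"

lemma orthonormal_basis_of_finite: "orthonormal_basis_of W B \<Longrightarrow> finite B"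
  unfolding orthonormal_basis_of_def
  by (metis finiteI_independent norm_zero pairwise_orthogonal_independent zero_neq_one)

lemma orthonormal_basis_of_exists:
  assumes "subspace W" shows "\<exists>B. orthonormal_basis_of W B"
  using orthonormal_basis_subspace[OF assms] unfolding orthonormal_basis_of_def by metis

lemma orthonormal_basis_of_expand:
  assumes B: "orthonormal_basis_of W B" and "x \<in> W"
  shows "(\<Sum>b\<in>B. (x \<bullet> b) *\<^sub>R b) = x"
  using orthonormal_basis_expand[of B x] orthonormal_basis_of_finite[OF B] assms
  unfolding orthonormal_basis_of_def by auto

text \<open>The trace does not depend on the orthonormal basis that is chosen.\<close>

lemma trace_on_eq:
  fixes A :: "'a::euclidean_space \<Rightarrow> 'a \<Rightarrow> real"
  assumes A: "bilinear A" and C: "orthonormal_basis_of W C"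
  shows "trace_on A W = (\<Sum>c\<in>C. A c c)"
proof -
  define B where "B = (SOME B. orthonormal_basis_of W B)"
  have B: "orthonormal_basis_of W B"
    unfolding B_def using C by (rule someI)
  have sub: "b \<in> W" if "orthonormal_basis_of W D" "b \<in> D" for b D
    using that span_base unfolding orthonormal_basis_of_def by blast
  have finB: "finite B" and finC: "finite C"
    using B C orthonormal_basis_of_finite by blast+
  have "(\<Sum>b\<in>B. A b b) = (\<Sum>b\<in>B. \<Sum>c\<in>C. (b \<bullet> c) * A c b)"
  proof (rule sum.cong[OF refl])
    fix b assume b: "b \<in> B"
    have "A b b = A (\<Sum>c\<in>C. (b \<bullet> c) *\<^sub>R c) b"
      using orthonormal_basis_of_expand[OF C sub[OF B b]] by simp
    also have "\<dots> = (\<Sum>c\<in>C. (b \<bullet> c) * A c b)"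
    proof -
      interpret l: linear "\<lambda>x. A x b" using A by (simp add: bilinear_def)
      show ?thesis by (simp add: l.sum l.scale)
    qed
    finally show "A b b = (\<Sum>c\<in>C. (b \<bullet> c) * A c b)" .
  qed
  also have "\<dots> = (\<Sum>c\<in>C. \<Sum>b\<in>B. (c \<bullet> b) * A c b)"
    by (subst sum.swap) (simp add: inner_commute)
  also have "\<dots> = (\<Sum>c\<in>C. A c c)"
  proof (rule sum.cong[OF refl])
    fix c assume c: "c \<in> C"
    have "A c c = A c (\<Sum>b\<in>B. (c \<bullet> b) *\<^sub>R b)"
      using orthonormal_basis_of_expand[OF B sub[OF C c]] by simp
    also have "\<dots> = (\<Sum>b\<in>B. (c \<bullet> b) * A c b)"
    proof -
      interpret r: linear "A c" using A by (simp add: bilinear_def)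
      show ?thesis by (simp add: r.sum r.scale)
    qed
    finally show "(\<Sum>b\<in>B. (c \<bullet> b) * A c b) = A c c" by simp
  qed
  finally show ?thesis unfolding trace_on_def B_def .
qed

definition complex_structure :: "complex^'n \<Rightarrow> complex^'n" where
  "complex_structure z = \<i> *s z"

definition LAG :: "(complex^'n) set set" where
  "LAG = {W. subspace W \<and> dim W = CARD('n) \<and> complex_structure ` W = orthogonal_comp W}"

definition P_LAG :: "(complex^'n \<Rightarrow> complex^'n \<Rightarrow> real) set" where
  "P_LAG = {A \<in> Sym2. \<forall>W\<in>LAG. trace_on A W \<ge> 0}"

definition dual_P_LAG :: "(complex^'n \<Rightarrow> complex^'n \<Rightarrow> real) set" where
  "dual_P_LAG = {A \<in> Sym2. \<exists>W\<in>LAG. trace_on A W \<ge> 0}"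

definition upper_semicontinuous_on :: "'a::topological_space set \<Rightarrow> ('a \<Rightarrow> ereal) \<Rightarrow> bool" where
  "upper_semicontinuous_on X u \<longleftrightarrow>
     (\<forall>x\<in>X. \<forall>c. u x < c \<longrightarrow> (\<forall>\<^sub>F y in at x within X. u y < c))"

text \<open>
  \<open>F\<close> is the constant-coefficient constraint set on the second derivative.  The functions take
  values in \<open>[-\<infinity>, \<infinity>)\<close>; there is no test function at a point where \<open>u = -\<infinity>\<close>.
\<close>

definition subharmonic_on ::
  "('a::euclidean_space \<Rightarrow> 'a \<Rightarrow> real) set \<Rightarrow> 'a set \<Rightarrow> ('a \<Rightarrow> ereal) \<Rightarrow> bool" where
  "subharmonic_on F X u \<longleftrightarrow>
     (\<forall>x\<in>X. u x < \<infinity>) \<and> upper_semicontinuous_on X u \<and>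
     (\<forall>x\<in>X. \<forall>U \<phi>. open U \<and> x \<in> U \<and> U \<subseteq> X \<and> smooth_on \<phi> U \<and>
        (\<forall>y\<in>U. u y \<le> ereal (\<phi> y)) \<and> u x = ereal (\<phi> x) \<longrightarrow> hessian \<phi> x \<in> F)"

definition lag_psh :: "(complex^'n) set \<Rightarrow> (complex^'n \<Rightarrow> ereal) \<Rightarrow> bool" where
  "lag_psh X u \<longleftrightarrow> subharmonic_on P_LAG X u"

definition dually_lag_psh :: "(complex^'n) set \<Rightarrow> (complex^'n \<Rightarrow> ereal) \<Rightarrow> bool" where
  "dually_lag_psh X u \<longleftrightarrow> subharmonic_on dual_P_LAG X u"

definition lag_harmonic :: "(complex^'n) set \<Rightarrow> (complex^'n \<Rightarrow> real) \<Rightarrow> bool" where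
  "lag_harmonic X H \<longleftrightarrow> continuous_on X H \<and>
     lag_psh X (\<lambda>x. ereal (H x)) \<and> dually_lag_psh X (\<lambda>x. ereal (- H x))"

definition lag_pluriharmonic :: "(complex^'n) set \<Rightarrow> (complex^'n \<Rightarrow> real) \<Rightarrow> bool" where
  "lag_pluriharmonic X f \<longleftrightarrow> continuous_on X f \<and>
     lag_psh X (\<lambda>x. ereal (f x)) \<and> lag_psh X (\<lambda>x. ereal (- f x))"

text \<open>The supremum is taken in the extended reals, so that it is \<open>-\<infinity>\<close> for \<open>L = {}\<close>.\<close>

definition lag_hull :: "(complex^'n) set \<Rightarrow> (complex^'n) set \<Rightarrow> (complex^'n) set" where
  "lag_hull X L = {x \<in> X. \<forall>g. smooth_on g X \<and> lag_psh X (\<lambda>y. ereal (g y)) \<longrightarrow>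
     ereal (g x) \<le> (SUP y\<in>L. ereal (g y))}"

definition lag_convex :: "(complex^'n) set \<Rightarrow> (complex^'n) set \<Rightarrow> bool" where
  "lag_convex X L \<longleftrightarrow> lag_hull X L = L"

end

theory Submission
  imports Defs
begin

text \<open>
  Suppose a smooth plurisubharmonic \<open>g\<close> is larger at a contact point than on \<open>\<Sigma> \<inter> \<partial>K\<close>.  Then for small
  \<open>\<epsilon>, \<delta> > 0\<close> the function \<open>f + \<epsilon> g + \<delta> \<bar>x\<bar>\<^sup>2 - H\<close> has its maximum over \<open>K\<close> at an interior point, where
  \<open>-(f + \<epsilon> g + \<delta> \<bar>x\<bar>\<^sup>2)\<close> is a test function for \<open>-H\<close> whose Hessian has negative trace on every
  Lagrangian plane.  This needs \<open>f\<close> to be smooth: \<open>\<real>\<^sup>n\<close> and \<open>i \<real>\<^sup>n\<close> are Lagrangian, so \<open>f\<close> is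
  harmonic in the viscosity sense, and by comparison with solutions of the Dirichlet problem it is a
  locally uniform limit of harmonic polynomials.

  For the converse inclusion, \<open>w = H - f\<close> is plurisubharmonic, vanishes on \<open>\<Sigma>\<close> and is positive on
  \<open>K - \<Sigma>\<close>, but it is only continuous.  On every Lagrangian disc \<open>w\<close> satisfies the comparison principle
  with respect to harmonic polynomials; this property is additive, hence stable under mollification,
  which gives smooth plurisubharmonic approximations near \<open>K\<close>.  Convexity of \<open>K\<close> extends them to \<open>X\<close>.

  The discs are treated uniformly: \<open>B\<close> is an orthonormal set, \<open>lap\<close> the Laplacian along \<open>span B\<close>;
  \<open>B = Basis\<close> gives balls, a basis of a Lagrangian plane gives Lagrangian discs.
\<close>

section \<open>Smooth functions\<close>

text \<open>Two features of the viscosity definition shape the argument. The dual condition on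
  \<open>- H\<close> yields one unknown Lagrangian plane at one point, so every summand of the
  perturbation must have nonnegative trace there on all planes at once; smoothness of
  \<open>f\<close> and \<open>g\<close> provides this. And two functions that are subharmonic in the
  sense of test functions need not admit them at the same point, so sums and averages cannot be
  treated pointwise. Upper bounds on a circle do add; the way back to Hessians is taken only for the
  smooth mollified function. The Dirichlet problem is needed only up to a uniform error on the
  circle, so no Poisson integral enters: combinations of the powers
  \<open>(a \<bullet> (x - y)) ^ k\<close>, which have exact polynomial solutions, approximate
  exponentials, and sums of exponentials are dense by Stone-Weierstrass. In the gluing no second
  derivative of a composite is computed for the plurisubharmonicity: \<open>theta\<close> is convex
  with slopes in [0,1], and its supporting lines reduce a regularised maximum to a convex
  combination.\<close>

definition pd :: "'a::euclidean_space \<Rightarrow> ('a \<Rightarrow> real) \<Rightarrow> 'a \<Rightarrow> real" where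
  "pd v f = (\<lambda>x. frechet_derivative f (at x) v)"

lemma hessian_eq_pd: "hessian f x u v = pd u (pd v f) x"
  by (simp add: hessian_def pd_def)

lemma C_k_on_Suc_pd:
  "C_k_on (Suc k) f U \<longleftrightarrow> (\<forall>x\<in>U. f differentiable (at x)) \<and> (\<forall>v. C_k_on k (pd v f) U)"
  by (simp add: pd_def)

lemma pd_eqI: "(f has_derivative f') (at x) \<Longrightarrow> pd v f x = f' v"
  by (metis frechet_derivative_at pd_def)

lemma has_derivative_pd: "f differentiable (at x) \<Longrightarrow> (f has_derivative (\<lambda>v. pd v f x)) (at x)"
  using frechet_derivative_works unfolding pd_def by fastforce

lemma pd_cong:
  assumes "open U" "x \<in> U" "\<And>y. y \<in> U \<Longrightarrow> f y = g y"
  shows "pd v f x = pd v g x"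
proof -
  have "(f has_derivative D) (at x) \<longleftrightarrow> (g has_derivative D) (at x)" for D
    using has_derivative_transform_within_open[of f D x UNIV U g]
      has_derivative_transform_within_open[of g D x UNIV U f] assms by auto
  then show ?thesis by (simp add: pd_def frechet_derivative_def)
qed

lemma differentiable_cong_open:
  fixes f g :: "'a::euclidean_space \<Rightarrow> real"
  assumes "open U" "x \<in> U" "\<And>y. y \<in> U \<Longrightarrow> f y = g y" "f differentiable (at x)"
  shows "g differentiable (at x)"
proof -
  obtain D where "(f has_derivative D) (at x)" using assms(4) by (auto simp: differentiable_def)
  then have "(g has_derivative D) (at x)"
    using has_derivative_transform_within_open[of f D x UNIV U g] assms by auto
  then show ?thesis by (auto simp: differentiable_def)
qed

lemma C_k_on_cong:
  assumes "open U" "\<And>y. y \<in> U \<Longrightarrow> f y = g y" "C_k_on k f U"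
  shows "C_k_on k g U"
  using assms(2,3)
proof (induction k arbitrary: f g)
  case 0
  then show ?case using continuous_on_cong[of U U f g] by auto
next
  case (Suc k)
  have "C_k_on k (pd v g) U" for v
  proof (rule Suc.IH[of "pd v f"])
    show "pd v f y = pd v g y" if "y \<in> U" for y
      by (rule pd_cong[OF assms(1) that]) (rule Suc.prems)
    show "C_k_on k (pd v f) U" using Suc.prems(2) unfolding C_k_on_Suc_pd by blast
  qed
  moreover have "\<forall>x\<in>U. g differentiable (at x)"
    using Suc.prems(2) differentiable_cong_open[OF assms(1) _ Suc.prems(1)] by auto
  ultimately show ?case unfolding C_k_on_Suc_pd by blast
qed

lemma smooth_on_cong:
  assumes "open U" "\<And>y. y \<in> U \<Longrightarrow> f y = g y" "smooth_on f U"
  shows "smooth_on g U"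
  using C_k_on_cong[OF assms(1,2)] assms(3) unfolding smooth_on_def by auto

lemma smooth_on_subset: "smooth_on f U \<Longrightarrow> V \<subseteq> U \<Longrightarrow> smooth_on f V"
proof -
  have "C_k_on k f U \<Longrightarrow> V \<subseteq> U \<Longrightarrow> C_k_on k f V" for k
    by (induction k arbitrary: f) (auto intro: continuous_on_subset)
  then show "smooth_on f U \<Longrightarrow> V \<subseteq> U \<Longrightarrow> smooth_on f V" by (auto simp: smooth_on_def)
qed

lemma smooth_on_local:
  assumes "\<And>x. x \<in> X \<Longrightarrow> \<exists>U. open U \<and> x \<in> U \<and> smooth_on f U"
  shows "smooth_on f X"
proof -
  have "C_k_on k f X" if "\<And>x. x \<in> X \<Longrightarrow> \<exists>U. open U \<and> x \<in> U \<and> C_k_on k f U" for k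
    using that
  proof (induction k arbitrary: f)
    case 0
    have "isCont f x" if "x \<in> X" for x
      using 0[OF that] by (auto simp: continuous_on_eq_continuous_at)
    then show ?case by (auto intro: continuous_at_imp_continuous_on)
  next
    case (Suc k)
    have "C_k_on k (pd v f) X" for v
      by (rule Suc.IH) (use Suc.prems in \<open>force simp: pd_def\<close>)
    moreover have "\<forall>x\<in>X. f differentiable (at x)" using Suc.prems by fastforce
    ultimately show ?case unfolding C_k_on_Suc_pd by blast
  qed
  then show ?thesis using assms unfolding smooth_on_def by blast
qed

lemma smooth_on_differentiable: "smooth_on f U \<Longrightarrow> x \<in> U \<Longrightarrow> f differentiable (at x)"
  unfolding smooth_on_def by (metis C_k_on_Suc_pd)

lemma smooth_on_pd: "smooth_on f U \<Longrightarrow> smooth_on (pd v f) U"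
  unfolding smooth_on_def by (metis C_k_on_Suc_pd)

lemma smooth_on_continuous: "smooth_on f U \<Longrightarrow> continuous_on U f"
  unfolding smooth_on_def using C_k_on.simps(1)[of f U] by fast

text \<open>\<open>C_k_on\<close> recurses on the order of differentiation. Instead of treating each
  order, it is enough to exhibit a class \<open>P\<close> closed under directional derivatives up to
  equality on \<open>U\<close>. The classes used below are an algebra of composite functions, local
  limits of harmonic polynomials, and convolutions with smooth kernels.\<close>

lemma smooth_on_coinduct:
  assumes U: "open U" and "P f"
    and step: "\<And>f. P f \<Longrightarrow> (\<forall>x\<in>U. f differentiable (at x)) \<and>
                 (\<forall>v. \<exists>g. P g \<and> (\<forall>x\<in>U. pd v f x = g x))"
  shows "smooth_on f U"
proof -
  have "C_k_on k f U" if "P f" for k f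
    using that
  proof (induction k arbitrary: f)
    case 0
    then show ?case using step[OF 0]
      by (auto intro!: continuous_at_imp_continuous_on differentiable_imp_continuous_within)
  next
    case (Suc k)
    have "C_k_on k (pd v f) U" for v
    proof -
      obtain g where "P g" "\<forall>x\<in>U. pd v f x = g x" using step[OF Suc.prems] by blast
      then show ?thesis using Suc.IH[of g] C_k_on_cong[OF U, of g "pd v f"] by simp
    qed
    then show ?case using step[OF Suc.prems] unfolding C_k_on_Suc_pd by blast
  qed
  then show ?thesis using assms(2) by (auto simp: smooth_on_def)
qed

text \<open>Division by \<open>t ^ n\<close> makes the family closed under differentiation: the
  derivative of a member is a combination of members with larger index.\<close>

definition flat :: "nat \<Rightarrow> real \<Rightarrow> real" where
  "flat n t = (if t > 0 then exp (- 1 / t) / t ^ n else 0)"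

lemma flat_tendsto_0: "(flat n \<longlongrightarrow> 0) (at 0)"
proof -
  have "((\<lambda>x::real. x ^ n / exp x) \<longlongrightarrow> 0) at_top" by (rule tendsto_power_div_exp_0)
  then have "((\<lambda>t::real. (inverse t) ^ n / exp (inverse t)) \<longlongrightarrow> 0) (at_right 0)"
    by (rule filterlim_compose[OF _ filterlim_inverse_at_top_right])
  then have R: "(flat n \<longlongrightarrow> 0) (at_right 0)"
  proof (rule Lim_transform_eventually)
    show "\<forall>\<^sub>F t in at_right 0. (inverse t) ^ n / exp (inverse t) = flat n t"
      by (auto simp: eventually_at_filter flat_def divide_simps exp_minus)
  qed
  have L: "(flat n \<longlongrightarrow> 0) (at_left 0)"
    by (rule Lim_transform_eventually[of "\<lambda>_. 0"]) (auto simp: eventually_at_filter flat_def)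
  show ?thesis using R L by (simp add: filterlim_split_at)
qed

lemma flat_has_derivative:
  "(flat n has_real_derivative flat (n + 2) t - real n * flat (n + 1) t) (at t)"
proof -
  consider "t > 0" | "t < 0" | "t = 0" by linarith
  then show ?thesis
  proof cases
    case 1
    have "((\<lambda>t. exp (- 1 / t) / t ^ n) has_real_derivative flat (n + 2) t - real n * flat (n + 1) t) (at t)"
    proof -
      have n: "real n * t ^ (n - 1) = real n * t ^ n / t" using 1 by (cases n) auto
      have "((\<lambda>t. exp (- 1 / t) / t ^ n) has_real_derivative
          (exp (- 1 / t) * (1 / t\<^sup>2) * t ^ n - exp (- 1 / t) * (real n * t ^ (n - 1))) / (t ^ n * t ^ n)) (at t)"
        using 1 by (auto intro!: derivative_eq_intros simp: power2_eq_square)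
      also have "(exp (- 1 / t) * (1 / t\<^sup>2) * t ^ n - exp (- 1 / t) * (real n * t ^ (n - 1))) / (t ^ n * t ^ n)
          = flat (n + 2) t - real n * flat (n + 1) t"
        unfolding n flat_def using 1 by (simp add: divide_simps power2_eq_square) (simp add: algebra_simps)?
      finally show ?thesis .
    qed
    then show ?thesis
      by (rule has_field_derivative_transform_within_open[where S="{0<..}"])
        (use 1 in \<open>auto simp: flat_def\<close>)
  next
    case 2
    have "((\<lambda>t. 0) has_real_derivative flat (n + 2) t - real n * flat (n + 1) t) (at t)"
      using 2 by (auto simp: flat_def)
    then show ?thesis
      by (rule has_field_derivative_transform_within_open[where S="{..<0}"])
        (use 2 in \<open>auto simp: flat_def\<close>)
  next
    case 3
    \<comment> \<open>At 0 the difference quotient is itself a member of the family, so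
      differentiability there is again \<open>flat_tendsto_0\<close>.\<close>
    have "(\<lambda>h. (flat n (0 + h) - flat n 0) / h) = flat (Suc n)"
      by (auto simp: flat_def fun_eq_iff field_simps)
    then show ?thesis using 3 flat_tendsto_0[of "Suc n"] unfolding DERIV_def by (simp add: flat_def)
  qed
qed

text \<open>Clause \<open>base\<close> admits every smooth function, so the closure of smooth
  functions under sums, products and \<open>flat\<close> follows from a single coinduction, with
  only first order Leibniz and chain rules.\<close>

inductive smooth_alg :: "'a::euclidean_space set \<Rightarrow> ('a \<Rightarrow> real) \<Rightarrow> bool" for U where
  base: "smooth_on f U \<Longrightarrow> smooth_alg U f"
| lin: "bounded_linear f \<Longrightarrow> smooth_alg U f"
| const: "smooth_alg U (\<lambda>x. c)"
| add: "smooth_alg U f \<Longrightarrow> smooth_alg U g \<Longrightarrow> smooth_alg U (\<lambda>x. f x + g x)"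
| mult: "smooth_alg U f \<Longrightarrow> smooth_alg U g \<Longrightarrow> smooth_alg U (\<lambda>x. f x * g x)"
| flat: "smooth_alg U f \<Longrightarrow> smooth_alg U (\<lambda>x. flat n (f x))"

lemma smooth_alg_derivative:
  assumes "smooth_alg U f"
  shows "(\<forall>x\<in>U. f differentiable (at x)) \<and> (\<forall>v. \<exists>g. smooth_alg U g \<and> (\<forall>x\<in>U. pd v f x = g x))"
  using assms
proof induction
  case (base f)
  then show ?case using smooth_on_differentiable smooth_on_pd smooth_alg.base by blast
next
  case (lin f)
  then have "pd v f x = f v" for v x
    by (intro pd_eqI bounded_linear_imp_has_derivative)
  then show ?case using smooth_alg.const lin bounded_linear_imp_differentiable by blast
next
  case (const c)
  have "pd v (\<lambda>x. c) x = 0" for v x :: 'a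
    by (rule pd_eqI) (auto intro!: derivative_eq_intros)
  then show ?case using smooth_alg.const by fastforce
next
  case (add f g)
  have "pd v (\<lambda>x. f x + g x) x = pd v f x + pd v g x" if "x \<in> U" for v x
    by (rule pd_eqI) (use add.IH that in \<open>auto intro!: derivative_eq_intros has_derivative_pd\<close>)
  moreover have "\<exists>h. smooth_alg U h \<and> (\<forall>x\<in>U. pd v f x + pd v g x = h x)" for v
  proof -
    obtain f' g' where "smooth_alg U f'" "\<forall>x\<in>U. pd v f x = f' x"
      "smooth_alg U g'" "\<forall>x\<in>U. pd v g x = g' x" using add.IH by metis
    then show ?thesis by (intro exI[of _ "\<lambda>x. f' x + g' x"]) (auto intro: smooth_alg.add)
  qed
  ultimately show ?case using add.IH by auto
next
  case (mult f g)
  have "pd v (\<lambda>x. f x * g x) x = f x * pd v g x + pd v f x * g x" if "x \<in> U" for v x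
    by (rule pd_eqI) (use mult.IH that in \<open>auto intro!: derivative_eq_intros has_derivative_pd\<close>)
  moreover have "\<exists>h. smooth_alg U h \<and> (\<forall>x\<in>U. f x * pd v g x + pd v f x * g x = h x)" for v
  proof -
    obtain f' g' where "smooth_alg U f'" "\<forall>x\<in>U. pd v f x = f' x"
      "smooth_alg U g'" "\<forall>x\<in>U. pd v g x = g' x" using mult.IH by metis
    then show ?thesis
      by (intro exI[of _ "\<lambda>x. f x * g' x + f' x * g x"])
        (auto intro!: smooth_alg.add smooth_alg.mult mult.hyps)
  qed
  ultimately show ?case using mult.IH by auto
next
  case (flat f n)
  have D: "((\<lambda>x. flat n (f x)) has_derivative
      (\<lambda>v. pd v f x * (flat (n + 2) (f x) - real n * flat (n + 1) (f x)))) (at x)" if "x \<in> U" for x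
    using DERIV_compose_FDERIV[OF flat_has_derivative has_derivative_pd] flat.IH that by blast
  have "\<exists>h. smooth_alg U h \<and>
      (\<forall>x\<in>U. pd v f x * (flat (n + 2) (f x) - real n * flat (n + 1) (f x)) = h x)" for v
  proof -
    obtain f' where f': "smooth_alg U f'" "\<forall>x\<in>U. pd v f x = f' x" using flat.IH by metis
    have "smooth_alg U (\<lambda>x. f' x * (flat (n + 2) (f x) + (- real n) * flat (n + 1) (f x)))"
      by (intro smooth_alg.mult smooth_alg.add smooth_alg.flat smooth_alg.const f'(1) flat.hyps)
    with f'(2) show ?thesis by (intro exI[of _ "\<lambda>x. f' x * (flat (n + 2) (f x) + (- real n) * flat (n + 1) (f x))"]) auto
  qed
  moreover have "pd v (\<lambda>x. flat n (f x)) x = pd v f x * (flat (n + 2) (f x) - real n * flat (n + 1) (f x))"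
    if "x \<in> U" for v x using pd_eqI[OF D[OF that]] .
  ultimately show ?case using D unfolding differentiable_def by force
qed

lemma smooth_alg_smooth: "open U \<Longrightarrow> smooth_alg U f \<Longrightarrow> smooth_on f U"
  by (rule smooth_on_coinduct[of U "smooth_alg U"]) (use smooth_alg_derivative in auto)

lemma smooth_on_const: "open U \<Longrightarrow> smooth_on (\<lambda>x. c) U"
  by (simp add: smooth_alg_smooth smooth_alg.const)

lemma smooth_on_add: "open U \<Longrightarrow> smooth_on f U \<Longrightarrow> smooth_on g U \<Longrightarrow> smooth_on (\<lambda>x. f x + g x) U"
  by (simp add: smooth_alg_smooth smooth_alg.add smooth_alg.base)

lemma smooth_on_mult: "open U \<Longrightarrow> smooth_on f U \<Longrightarrow> smooth_on g U \<Longrightarrow> smooth_on (\<lambda>x. f x * g x) U"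
  by (simp add: smooth_alg_smooth smooth_alg.mult smooth_alg.base)

lemma smooth_on_cmult: "open U \<Longrightarrow> smooth_on f U \<Longrightarrow> smooth_on (\<lambda>x. c * f x) U"
  by (simp add: smooth_on_mult smooth_on_const)

lemma smooth_on_minus: "open U \<Longrightarrow> smooth_on f U \<Longrightarrow> smooth_on (\<lambda>x. - f x) U"
  using smooth_on_cmult[of U f "-1"] by simp

lemma smooth_on_diff: "open U \<Longrightarrow> smooth_on f U \<Longrightarrow> smooth_on g U \<Longrightarrow> smooth_on (\<lambda>x. f x - g x) U"
  using smooth_on_add[of U f "\<lambda>x. - g x"] smooth_on_minus[of U g] by simp

lemma smooth_on_sum:
  "open U \<Longrightarrow> (\<And>i. i \<in> I \<Longrightarrow> smooth_on (f i) U) \<Longrightarrow> smooth_on (\<lambda>x. \<Sum>i\<in>I. f i x) U"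
  by (induction I rule: infinite_finite_induct) (auto simp: smooth_on_const smooth_on_add)

lemma smooth_on_flat: "open U \<Longrightarrow> smooth_on f U \<Longrightarrow> smooth_on (\<lambda>x. flat n (f x)) U"
  by (simp add: smooth_alg_smooth smooth_alg.flat smooth_alg.base)

lemma smooth_on_polynomial:
  assumes "open U" "real_polynomial_function p" shows "smooth_on p U"
proof -
  have "smooth_alg U p" using assms(2) by induction (auto intro: smooth_alg.intros)
  then show ?thesis using assms(1) smooth_alg_smooth by blast
qed

section \<open>Rules for first and second directional derivatives\<close>

lemma pd_const: "pd v (\<lambda>x. c) x = 0"
  by (rule pd_eqI) (auto intro!: derivative_eq_intros)

lemma pd_add:
  "f differentiable (at x) \<Longrightarrow> g differentiable (at x) \<Longrightarrow> pd v (\<lambda>x. f x + g x) x = pd v f x + pd v g x"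
  by (rule pd_eqI) (auto intro!: derivative_eq_intros has_derivative_pd)

lemma pd_mult:
  "f differentiable (at x) \<Longrightarrow> g differentiable (at x) \<Longrightarrow>
    pd v (\<lambda>x. f x * g x) x = f x * pd v g x + pd v f x * g x"
  by (rule pd_eqI) (auto intro!: derivative_eq_intros has_derivative_pd)

lemma pd_cmult: "f differentiable (at x) \<Longrightarrow> pd v (\<lambda>x. c * f x) x = c * pd v f x"
  by (rule pd_eqI) (auto intro!: derivative_eq_intros has_derivative_pd)

lemma pd_vec_add: "f differentiable (at x) \<Longrightarrow> pd (u + v) f x = pd u f x + pd v f x"
  by (simp add: pd_def linear_add linear_frechet_derivative)

lemma pd_vec_scale: "f differentiable (at x) \<Longrightarrow> pd (c *\<^sub>R v) f x = c * pd v f x"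
  by (simp add: pd_def linear_cmul linear_frechet_derivative)

lemma pd_line:
  assumes "f differentiable (at (x + t *\<^sub>R v))"
  shows "((\<lambda>t. f (x + t *\<^sub>R v)) has_real_derivative pd v f (x + t *\<^sub>R v)) (at t)"
proof -
  have "((\<lambda>t. x + t *\<^sub>R v) has_derivative (\<lambda>s. s *\<^sub>R v)) (at t)"
    by (auto intro!: derivative_eq_intros)
  from diff_chain_at[OF this has_derivative_pd[OF assms]]
  have "((\<lambda>t. f (x + t *\<^sub>R v)) has_derivative (\<lambda>s. pd (s *\<^sub>R v) f (x + t *\<^sub>R v))) (at t)"
    by (simp add: o_def)
  then show ?thesis
    using assms by (simp add: has_field_derivative_def pd_vec_scale mult.commute[of "pd v f _"] mult_commute_abs)
qed

text \<open>The mean value theorem is applied twice, along \<open>u\<close> to the increment of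
  \<open>f\<close> over \<open>h *\<^sub>R v\<close>, then along \<open>v\<close> to
  \<open>pd u f\<close>. The second difference is symmetric in \<open>u\<close> and
  \<open>v\<close>, which \<open>pd_commute\<close> exploits.\<close>

lemma mixed_difference:
  fixes f :: "'a::euclidean_space \<Rightarrow> real"
  assumes "0 < h" and R: "\<And>s t. 0 \<le> s \<Longrightarrow> s \<le> h \<Longrightarrow> 0 \<le> t \<Longrightarrow> t \<le> h \<Longrightarrow> x + s *\<^sub>R u + t *\<^sub>R v \<in> U"
    and f: "smooth_on f U"
  shows "\<exists>s t. 0 < s \<and> s < h \<and> 0 < t \<and> t < h \<and>
    f (x + h *\<^sub>R u + h *\<^sub>R v) - f (x + h *\<^sub>R u) - f (x + h *\<^sub>R v) + f x
      = h * h * pd v (pd u f) (x + s *\<^sub>R u + t *\<^sub>R v)"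
proof -
  define g where "g s = f ((x + h *\<^sub>R v) + s *\<^sub>R u) - f (x + s *\<^sub>R u)" for s
  have g: "(g has_real_derivative pd u f ((x + h *\<^sub>R v) + s *\<^sub>R u) - pd u f (x + s *\<^sub>R u)) (at s)"
    if "0 \<le> s" "s \<le> h" for s
    unfolding g_def
    by (intro derivative_intros pd_line smooth_on_differentiable[OF f])
      (use R[of s 0] R[of s h] that \<open>0 < h\<close> in \<open>auto simp: algebra_simps\<close>)
  obtain s where s: "0 < s" "s < h" and
    gs: "g h - g 0 = (h - 0) * (pd u f ((x + h *\<^sub>R v) + s *\<^sub>R u) - pd u f (x + s *\<^sub>R u))"
    using MVT2[OF \<open>0 < h\<close> g] by blast
  have k: "((\<lambda>t. pd u f ((x + s *\<^sub>R u) + t *\<^sub>R v)) has_real_derivative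
      pd v (pd u f) ((x + s *\<^sub>R u) + t *\<^sub>R v)) (at t)" if "0 \<le> t" "t \<le> h" for t
    by (intro pd_line smooth_on_differentiable[OF smooth_on_pd[OF f]]) (use R s that in auto)
  obtain t where t: "0 < t" "t < h" and
    "pd u f ((x + s *\<^sub>R u) + h *\<^sub>R v) - pd u f ((x + s *\<^sub>R u) + 0 *\<^sub>R v)
      = (h - 0) * pd v (pd u f) ((x + s *\<^sub>R u) + t *\<^sub>R v)"
    using MVT2[OF \<open>0 < h\<close> k] by blast
  with gs have "g h - g 0 = h * h * pd v (pd u f) (x + s *\<^sub>R u + t *\<^sub>R v)"
    by (simp add: algebra_simps)
  then show ?thesis using s t unfolding g_def by (intro exI[of _ s] exI[of _ t]) (auto simp: algebra_simps)
qed

text \<open>The second difference equals \<open>h * h\<close> times either iterated derivative, each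
  taken at some point of a small parallelogram. Continuity of both at \<open>x\<close> then excludes
  two different values there.\<close>

lemma pd_commute:
  fixes f :: "'a::euclidean_space \<Rightarrow> real"
  assumes U: "open U" "x \<in> U" and f: "smooth_on f U"
  shows "pd u (pd v f) x = pd v (pd u f) x"
proof (rule ccontr)
  let ?a = "pd v (pd u f)" and ?b = "pd u (pd v f)"
  assume ne: "?b x \<noteq> ?a x"
  define e where "e = \<bar>?b x - ?a x\<bar> / 2"
  have e: "e > 0" using ne by (simp add: e_def)
  have "continuous_on U ?a" "continuous_on U ?b"
    using f smooth_on_pd smooth_on_continuous by blast+
  then have "isCont ?a x" "isCont ?b x" using U by (auto simp: continuous_on_eq_continuous_at)
  then obtain d1 d2 where d: "d1 > 0" "d2 > 0" "\<forall>y. dist y x < d1 \<longrightarrow> \<bar>?a y - ?a x\<bar> < e"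
      "\<forall>y. dist y x < d2 \<longrightarrow> \<bar>?b y - ?b x\<bar> < e"
    using e unfolding continuous_at_eps_delta dist_real_def by metis
  obtain d3 where d3: "d3 > 0" "ball x d3 \<subseteq> U" using U open_contains_ball by metis
  define d where "d = min d1 (min d2 d3)"
  \<comment> \<open>This keeps the whole parallelogram within \<open>d / 2\<close> of
    \<open>x\<close>; the summand 1 covers \<open>u = v = 0\<close>.\<close>
  define h where "h = d / (2 * (norm u + norm v + 1))"
  have d0: "d > 0" using d d3 by (simp add: d_def)
  have pos: "norm u + norm v + 1 > 0" by (simp add: add_nonneg_pos)
  have h0: "h > 0" using d0 pos by (simp add: h_def)
  have near: "dist (x + s *\<^sub>R u + t *\<^sub>R v) x < d" if "0 \<le> s" "s \<le> h" "0 \<le> t" "t \<le> h" for s t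
  proof -
    have "dist (x + s *\<^sub>R u + t *\<^sub>R v) x = norm (s *\<^sub>R u + t *\<^sub>R v)" by (simp add: dist_norm)
    also have "\<dots> \<le> s * norm u + t * norm v" using norm_triangle_ineq[of "s *\<^sub>R u" "t *\<^sub>R v"] that by simp
    also have "\<dots> \<le> h * (norm u + norm v + 1)"
      using that h0 mult_right_mono[of s h "norm u"] mult_right_mono[of t h "norm v"]
      by (simp add: algebra_simps)
    also have "\<dots> = d / 2" unfolding h_def using pos by (metis nonzero_eq_divide_eq order_less_irrefl divide_divide_eq_left mult.commute)
    finally show ?thesis using d0 by simp
  qed
  have inU: "x + s *\<^sub>R u + t *\<^sub>R v \<in> U" if "0 \<le> s" "s \<le> h" "0 \<le> t" "t \<le> h" for s t
    using near[OF that] d3 by (auto simp: d_def dist_commute)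
  obtain s t where st: "0 < s" "s < h" "0 < t" "t < h"
    "f (x + h *\<^sub>R u + h *\<^sub>R v) - f (x + h *\<^sub>R u) - f (x + h *\<^sub>R v) + f x
      = h * h * ?a (x + s *\<^sub>R u + t *\<^sub>R v)"
    using mixed_difference[OF h0 inU f] by blast
  have inU': "x + s *\<^sub>R v + t *\<^sub>R u \<in> U" if "0 \<le> s" "s \<le> h" "0 \<le> t" "t \<le> h" for s t
    using inU[of t s] that by (simp add: algebra_simps)
  obtain s' t' where st': "0 < s'" "s' < h" "0 < t'" "t' < h"
    "f (x + h *\<^sub>R v + h *\<^sub>R u) - f (x + h *\<^sub>R v) - f (x + h *\<^sub>R u) + f x
      = h * h * ?b (x + s' *\<^sub>R v + t' *\<^sub>R u)"
    using mixed_difference[OF h0 inU' f] by blast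
  have "h * h * ?a (x + s *\<^sub>R u + t *\<^sub>R v) = h * h * ?b (x + s' *\<^sub>R v + t' *\<^sub>R u)"
    using st(5) st'(5) by (simp add: algebra_simps)
  then have "?a (x + s *\<^sub>R u + t *\<^sub>R v) = ?b (x + t' *\<^sub>R u + s' *\<^sub>R v)"
    using h0 by (simp add: algebra_simps)
  moreover have "\<bar>?a (x + s *\<^sub>R u + t *\<^sub>R v) - ?a x\<bar> < e"
    using d near[of s t] st by (auto simp: d_def)
  moreover have "\<bar>?b (x + t' *\<^sub>R u + s' *\<^sub>R v) - ?b x\<bar> < e"
    using d near[of t' s'] st' by (auto simp: d_def)
  ultimately show False unfolding e_def by (simp add: abs_if split: if_splits)
qed

lemma hessian_Sym2:
  assumes U: "open U" "x \<in> U" and f: "smooth_on f U"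
  shows "hessian f x \<in> Sym2"
proof -
  have d: "pd v f differentiable (at x)" for v
    using U f smooth_on_pd smooth_on_differentiable by blast
  have sym: "hessian f x u v = hessian f x v u" for u v
    using pd_commute[OF U f] by (simp add: hessian_eq_pd)
  have lin: "linear (\<lambda>u. hessian f x u v)" for v
    unfolding hessian_eq_pd by (rule linearI) (auto simp: pd_vec_add pd_vec_scale d)
  moreover have "linear (hessian f x u)" for u
    using lin[of u] sym by (simp add: linear_iff)
  ultimately show ?thesis using sym by (auto simp: Sym2_def bilinear_def)
qed

lemma hessian_add:
  assumes U: "open U" "x \<in> U" and f: "smooth_on f U" and g: "smooth_on g U"
  shows "hessian (\<lambda>x. f x + g x) x u v = hessian f x u v + hessian g x u v"
proof -
  have "pd u (pd v (\<lambda>x. f x + g x)) x = pd u (\<lambda>x. pd v f x + pd v g x) x"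
    by (rule pd_cong[OF U]) (use f g smooth_on_differentiable in \<open>blast intro: pd_add\<close>)
  also have "\<dots> = pd u (pd v f) x + pd u (pd v g) x"
    using U f g smooth_on_pd smooth_on_differentiable by (blast intro: pd_add)
  finally show ?thesis by (simp add: hessian_eq_pd)
qed

lemma hessian_cmult:
  assumes U: "open U" "x \<in> U" and f: "smooth_on f U"
  shows "hessian (\<lambda>x. c * f x) x u v = c * hessian f x u v"
proof -
  have "pd u (pd v (\<lambda>x. c * f x)) x = pd u (\<lambda>x. c * pd v f x) x"
    by (rule pd_cong[OF U]) (use f smooth_on_differentiable in \<open>blast intro: pd_cmult\<close>)
  also have "\<dots> = c * pd u (pd v f) x"
    using U f smooth_on_pd smooth_on_differentiable by (blast intro: pd_cmult)
  finally show ?thesis by (simp add: hessian_eq_pd)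
qed

lemma hessian_const: "hessian (\<lambda>x. c) x u v = 0"
  by (simp add: hessian_eq_pd pd_const[abs_def])

text \<open>Minimality is asked only along one line, because extrema are later taken over discs of
  lower dimension. A negative second derivative would make the first derivative, which vanishes at
  \<open>x\<close>, negative just to the right, and the mean value theorem would give a smaller
  value.\<close>

lemma hessian_diag_nonneg_at_min:
  assumes U: "open U" "x \<in> U" and f: "smooth_on f U"
    and min: "\<And>t. x + t *\<^sub>R v \<in> U \<Longrightarrow> f x \<le> f (x + t *\<^sub>R v)"
  shows "0 \<le> hessian f x v v"
proof (rule ccontr)
  assume neg: "\<not> 0 \<le> hessian f x v v"
  define g where "g t = f (x + t *\<^sub>R v)" for t
  define g' where "g' t = pd v f (x + t *\<^sub>R v)" for t
  have "open ((\<lambda>t. x + t *\<^sub>R v) -` U)"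
    by (rule open_vimage[OF U(1)]) (intro continuous_intros)
  then obtain r where r: "r > 0" "ball 0 r \<subseteq> (\<lambda>t. x + t *\<^sub>R v) -` U"
    using U by (auto simp: open_contains_ball dest: bspec[where x=0])
  have inU: "x + t *\<^sub>R v \<in> U" if "\<bar>t\<bar> < r" for t
    using r that by (auto simp: subset_iff)
  have g: "(g has_real_derivative g' t) (at t)" if "\<bar>t\<bar> < r" for t
    unfolding g_def g'_def by (intro pd_line smooth_on_differentiable[OF f] inU that)
  have g0: "g' 0 = 0"
    by (rule DERIV_local_min[OF g, of 0 r]) (use r min inU in \<open>auto simp: g_def\<close>)
  have "(g' has_real_derivative pd v (pd v f) (x + 0 *\<^sub>R v)) (at 0)"
    unfolding g'_def by (intro pd_line smooth_on_differentiable[OF smooth_on_pd[OF f]] inU) (use r in auto)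
  then have "(g' has_real_derivative hessian f x v v) (at 0)" by (simp add: hessian_eq_pd)
  from DERIV_neg_dec_right[OF this] neg obtain d where d: "d > 0" "\<forall>h>0. h < d \<longrightarrow> g' h < g' 0"
    by auto
  define h where "h = min d r / 2"
  have h: "0 < h" "h < d" "h < r" using d r by (auto simp: h_def)
  obtain z where z: "0 < z" "z < h" "g h - g 0 = (h - 0) * g' z"
    using MVT2[of 0 h g g'] h g by auto
  have "g' z < 0" using d z h g0 by auto
  then have "g h < g 0" using z h mult_pos_neg[of h "g' z"] by simp
  then show False using min[of h] inU[of h] h by (simp add: g_def)
qed

section \<open>Harmonic polynomials on discs\<close>

abbreviation rpf :: "('a::euclidean_space \<Rightarrow> real) \<Rightarrow> bool" where
  "rpf \<equiv> real_polynomial_function"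

lemma rpf_smooth: "rpf p \<Longrightarrow> smooth_on p UNIV"
  by (simp add: smooth_on_polynomial)

lemma rpf_differentiable: "rpf p \<Longrightarrow> p differentiable (at x)"
  using rpf_smooth smooth_on_differentiable by blast

lemma rpf_continuous: "rpf p \<Longrightarrow> continuous_on S p"
  using rpf_smooth smooth_on_continuous continuous_on_subset by blast

lemma rpf_pd: "rpf p \<Longrightarrow> rpf (pd v p)"
proof (induction rule: real_polynomial_function.induct)
  case (linear f)
  then have "pd v f = (\<lambda>x. f v)"
    by (intro ext pd_eqI bounded_linear_imp_has_derivative)
  then show ?case by (simp add: real_polynomial_function.intros(2))
next
  case (const c)
  have "pd v (\<lambda>x. c) = (\<lambda>x. 0)" by (simp add: fun_eq_iff pd_const)
  then show ?case by (simp add: real_polynomial_function.intros(2))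
next
  case (add f g)
  then have "pd v (\<lambda>x. f x + g x) = (\<lambda>x. pd v f x + pd v g x)"
    by (simp add: fun_eq_iff pd_add rpf_differentiable)
  then show ?case using add by auto
next
  case (mult f g)
  then have "pd v (\<lambda>x. f x * g x) = (\<lambda>x. f x * pd v g x + pd v f x * g x)"
    by (simp add: fun_eq_iff pd_mult rpf_differentiable)
  then show ?case using mult by auto
qed

lemma rpf_cmult: "rpf p \<Longrightarrow> rpf (\<lambda>x. c * p x)"
  by (rule real_polynomial_function.intros(4)[OF real_polynomial_function.intros(2)])

lemma rpf_add: "rpf p \<Longrightarrow> rpf q \<Longrightarrow> rpf (\<lambda>x. p x + q x)"
  by (rule real_polynomial_function.intros(3))

lemma rpf_inner: "rpf (\<lambda>x. a \<bullet> (x - y))"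
proof -
  have "rpf (\<lambda>x. a \<bullet> x)" by (rule real_polynomial_function.intros(1)) (rule bounded_linear_inner_right)
  then show ?thesis by (simp add: inner_diff_right real_polynomial_function_diff real_polynomial_function.intros(2))
qed

lemma pd_power:
  assumes "f differentiable (at x)"
  shows "pd v (\<lambda>x. f x ^ k) x = real k * f x ^ (k - 1) * pd v f x"
  by (rule pd_eqI) (use has_derivative_power[OF has_derivative_pd[OF assms], of k] in \<open>simp add: mult_ac\<close>)

lemma pd_inner: "pd v (\<lambda>x. a \<bullet> (x - y)) x = a \<bullet> v"
  by (rule pd_eqI) (auto intro!: derivative_eq_intros)

lemma hessian_mult:
  assumes f: "smooth_on f UNIV" and g: "smooth_on g UNIV"
  shows "hessian (\<lambda>x. f x * g x) x u v
    = f x * hessian g x u v + pd u f x * pd v g x + pd v f x * pd u g x + hessian f x u v * g x"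
proof -
  note d = smooth_on_differentiable[OF f] smooth_on_differentiable[OF g]
    smooth_on_differentiable[OF smooth_on_pd[OF f]] smooth_on_differentiable[OF smooth_on_pd[OF g]]
  have "pd v (\<lambda>x. f x * g x) = (\<lambda>x. f x * pd v g x + pd v f x * g x)"
    using d by (simp add: fun_eq_iff pd_mult)
  then show ?thesis
    using d unfolding hessian_eq_pd by (simp add: pd_add pd_mult)
qed

text \<open>The condition \<open>ne\<close> gives \<open>card B > 0\<close>, hence a strictly
  positive Laplacian of \<open>Q\<close>; this is the source of strictness in the perturbation
  arguments on discs.\<close>

locale orthonormal_frame =
  fixes B :: "'a::euclidean_space set"
  assumes orth: "pairwise orthogonal B" and unit: "\<And>b. b \<in> B \<Longrightarrow> norm b = 1" and ne: "B \<noteq> {}"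
begin

lemma onb: "orthonormal_basis_of (span B) B"
  using orth unit by (simp add: orthonormal_basis_of_def)

lemma finB: "finite B"
  using onb by (rule orthonormal_basis_of_finite)

lemma inner_frame: "b \<in> B \<Longrightarrow> c \<in> B \<Longrightarrow> b \<bullet> c = (if b = c then 1 else 0)"
  using orth unit by (auto simp: pairwise_def orthogonal_def dot_square_norm)

lemma expand: "x \<in> span B \<Longrightarrow> (\<Sum>b\<in>B. (x \<bullet> b) *\<^sub>R b) = x"
  using orthonormal_basis_of_expand[OF onb] .

lemma parseval:
  assumes "x \<in> span B" shows "(\<Sum>b\<in>B. (x \<bullet> b) * (z \<bullet> b)) = x \<bullet> z"
proof -
  have "x \<bullet> z = (\<Sum>b\<in>B. (x \<bullet> b) *\<^sub>R b) \<bullet> z" using expand[OF assms] by simp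
  then show ?thesis by (simp add: inner_sum_left inner_commute[of z])
qed

definition prj :: "'a \<Rightarrow> 'a" where "prj x = (\<Sum>b\<in>B. (x \<bullet> b) *\<^sub>R b)"

text \<open>The squared length of the projection of \<open>x - y\<close> to \<open>span B\<close>: a
  polynomial on the whole space that agrees with the squared distance to \<open>y\<close> on the
  discs around \<open>y\<close>.\<close>

definition Q :: "'a \<Rightarrow> 'a \<Rightarrow> real" where "Q y x = (\<Sum>b\<in>B. ((x - y) \<bullet> b)\<^sup>2)"

definition lap :: "('a \<Rightarrow> real) \<Rightarrow> 'a \<Rightarrow> real" where "lap f x = (\<Sum>b\<in>B. hessian f x b b)"

definition disc :: "'a \<Rightarrow> real \<Rightarrow> 'a set" where "disc y r = {x. x - y \<in> span B \<and> norm (x - y) \<le> r}"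

definition circ :: "'a \<Rightarrow> real \<Rightarrow> 'a set" where "circ y r = {x. x - y \<in> span B \<and> norm (x - y) = r}"

text \<open>The equation is imposed on the whole space and not only on one disc, so that
  \<open>harm\<close> is stable under translations and derivatives in directions outside
  \<open>span B\<close>.\<close>

definition harm :: "('a \<Rightarrow> real) \<Rightarrow> bool" where "harm h \<longleftrightarrow> rpf h \<and> (\<forall>x. lap h x = 0)"

lemma prj_span: "prj x \<in> span B"
  unfolding prj_def by (intro span_sum span_scale span_base)

lemma prj_inner: "b \<in> B \<Longrightarrow> prj x \<bullet> b = x \<bullet> b"
  unfolding prj_def inner_sum_left using finB
  by (simp add: inner_frame sum.delta' if_distrib cong: if_cong)

lemma Q_norm: "Q y x = (norm (prj (x - y)))\<^sup>2"
  using parseval[OF prj_span, of "x - y" "prj (x - y)"]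
  by (simp add: Q_def prj_inner dot_square_norm power2_eq_square)

lemma Q_norm_span: "x - y \<in> span B \<Longrightarrow> Q y x = (norm (x - y))\<^sup>2"
  by (simp add: Q_norm prj_def expand)

lemma norm_decomp: "(norm (x - y))\<^sup>2 = Q y x + (norm (x - y - prj (x - y)))\<^sup>2"
proof -
  have "prj (x - y) \<bullet> (x - y) = Q y x"
    using parseval[OF prj_span, of "x - y" "x - y"] by (simp add: Q_def prj_inner power2_eq_square)
  then show ?thesis
    using Q_norm[of y x] by (simp add: power2_norm_eq_inner inner_diff inner_commute)
qed

lemma rpf_Q: "rpf (Q y)"
proof -
  have "rpf (\<lambda>x. \<Sum>b\<in>B. (b \<bullet> (x - y))\<^sup>2)"
    by (intro real_polynomial_function_sum finB real_polynomial_function_power rpf_inner)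
  then show ?thesis by (simp add: Q_def[abs_def] inner_commute)
qed

lemma circ_disc: "circ y r \<subseteq> disc y r" by (auto simp: circ_def disc_def)

lemma disc_compact: "compact (disc y r)"
proof -
  have "disc y r = (\<lambda>z. y + z) ` (span B \<inter> cball 0 r)"
  proof (intro equalityI subsetI)
    fix x assume "x \<in> disc y r"
    then show "x \<in> (\<lambda>z. y + z) ` (span B \<inter> cball 0 r)"
      by (intro image_eqI[of _ _ "x - y"]) (auto simp: disc_def)
  qed (auto simp: disc_def)
  moreover have "compact (span B \<inter> cball 0 r)"
    by (intro closed_Int_compact closed_span compact_cball)
  ultimately show ?thesis using compact_translation[of "span B \<inter> cball 0 r" y] by simp
qed

lemma circ_compact: "compact (circ y r)"
proof -
  have "circ y r = disc y r \<inter> {x. norm (x - y) = r}" by (auto simp: disc_def circ_def)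
  moreover have "closed {x. norm (x - y) = r}" by (intro closed_Collect_eq continuous_intros)
  ultimately show ?thesis using compact_Int_closed[OF disc_compact] by simp
qed

lemma lap_add:
  "open U \<Longrightarrow> x \<in> U \<Longrightarrow> smooth_on f U \<Longrightarrow> smooth_on g U \<Longrightarrow> lap (\<lambda>x. f x + g x) x = lap f x + lap g x"
  by (simp add: lap_def hessian_add sum.distrib)

lemma lap_cmult:
  "open U \<Longrightarrow> x \<in> U \<Longrightarrow> smooth_on f U \<Longrightarrow> lap (\<lambda>x. c * f x) x = c * lap f x"
  by (simp add: lap_def hessian_cmult sum_distrib_left)

lemma lap_const: "lap (\<lambda>x. c) x = 0"
  by (simp add: lap_def hessian_const)

lemma lap_mult:
  assumes "rpf f" "rpf g"
  shows "lap (\<lambda>x. f x * g x) x = f x * lap g x + 2 * (\<Sum>b\<in>B. pd b f x * pd b g x) + lap f x * g x"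
  unfolding lap_def
  by (simp add: hessian_mult rpf_smooth assms sum.distrib sum_distrib_left sum_distrib_right algebra_simps)

lemma lap_power:
  assumes p: "rpf p"
  shows "lap (\<lambda>x. p x ^ k) x = real k * p x ^ (k - 1) * lap p x
    + real k * real (k - 1) * p x ^ (k - 2) * (\<Sum>b\<in>B. (pd b p x)\<^sup>2)"
proof -
  have "hessian (\<lambda>x. p x ^ k) x b b = real k * p x ^ (k - 1) * hessian p x b b
      + real k * real (k - 1) * p x ^ (k - 2) * (pd b p x)\<^sup>2" for b
  proof -
    have "pd b (\<lambda>x. p x ^ k) = (\<lambda>x. (real k * p x ^ (k - 1)) * pd b p x)"
      by (intro ext pd_power rpf_differentiable[OF p])
    moreover have "pd b (\<lambda>x. real k * p x ^ (k - 1)) x = real k * (real (k - 1) * p x ^ (k - 2) * pd b p x)"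
      using p by (simp add: pd_cmult pd_power rpf_differentiable real_polynomial_function_power numeral_2_eq_2)
    moreover have "(\<lambda>x. real k * p x ^ (k - 1)) differentiable (at x)"
      using p by (intro rpf_differentiable real_polynomial_function.intros(4) real_polynomial_function.intros(2)
          real_polynomial_function_power)
    ultimately show ?thesis
      using pd_mult[of "\<lambda>x. real k * p x ^ (k - 1)" x "pd b p" b] rpf_differentiable[OF rpf_pd[OF p]]
      by (simp add: hessian_eq_pd power2_eq_square algebra_simps)
  qed
  then show ?thesis by (simp add: lap_def sum.distrib sum_distrib_left)
qed

lemma pd_Q: "b \<in> B \<Longrightarrow> pd b (Q y) x = 2 * ((x - y) \<bullet> b)"
proof -
  assume b: "b \<in> B"
  have "pd b (Q y) x = (\<Sum>c\<in>B. 2 * ((x - y) \<bullet> c) * (b \<bullet> c))"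
    unfolding Q_def[abs_def] by (rule pd_eqI) (auto intro!: derivative_eq_intros simp: mult_ac)
  also have "\<dots> = 2 * ((x - y) \<bullet> b)"
    using finB b by (simp add: inner_frame sum.delta' if_distrib cong: if_cong)
  finally show ?thesis .
qed

lemma lap_Q: "lap (Q y) x = 2 * card B"
proof -
  have "hessian (Q y) x b b = 2" if b: "b \<in> B" for b
  proof -
    have "pd b (Q y) = (\<lambda>x. 2 * (b \<bullet> (x - y)))" using pd_Q[OF b] by (auto simp: inner_commute)
    then show ?thesis
      using unit[OF b] pd_cmult[of "\<lambda>x. b \<bullet> (x - y)" x b 2] rpf_differentiable[OF rpf_inner]
      by (simp add: hessian_eq_pd pd_inner dot_square_norm)
  qed
  then show ?thesis by (simp add: lap_def)
qed

lemma lap_inner: "lap (\<lambda>x. a \<bullet> (x - y)) x = 0"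
  by (simp add: lap_def hessian_eq_pd pd_inner[abs_def] pd_const)

text \<open>By the Leibniz rule: the power of \<open>Q\<close> contributes
  \<open>2 * real j + card B\<close> to the bracket, the mixed gradient term contributes
  \<open>2 * real k\<close>, and the power of the linear form gives the second summand. The
  truncated \<open>k - 2\<close> is harmless, since its coefficient is 0 for
  \<open>k < 2\<close>.\<close>

lemma lap_zonal:
  assumes a: "a \<in> span B"
  shows "lap (\<lambda>x. Q y x ^ Suc j * (a \<bullet> (x - y)) ^ k) x
    = 2 * (real j + 1) * (2 * real j + card B + 2 * real k) * (Q y x ^ j * (a \<bullet> (x - y)) ^ k)
      + real k * real (k - 1) * (norm a)\<^sup>2 * (Q y x ^ Suc j * (a \<bullet> (x - y)) ^ (k - 2))"
proof -
  let ?s = "\<lambda>x. a \<bullet> (x - y)"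
  have a2: "(\<Sum>b\<in>B. (a \<bullet> b)\<^sup>2) = (norm a)\<^sup>2"
    using parseval[OF a, of a] by (simp add: power2_eq_square dot_square_norm flip: power2_eq_square)
  have q2: "(\<Sum>b\<in>B. (pd b (Q y) x)\<^sup>2) = 4 * Q y x"
    by (simp add: pd_Q Q_def power_mult_distrib sum_distrib_left)
  have lQ: "lap (\<lambda>x. Q y x ^ Suc j) x = 2 * (real j + 1) * (card B + 2 * real j) * Q y x ^ j"
    unfolding lap_power[OF rpf_Q] q2 lap_Q by (cases j) (auto simp: algebra_simps)
  have ls: "lap (\<lambda>x. ?s x ^ k) x = real k * real (k - 1) * (norm a)\<^sup>2 * ?s x ^ (k - 2)"
    unfolding lap_power[OF rpf_inner] lap_inner pd_inner a2 by simp
  have "(\<Sum>b\<in>B. pd b (\<lambda>x. Q y x ^ Suc j) x * pd b (\<lambda>x. ?s x ^ k) x)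
      = (\<Sum>b\<in>B. 2 * (real j + 1) * Q y x ^ j * (real k * ?s x ^ (k - 1)) * ((a \<bullet> b) * ((x - y) \<bullet> b)))"
    by (intro sum.cong refl)
      (simp only: pd_power[OF rpf_differentiable[OF rpf_Q]] pd_power[OF rpf_differentiable[OF rpf_inner]]
        pd_Q pd_inner, simp add: mult_ac del: power_Suc)
  \<comment> \<open>The gradient of \<open>Q\<close> along \<open>B\<close> is twice the projection
    of \<open>x - y\<close>, so by Parseval its product with \<open>a\<close> returns the linear
    form.\<close>
  also have "\<dots> = 2 * (real j + 1) * Q y x ^ j * (real k * ?s x ^ (k - 1)) * ?s x"
    using parseval[OF a, of "x - y"] by (simp flip: sum_distrib_left)
  also have "\<dots> = 2 * (real j + 1) * real k * (Q y x ^ j * ?s x ^ k)"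
    by (cases k) auto
  finally have cr: "(\<Sum>b\<in>B. pd b (\<lambda>x. Q y x ^ Suc j) x * pd b (\<lambda>x. ?s x ^ k) x)
    = 2 * (real j + 1) * real k * (Q y x ^ j * ?s x ^ k)" .
  show ?thesis
    unfolding lap_mult[OF real_polynomial_function_power[OF rpf_Q] real_polynomial_function_power[OF rpf_inner]]
      lQ ls cr
    by (simp add: algebra_simps)
qed

lemma harm_add: "harm f \<Longrightarrow> harm g \<Longrightarrow> harm (\<lambda>x. f x + g x)"
  by (auto simp: harm_def lap_add[of UNIV] rpf_smooth)

lemma harm_cmult: "harm f \<Longrightarrow> harm (\<lambda>x. c * f x)"
  by (auto simp: harm_def lap_cmult[of UNIV] rpf_smooth)

lemma harm_const: "harm (\<lambda>x. c)"
  by (auto simp: harm_def lap_const)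

lemma harm_minus: "harm f \<Longrightarrow> harm (\<lambda>x. - f x)"
  using harm_cmult[of f "-1"] by simp

lemma harm_diff: "harm f \<Longrightarrow> harm g \<Longrightarrow> harm (\<lambda>x. f x - g x)"
  using harm_add[of f "\<lambda>x. - g x"] harm_minus[of g] by simp

text \<open>The Poisson problem with zonal right-hand side and the Dirichlet problem with boundary values
  \<open>(a \<bullet> (x - y)) ^ k\<close> are solved by a simultaneous induction on \<open>k\<close>: the Laplacian of
  \<open>Q ^ (j + 1) * s ^ k\<close> is a positive multiple of \<open>Q ^ j * s ^ k\<close> up to a term with \<open>s ^ (k - 2)\<close>.\<close>

lemma zonal_dirichlet_step:
  assumes a: "a \<in> span B"
    and u: "k \<ge> 2 \<Longrightarrow> \<exists>u. rpf u \<and> (\<forall>x. lap u x = (a \<bullet> (x - y)) ^ (k - 2)) \<and> (\<forall>x\<in>circ y r. u x = 0)"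
  shows "\<exists>h. harm h \<and> (\<forall>x\<in>circ y r. h x = (a \<bullet> (x - y)) ^ k)"
proof -
  define c where "c = real k * real (k - 1) * (norm a)\<^sup>2"
  have p: "rpf (\<lambda>x. (a \<bullet> (x - y)) ^ k)"
    by (intro real_polynomial_function_power rpf_inner)
  have l: "lap (\<lambda>x. (a \<bullet> (x - y)) ^ k) x = c * (a \<bullet> (x - y)) ^ (k - 2)" for x
    unfolding lap_power[OF rpf_inner] lap_inner pd_inner c_def
    using parseval[OF a, of a] by (simp add: power2_eq_square dot_square_norm flip: power2_eq_square)
  show ?thesis
  proof (cases "k \<ge> 2")
    case True
    then obtain u where u: "rpf u" "\<forall>x. lap u x = (a \<bullet> (x - y)) ^ (k - 2)" "\<forall>x\<in>circ y r. u x = 0"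
      using assms(2) by blast
    have pu: "rpf (\<lambda>x. - c * u x)" by (rule rpf_cmult[OF u(1)])
    \<comment> \<open>The correction by \<open>u\<close> cancels the Laplacian of the power and
      vanishes on the circle.\<close>
    have "harm (\<lambda>x. (a \<bullet> (x - y)) ^ k + - c * u x)"
      unfolding harm_def using rpf_add[OF p pu] l u(2)
        lap_add[OF open_UNIV UNIV_I rpf_smooth[OF p] rpf_smooth[OF pu]]
        lap_cmult[OF open_UNIV UNIV_I rpf_smooth[OF u(1)], of "- c"] by simp
    then show ?thesis using u by (intro exI conjI) auto
  next
    case False
    then have "c = 0" by (cases k) (auto simp: c_def)
    then show ?thesis using p l by (intro exI[of _ "\<lambda>x. (a \<bullet> (x - y)) ^ k"]) (auto simp: harm_def)
  qed
qed

lemma zonal_poisson: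
  assumes a: "a \<in> span B"
  shows "\<exists>u. rpf u \<and> (\<forall>x. lap u x = Q y x ^ j * (a \<bullet> (x - y)) ^ k) \<and> (\<forall>x\<in>circ y r. u x = 0)"
\<comment> \<open>\<open>j\<close> is generalised because the error term lowers \<open>k\<close> by
  2 but raises the power of \<open>Q\<close> by 1.\<close>
proof (induction k arbitrary: j rule: less_induct)
  case (less k)
  let ?s = "\<lambda>x. a \<bullet> (x - y)"
  obtain h where h: "harm h" "\<forall>x\<in>circ y r. h x = ?s x ^ k"
    using zonal_dirichlet_step[OF a, of k y r] less.IH[of "k - 2" 0] by auto
  define c where "c = real k * real (k - 1) * (norm a)\<^sup>2"
  define d where "d = 2 * (real j + 1) * (2 * real j + card B + 2 * real k)"
  have "card B > 0" using finB ne by (simp add: card_gt_0_iff)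
  then have d: "d > 0" unfolding d_def by (intro mult_pos_pos) auto
  have "\<exists>u. rpf u \<and> (\<forall>x. lap u x = c * (Q y x ^ Suc j * ?s x ^ (k - 2))) \<and> (\<forall>x\<in>circ y r. u x = 0)"
  proof (cases "k \<ge> 2")
    case True
    then obtain u where u: "rpf u" "\<forall>x. lap u x = Q y x ^ Suc j * ?s x ^ (k - 2)" "\<forall>x\<in>circ y r. u x = 0"
      using less.IH[of "k - 2" "Suc j"] by auto
    then show ?thesis
      by (intro exI[of _ "\<lambda>x. c * u x"]) (auto simp: lap_cmult[of UNIV] rpf_smooth)
  next
    case False
    then have "c = 0" by (cases k) (auto simp: c_def)
    then show ?thesis by (intro exI[of _ "\<lambda>x. 0"]) (auto simp: lap_const)
  qed
  then obtain u where u: "rpf u" "\<forall>x. lap u x = c * (Q y x ^ Suc j * ?s x ^ (k - 2))" "\<forall>x\<in>circ y r. u x = 0"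
    by blast
  let ?z = "\<lambda>x. Q y x ^ Suc j * ?s x ^ k"
  \<comment> \<open>On the circle \<open>Q\<close> is the constant \<open>r\<^sup>2\<close>, so
    \<open>?z\<close> has the boundary values of \<open>(r\<^sup>2) ^ Suc j * h x\<close>;
    subtracting this harmonic function restores boundary value 0. Subtracting \<open>u\<close>
    removes the error term, and \<open>1 / d\<close> normalises.\<close>
  let ?w = "\<lambda>x. (1 / d) * (?z x + (- 1) * (u x + (r\<^sup>2) ^ Suc j * h x))"
  have z: "rpf ?z"
    by (intro real_polynomial_function.intros(4) real_polynomial_function_power rpf_Q rpf_inner)
  have hh: "rpf h" "\<And>x. lap h x = 0" using h by (auto simp: harm_def)
  have p1: "rpf (\<lambda>x. (r\<^sup>2) ^ Suc j * h x)" by (rule rpf_cmult[OF hh(1)])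
  have p2: "rpf (\<lambda>x. u x + (r\<^sup>2) ^ Suc j * h x)" by (rule rpf_add[OF u(1) p1])
  have p3: "rpf (\<lambda>x. (- 1) * (u x + (r\<^sup>2) ^ Suc j * h x))" by (rule rpf_cmult[OF p2])
  have p4: "rpf (\<lambda>x. ?z x + (- 1) * (u x + (r\<^sup>2) ^ Suc j * h x))" by (rule rpf_add[OF z p3])
  have "lap ?w x = Q y x ^ j * ?s x ^ k" for x
  proof -
    have "lap ?w x = (1 / d) * lap (\<lambda>x. ?z x + (- 1) * (u x + (r\<^sup>2) ^ Suc j * h x)) x"
      by (rule lap_cmult[of UNIV], (intro open_UNIV UNIV_I rpf_smooth p4)+)
    also have "lap (\<lambda>x. ?z x + (- 1) * (u x + (r\<^sup>2) ^ Suc j * h x)) x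
        = lap ?z x + lap (\<lambda>x. (- 1) * (u x + (r\<^sup>2) ^ Suc j * h x)) x"
      by (rule lap_add[of UNIV], (intro open_UNIV UNIV_I rpf_smooth z p3)+)
    also have "lap (\<lambda>x. (- 1) * (u x + (r\<^sup>2) ^ Suc j * h x)) x
        = (- 1) * lap (\<lambda>x. u x + (r\<^sup>2) ^ Suc j * h x) x"
      by (rule lap_cmult[of UNIV], (intro open_UNIV UNIV_I rpf_smooth p2)+)
    also have "lap (\<lambda>x. u x + (r\<^sup>2) ^ Suc j * h x) x = lap u x + lap (\<lambda>x. (r\<^sup>2) ^ Suc j * h x) x"
      by (rule lap_add[of UNIV], (intro open_UNIV UNIV_I rpf_smooth p1 u(1))+)
    also have "lap (\<lambda>x. (r\<^sup>2) ^ Suc j * h x) x = (r\<^sup>2) ^ Suc j * lap h x"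
      by (rule lap_cmult[of UNIV], (intro open_UNIV UNIV_I rpf_smooth hh(1))+)
    finally show ?thesis
      using d hh u lap_zonal[OF a, of y j k x, folded c_def d_def] by simp
  qed
  moreover have "rpf ?w" by (rule rpf_cmult[OF p4])
  moreover have "?w x = 0" if "x \<in> circ y r" for x
    using that u h Q_norm_span[of x y] by (auto simp: circ_def)
  ultimately show ?case by (intro exI[of _ ?w] conjI) auto
qed

lemma zonal_dirichlet:
  assumes "a \<in> span B"
  shows "\<exists>h. harm h \<and> (\<forall>x\<in>circ y r. h x = (a \<bullet> (x - y)) ^ k)"
  using zonal_dirichlet_step[OF assms] zonal_poisson[OF assms, of y 0] by simp

section \<open>The Dirichlet problem for continuous boundary values, up to a uniform error\<close>

definition approximable :: "'a \<Rightarrow> real \<Rightarrow> ('a \<Rightarrow> real) \<Rightarrow> bool" where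
  "approximable y r F \<longleftrightarrow> (\<forall>e>0. \<exists>h. harm h \<and> (\<forall>x\<in>circ y r. \<bar>F x - h x\<bar> < e))"

lemma approximable_add:
  assumes "approximable y r F" "approximable y r G" shows "approximable y r (\<lambda>x. F x + G x)"
  unfolding approximable_def
proof (intro allI impI)
  fix e :: real assume "e > 0"
  then have e: "e / 2 > 0" by simp
  obtain f g where f: "harm f" "\<forall>x\<in>circ y r. \<bar>F x - f x\<bar> < e / 2"
    and g: "harm g" "\<forall>x\<in>circ y r. \<bar>G x - g x\<bar> < e / 2"
    using assms e unfolding approximable_def by meson
  have "\<bar>F x + G x - (f x + g x)\<bar> < e" if "x \<in> circ y r" for x
    using f(2)[rule_format, OF that] g(2)[rule_format, OF that] by linarith
  then show "\<exists>h. harm h \<and> (\<forall>x\<in>circ y r. \<bar>F x + G x - h x\<bar> < e)"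
    using harm_add[OF f(1) g(1)] by (intro exI[of _ "\<lambda>x. f x + g x"]) auto
qed

lemma approximable_cmult:
  assumes "approximable y r F" shows "approximable y r (\<lambda>x. c * F x)"
  unfolding approximable_def
proof (intro allI impI)
  fix e :: real assume e: "e > 0"
  then have "e / (\<bar>c\<bar> + 1) > 0" by (simp add: add_nonneg_pos)
  then obtain f where f: "harm f" "\<forall>x\<in>circ y r. \<bar>F x - f x\<bar> < e / (\<bar>c\<bar> + 1)"
    using assms unfolding approximable_def by meson
  have "\<bar>c * F x - c * f x\<bar> < e" if "x \<in> circ y r" for x
  proof -
    have "\<bar>c * F x - c * f x\<bar> = \<bar>c\<bar> * \<bar>F x - f x\<bar>" by (simp add: abs_mult flip: right_diff_distrib)
    also have "\<dots> \<le> \<bar>c\<bar> * (e / (\<bar>c\<bar> + 1))" using f(2) that by (intro mult_left_mono) (auto intro: less_imp_le)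
    also have "\<dots> < e" using e by (simp add: field_simps add_nonneg_pos)
    finally show ?thesis .
  qed
  then show "\<exists>h. harm h \<and> (\<forall>x\<in>circ y r. \<bar>c * F x - h x\<bar> < e)"
    using harm_cmult[OF f(1)] by (intro exI[of _ "\<lambda>x. c * f x"]) auto
qed

lemma approximable_limit:
  assumes "\<And>e. e > 0 \<Longrightarrow> \<exists>G. approximable y r G \<and> (\<forall>x\<in>circ y r. \<bar>F x - G x\<bar> < e)"
  shows "approximable y r F"
  unfolding approximable_def
proof (intro allI impI)
  fix e :: real assume "e > 0"
  then have e: "e / 2 > 0" by simp
  obtain G where G: "approximable y r G" "\<forall>x\<in>circ y r. \<bar>F x - G x\<bar> < e / 2" using assms[OF e] by blast
  obtain g where g: "harm g" "\<forall>x\<in>circ y r. \<bar>G x - g x\<bar> < e / 2"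
    using G(1) e unfolding approximable_def by meson
  have "\<bar>F x - g x\<bar> < e" if "x \<in> circ y r" for x
    using G(2)[rule_format, OF that] g(2)[rule_format, OF that] by linarith
  then show "\<exists>h. harm h \<and> (\<forall>x\<in>circ y r. \<bar>F x - h x\<bar> < e)" using g(1) by blast
qed

lemma approximable_harm: "harm h \<Longrightarrow> \<forall>x\<in>circ y r. F x = h x \<Longrightarrow> approximable y r F"
  unfolding approximable_def by force

lemma approximable_sum:
  "(\<And>i. i \<in> I \<Longrightarrow> approximable y r (F i)) \<Longrightarrow> approximable y r (\<lambda>x. \<Sum>i\<in>I. F i x)"
proof (induction I rule: infinite_finite_induct)
  case (insert i I)
  then have "approximable y r (\<lambda>x. F i x + (\<Sum>i\<in>I. F i x))" by (intro approximable_add) auto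
  then show ?case using insert by simp
qed (use approximable_harm[OF harm_const, of y r _ 0] in auto)

text \<open>The exponential is a uniform limit of polynomials in the single variable
  \<open>a \<bullet> (x - y)\<close>, which is bounded on the circle, and each power is matched
  exactly by \<open>zonal_dirichlet\<close>.\<close>

lemma approximable_exp:
  assumes a: "a \<in> span B" shows "approximable y r (\<lambda>x. exp (a \<bullet> (x - y)))"
proof (rule approximable_limit)
  fix e :: real assume e: "e > 0"
  define M where "M = norm a * \<bar>r\<bar>"
  obtain g :: "real \<Rightarrow> real" where g: "rpf g" "\<And>t. t \<in> {-M..M} \<Longrightarrow> \<bar>exp t - g t\<bar> < e"
    by (rule Stone_Weierstrass_real_polynomial_function[of "{-M..M}" exp e])
      (auto intro: continuous_intros simp: e)
  obtain c n where gc: "g = (\<lambda>t. \<Sum>i\<le>n. c i * t ^ i)"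
    using real_polynomial_function_imp_sum[OF g(1)] by blast
  have "approximable y r (\<lambda>x. (a \<bullet> (x - y)) ^ i)" for i
    using zonal_dirichlet[OF a, of y r i] approximable_harm[of _ y r "\<lambda>x. (a \<bullet> (x - y)) ^ i"] by auto
  then have "approximable y r (\<lambda>x. g (a \<bullet> (x - y)))"
    unfolding gc by (intro approximable_sum approximable_cmult)
  moreover have "\<bar>exp (a \<bullet> (x - y)) - g (a \<bullet> (x - y))\<bar> < e" if "x \<in> circ y r" for x
  proof (rule g(2))
    have "\<bar>a \<bullet> (x - y)\<bar> \<le> M"
      using Cauchy_Schwarz_ineq2[of a "x - y"] that by (auto simp: circ_def M_def)
    then show "a \<bullet> (x - y) \<in> {-M..M}" by auto
  qed
  ultimately show "\<exists>G. approximable y r G \<and> (\<forall>x\<in>circ y r. \<bar>exp (a \<bullet> (x - y)) - G x\<bar> < e)"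
    by blast
qed

text \<open>Stone-Weierstrass needs an algebra. A product of powers of two different linear forms is
  not such a power, whereas a product of two exponentials is again an exponential.\<close>

inductive exp_sum :: "'a \<Rightarrow> ('a \<Rightarrow> real) \<Rightarrow> bool" for y where
  base: "a \<in> span B \<Longrightarrow> exp_sum y (\<lambda>x. c * exp (a \<bullet> (x - y)))"
| add: "exp_sum y f \<Longrightarrow> exp_sum y g \<Longrightarrow> exp_sum y (\<lambda>x. f x + g x)"

lemma exp_sum_mult:
  assumes "exp_sum y f" "exp_sum y g" shows "exp_sum y (\<lambda>x. f x * g x)"
  using assms
proof (induction arbitrary: g)
  case (base a c)
  show ?case
    using base(2)
  proof induction
    case (base a' c')
    have "(\<lambda>x. c * exp (a \<bullet> (x - y)) * (c' * exp (a' \<bullet> (x - y)))) = (\<lambda>x. (c * c') * exp ((a + a') \<bullet> (x - y)))"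
      by (auto simp: inner_add_left exp_add)
    then show ?case using exp_sum.base[OF span_add[OF \<open>a \<in> span B\<close> base]] by simp
  next
    case (add f g)
    then show ?case using exp_sum.add[OF add.IH] by (simp add: distrib_left)
  qed
next
  case (add f1 f2)
  then show ?case
    using exp_sum.add[OF add.IH(1)[OF add.prems] add.IH(2)[OF add.prems]] by (simp add: distrib_right)
qed

lemma exp_sum_approximable: "exp_sum y f \<Longrightarrow> approximable y r f"
proof (induction rule: exp_sum.induct)
  case (base a c)
  then show ?case by (intro approximable_cmult approximable_exp)
next
  case (add f g)
  then show ?case by (intro approximable_add)
qed

lemma continuous_approximable:
  assumes F: "continuous_on (circ y r) F" shows "approximable y r F"
proof (rule approximable_limit)
  fix e :: real assume e: "e > 0"
  interpret E: function_ring_on "Collect (exp_sum y)" "circ y r"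
  proof unfold_locales
    show "continuous_on (circ y r) f" if "f \<in> Collect (exp_sum y)" for f
    proof -
      have "exp_sum y f" using that by simp
      then show ?thesis
      proof induction
        case (base a c)
        show ?case by (intro continuous_intros)
      next
        case (add f g)
        then show ?case by (intro continuous_on_add)
      qed
    qed
    show "(\<lambda>_. c) \<in> Collect (exp_sum y)" for c
      using exp_sum.base[OF span_zero, of y c] by simp
    show "\<exists>f\<in>Collect (exp_sum y). f p \<noteq> f q"
      if "p \<in> circ y r" "q \<in> circ y r" "p \<noteq> q" for p q
    proof -
      \<comment> \<open>Two points are separated by the exponential in the direction of their
        difference, which is admissible because it lies in \<open>span B\<close>.\<close>
      have "p - q = (p - y) - (q - y)" by simp
      then have "p - q \<in> span B" using that span_diff[of "p - y" B "q - y"] by (simp add: circ_def)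
      then have "exp_sum y (\<lambda>x. 1 * exp ((p - q) \<bullet> (x - y)))" by (rule exp_sum.base)
      moreover have "(p - q) \<bullet> (p - y) \<noteq> (p - q) \<bullet> (q - y)"
      proof -
        have "(p - q) \<bullet> (p - y) - (p - q) \<bullet> (q - y) = (p - q) \<bullet> (p - q)"
          by (simp add: inner_diff_left inner_diff_right)
        then show ?thesis using that(3) inner_eq_zero_iff[of "p - q"] by auto
      qed
      ultimately show ?thesis by (intro bexI[of _ "\<lambda>x. 1 * exp ((p - q) \<bullet> (x - y))"]) auto
    qed
  qed (auto simp: circ_compact exp_sum_mult exp_sum.add)
  obtain g where "g \<in> Collect (exp_sum y)" "\<And>x. x \<in> circ y r \<Longrightarrow> \<bar>F x - g x\<bar> < e"
    using E.Stone_Weierstrass_basic[OF F e] by blast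
  then show "\<exists>G. approximable y r G \<and> (\<forall>x\<in>circ y r. \<bar>F x - G x\<bar> < e)"
    using exp_sum_approximable by blast
qed

lemma dirichlet_approx:
  assumes "continuous_on (circ y r) F" "e > 0"
  obtains h where "harm h" "\<And>x. x \<in> circ y r \<Longrightarrow> \<bar>F x - h x\<bar> < e"
proof -
  obtain h where "harm h" "\<forall>x\<in>circ y r. \<bar>F x - h x\<bar> < e"
    using continuous_approximable[OF assms(1)] assms(2) unfolding approximable_def by blast
  then show ?thesis using that by blast
qed

text \<open>Adding a small multiple of \<open>Q\<close> makes the Laplacian strictly positive. A
  maximum off the circle would be a maximum along the lines in all directions of \<open>B\<close>,
  where the second derivatives are at most 0.\<close>

lemma max_principle:
  assumes U: "open U" "disc y r \<subseteq> U" and f: "smooth_on f U"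
    and l: "\<And>x. x \<in> disc y r \<Longrightarrow> 0 \<le> lap f x"
    and M: "\<And>x. x \<in> circ y r \<Longrightarrow> f x \<le> M" and x0: "x0 \<in> disc y r"
  shows "f x0 \<le> M"
proof (rule ccontr)
  assume "\<not> f x0 \<le> M"
  \<comment> \<open>Chosen so that \<open>\<eta> * r\<^sup>2\<close> is less than the excess
    \<open>f x0 - M\<close>; the perturbation then cannot move the maximum to the circle.\<close>
  define \<eta> where "\<eta> = (f x0 - M) / (2 * (r\<^sup>2 + 1))"
  have r1: "r\<^sup>2 + 1 > 0" by (simp add: add_nonneg_pos)
  have \<eta>: "\<eta> > 0" using \<open>\<not> f x0 \<le> M\<close> r1 by (simp add: \<eta>_def)
  have "\<eta> * (2 * (r\<^sup>2 + 1)) = f x0 - M" using r1 by (simp add: \<eta>_def)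
  moreover have "\<eta> * r\<^sup>2 < \<eta> * (2 * (r\<^sup>2 + 1))"
    using \<eta> by (intro mult_strict_left_mono) (auto simp: add_nonneg_pos)
  ultimately have \<eta>r: "\<eta> * r\<^sup>2 < f x0 - M" by simp
  define G where "G x = f x + \<eta> * Q y x" for x
  have sQ: "smooth_on (\<lambda>x. \<eta> * Q y x) U"
    using U(1) rpf_cmult[OF rpf_Q] smooth_on_polynomial by blast
  have sG: "smooth_on G U" unfolding G_def[abs_def] by (rule smooth_on_add[OF U(1) f sQ])
  have "continuous_on (disc y r) G"
    using sG smooth_on_continuous U(2) continuous_on_subset by blast
  then obtain x1 where x1: "x1 \<in> disc y r" "\<And>x. x \<in> disc y r \<Longrightarrow> G x \<le> G x1"
    using continuous_attains_sup[OF disc_compact] x0 by blast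
  have "f x0 \<le> G x1" using x1(2)[OF x0] \<eta> by (simp add: G_def Q_norm) (smt (verit) mult_nonneg_nonneg zero_le_power2)
  have "x1 \<notin> circ y r"
  proof
    assume c: "x1 \<in> circ y r"
    then have "Q y x1 = r\<^sup>2" using Q_norm_span by (auto simp: circ_def)
    then show False using M[OF c] \<open>f x0 \<le> G x1\<close> \<eta>r by (simp add: G_def)
  qed
  then have nx: "norm (x1 - y) < r" "x1 - y \<in> span B" using x1(1) by (auto simp: circ_def disc_def)
  define V where "V = U \<inter> ball y r"
  have V: "open V" "x1 \<in> V" using U x1(1) nx by (auto simp: V_def dist_norm norm_minus_commute)
  have sV: "smooth_on (\<lambda>x. (- 1) * G x) V"
    by (rule smooth_on_subset[OF smooth_on_cmult[OF U(1) sG]]) (auto simp: V_def)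
  have "hessian G x1 b b \<le> 0" if b: "b \<in> B" for b
  proof -
    have "0 \<le> hessian (\<lambda>x. (- 1) * G x) x1 b b"
    proof (rule hessian_diag_nonneg_at_min[OF V sV])
      fix t assume t: "x1 + t *\<^sub>R b \<in> V"
      have "x1 + t *\<^sub>R b - y = (x1 - y) + t *\<^sub>R b" by simp
      then have "x1 + t *\<^sub>R b - y \<in> span B"
        using span_add[OF nx(2) span_scale[OF span_base[OF b]]] by metis
      then have "x1 + t *\<^sub>R b \<in> disc y r"
        using t by (auto simp: disc_def V_def dist_norm norm_minus_commute)
      then show "(- 1) * G x1 \<le> (- 1) * G (x1 + t *\<^sub>R b)" using x1(2) by simp
    qed
    moreover have "hessian (\<lambda>x. (- 1) * G x) x1 b b = (- 1) * hessian G x1 b b"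
      by (rule hessian_cmult[OF V smooth_on_subset[OF sG]]) (auto simp: V_def)
    ultimately show ?thesis by simp
  qed
  then have "lap G x1 \<le> 0" unfolding lap_def by (simp add: sum_nonpos)
  moreover have "x1 \<in> U" using x1 U by auto
  then have "lap G x1 = lap f x1 + \<eta> * (2 * card B)"
    unfolding G_def[abs_def]
    using lap_add[OF U(1) _ f sQ] lap_cmult[OF U(1) _ smooth_on_polynomial[OF U(1) rpf_Q]] lap_Q by simp
  moreover have "card B > 0" using finB ne by (simp add: card_gt_0_iff)
  ultimately show False using l[OF x1(1)] \<eta> by (simp add: mult_pos_pos) (smt (verit) mult_pos_pos of_nat_0_less_iff)
qed

section \<open>Comparison with harmonic polynomials\<close>

lemma harm_smooth: "harm h \<Longrightarrow> smooth_on h UNIV"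
  by (simp add: harm_def rpf_smooth)

lemma harm_max_principle:
  assumes "harm h" "\<And>x. x \<in> circ y r \<Longrightarrow> h x \<le> M" "x \<in> disc y r"
  shows "h x \<le> M"
  using max_principle[of UNIV y r h M x] assms harm_smooth by (auto simp: harm_def)

definition subharmonic_B :: "'a set \<Rightarrow> ('a \<Rightarrow> real) \<Rightarrow> bool" where
  "subharmonic_B X w \<longleftrightarrow> (\<forall>y r h. r > 0 \<and> harm h \<and> disc y r \<subseteq> X \<and> (\<forall>x\<in>circ y r. w x \<le> h x)
      \<longrightarrow> (\<forall>x\<in>disc y r. w x \<le> h x))"

lemma subharmonic_BD:
  "subharmonic_B X w \<Longrightarrow> r > 0 \<Longrightarrow> harm h \<Longrightarrow> disc y r \<subseteq> X \<Longrightarrow> (\<And>x. x \<in> circ y r \<Longrightarrow> w x \<le> h x)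
    \<Longrightarrow> x \<in> disc y r \<Longrightarrow> w x \<le> h x"
  unfolding subharmonic_B_def by blast

text \<open>A substitute for the harmonic function with boundary values \<open>w\<close>: an
  approximation within \<open>e / 2\<close> on the circle, raised by \<open>e / 2\<close>, lies
  above \<open>w\<close> there, and comparison carries this into the disc.\<close>

lemma subharmonic_B_approx:
  assumes w: "subharmonic_B X w" "continuous_on X w" and yr: "r > 0" "disc y r \<subseteq> X" and e: "e > 0"
  obtains h where "harm h" "\<And>x. x \<in> circ y r \<Longrightarrow> w x \<le> h x \<and> h x \<le> w x + e"
    "\<And>x. x \<in> disc y r \<Longrightarrow> w x \<le> h x"
proof -
  have "continuous_on (circ y r) w" using w(2) yr(2) circ_disc continuous_on_subset by blast
  then obtain h where h: "harm h" "\<And>x. x \<in> circ y r \<Longrightarrow> \<bar>w x - h x\<bar> < e / 2"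
    using dirichlet_approx[of y r w "e / 2"] e by auto
  define k where "k x = h x + e / 2" for x
  have k: "harm k" unfolding k_def using harm_add[OF h(1) harm_const] .
  moreover have kc: "w x \<le> k x \<and> k x \<le> w x + e" if "x \<in> circ y r" for x
    using h(2)[OF that] unfolding k_def by linarith
  moreover have "w x \<le> k x" if "x \<in> disc y r" for x
    using subharmonic_BD[OF w(1) yr(1) k yr(2)] kc that by blast
  ultimately show ?thesis using that by blast
qed

text \<open>Near optimal majorants \<open>p\<close> and \<open>q\<close> of the two summands are
  added: \<open>p + q - h\<close> is harmonic and at most \<open>e\<close> on the circle, hence on
  the disc.\<close>

lemma subharmonic_B_add:
  assumes w: "subharmonic_B X w" "continuous_on X w" and v: "subharmonic_B X v" "continuous_on X v"
  shows "subharmonic_B X (\<lambda>x. w x + v x)"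
  unfolding subharmonic_B_def
proof (intro allI impI ballI, elim conjE)
  fix y r h x
  assume r: "r > 0" and h: "harm h" and D: "disc y r \<subseteq> X" and c: "\<forall>x\<in>circ y r. w x + v x \<le> h x"
    and x: "x \<in> disc y r"
  show "w x + v x \<le> h x"
  proof (rule field_le_epsilon)
    fix e :: real assume "e > 0"
    then have e: "e / 2 > 0" by simp
    obtain p where p: "harm p" "\<And>x. x \<in> circ y r \<Longrightarrow> w x \<le> p x \<and> p x \<le> w x + e / 2"
      "\<And>x. x \<in> disc y r \<Longrightarrow> w x \<le> p x" using subharmonic_B_approx[OF w r D e] by blast
    obtain q where q: "harm q" "\<And>x. x \<in> circ y r \<Longrightarrow> v x \<le> q x \<and> q x \<le> v x + e / 2"
      "\<And>x. x \<in> disc y r \<Longrightarrow> v x \<le> q x" using subharmonic_B_approx[OF v r D e] by blast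
    have "harm (\<lambda>x. p x + q x - h x)" by (intro harm_add harm_diff p q h)
    then have "p x + q x - h x \<le> e"
    proof (rule harm_max_principle[OF _ _ x])
      fix z assume z: "z \<in> circ y r"
      then show "p z + q z - h z \<le> e" using p(2)[OF z] q(2)[OF z] c[rule_format, OF z] by linarith
    qed
    then show "w x + v x \<le> h x + e" using p(3)[OF x] q(3)[OF x] by simp
  qed
qed

lemma subharmonic_B_zero: "subharmonic_B X (\<lambda>x. 0)"
  using harm_max_principle[OF harm_minus, where M = 0] by (force simp: subharmonic_B_def)

lemma subharmonic_B_cmult:
  assumes w: "subharmonic_B X w" and c: "c \<ge> 0"
  shows "subharmonic_B X (\<lambda>x. c * w x)"
proof (cases "c = 0")
  case True
  then show ?thesis using subharmonic_B_zero by simp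
next
  case False
  with c have c: "c > 0" by simp
  show ?thesis
    unfolding subharmonic_B_def
  proof (intro allI impI ballI, elim conjE)
    fix y r h x
    assume r: "r > 0" and h: "harm h" and D: "disc y r \<subseteq> X" and k: "\<forall>x\<in>circ y r. c * w x \<le> h x"
      and x: "x \<in> disc y r"
    have "w x \<le> (1 / c) * h x"
      by (rule subharmonic_BD[OF w r harm_cmult[OF h] D _ x]) (use k c in \<open>auto simp: field_simps\<close>)
    then show "c * w x \<le> h x" using c by (simp add: field_simps)
  qed
qed

lemma subharmonic_B_sum:
  assumes "\<And>i. i \<in> I \<Longrightarrow> subharmonic_B X (w i) \<and> continuous_on X (w i)"
  shows "subharmonic_B X (\<lambda>x. \<Sum>i\<in>I. w i x)"
  using assms
proof (induction I rule: infinite_finite_induct)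
  case (insert i I)
  then have "subharmonic_B X (\<lambda>x. w i x + (\<Sum>i\<in>I. w i x))"
    by (intro subharmonic_B_add continuous_on_sum) auto
  then show ?case using insert by simp
qed (simp_all add: subharmonic_B_zero)

lemma subharmonic_B_limit:
  assumes "\<And>D e. e > 0 \<Longrightarrow> compact D \<Longrightarrow> D \<subseteq> X \<Longrightarrow> \<exists>v. subharmonic_B X v \<and> (\<forall>x\<in>D. \<bar>w x - v x\<bar> \<le> e)"
  shows "subharmonic_B X w"
  unfolding subharmonic_B_def
proof (intro allI impI ballI, elim conjE)
  fix y r h x
  assume r: "r > 0" and h: "harm h" and D: "disc y r \<subseteq> X" and c: "\<forall>x\<in>circ y r. w x \<le> h x"
    and x: "x \<in> disc y r"
  show "w x \<le> h x"
  proof (rule field_le_epsilon)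
    fix e :: real assume "e > 0"
    then have e: "e / 2 > 0" by simp
    obtain v where v: "subharmonic_B X v" "\<forall>x\<in>disc y r. \<bar>w x - v x\<bar> \<le> e / 2"
      using assms[OF e disc_compact D] by blast
    have "v x \<le> h x + e / 2"
    proof (rule subharmonic_BD[OF v(1) r harm_add[OF h harm_const] D _ x])
      fix z assume z: "z \<in> circ y r"
      then show "v z \<le> h z + e / 2" using v(2)[rule_format, OF subsetD[OF circ_disc z]] c[rule_format, OF z] by linarith
    qed
    then show "w x \<le> h x + e" using v(2)[rule_format, OF x] by linarith
  qed
qed

end

section \<open>Viscosity subharmonic functions satisfy the comparison principle\<close>

lemma rpf_norm2: "rpf (\<lambda>x. (x - y) \<bullet> (x - y))"
proof -
  have "rpf (\<lambda>x. \<Sum>b\<in>Basis. (b \<bullet> (x - y))\<^sup>2)"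
    by (intro real_polynomial_function_sum finite_Basis real_polynomial_function_power rpf_inner)
  then show ?thesis by (simp add: euclidean_inner[of "x - y" "x - y" for x] inner_commute power2_eq_square)
qed

lemma hessian_norm2: "hessian (\<lambda>x. (x - y) \<bullet> (x - y)) x u v = 2 * (u \<bullet> v)"
proof -
  have "pd v (\<lambda>x. (x - y) \<bullet> (x - y)) = (\<lambda>x. 2 * (v \<bullet> (x - y)))" for v
    by (intro ext pd_eqI) (auto intro!: derivative_eq_intros simp: inner_commute)
  then show ?thesis
    using pd_cmult[OF rpf_differentiable[OF rpf_inner]] by (simp add: hessian_eq_pd pd_inner inner_commute)
qed

context orthonormal_frame
begin

lemma lap_norm2: "lap (\<lambda>x. (x - y) \<bullet> (x - y)) x = 2 * card B"
  unfolding lap_def hessian_norm2 using unit by (simp add: dot_square_norm)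

lemma lap_rpf_add: "rpf f \<Longrightarrow> rpf g \<Longrightarrow> lap (\<lambda>x. f x + g x) x = lap f x + lap g x"
  by (rule lap_add[OF open_UNIV UNIV_I]) (auto intro: rpf_smooth)

lemma lap_rpf_cmult: "rpf f \<Longrightarrow> lap (\<lambda>x. c * f x) x = c * lap f x"
  by (rule lap_cmult[OF open_UNIV UNIV_I]) (auto intro: rpf_smooth)

lemma card_pos: "card B > 0"
  using finB ne by (simp add: card_gt_0_iff)

text \<open>The squared distance from \<open>x\<close> to the affine plane
  \<open>y + span B\<close>. Bounds on \<open>Q\<close> and \<open>T\<close> together cut out a
  compact tube, the product of a disc with a ball in the orthogonal complement.\<close>

definition T :: "'a \<Rightarrow> 'a \<Rightarrow> real" where "T y x = (x - y) \<bullet> (x - y) - Q y x"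

lemma T_norm: "T y x = (norm (x - y - prj (x - y)))\<^sup>2"
  using norm_decomp[of x y] by (simp add: T_def power2_norm_eq_inner)

lemma T_eq_0: "T y x = 0 \<Longrightarrow> x - y \<in> span B"
  using T_norm prj_span by (metis eq_iff_diff_eq_0 norm_eq_zero power_zero_numeral zero_eq_power2)

lemma T_span: "x - y \<in> span B \<Longrightarrow> T y x = 0"
  by (simp add: T_norm prj_def expand)

lemma tube_subset:
  assumes s: "(\<Union>x\<in>disc y r. cball x s) \<subseteq> X" and "r > 0" "s > 0"
  shows "{x. Q y x \<le> r\<^sup>2 \<and> T y x \<le> s\<^sup>2} \<subseteq> X"
proof
  fix x assume x: "x \<in> {x. Q y x \<le> r\<^sup>2 \<and> T y x \<le> s\<^sup>2}"
  then have "norm (prj (x - y)) \<le> r" "norm (x - y - prj (x - y)) \<le> s"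
    using assms by (auto simp: Q_norm T_norm power2_le_iff_abs_le intro: power2_le_imp_le)
  then have "y + prj (x - y) \<in> disc y r" "x \<in> cball (y + prj (x - y)) s"
    by (auto simp: disc_def prj_span dist_norm norm_minus_commute algebra_simps)
  then show "x \<in> X" using s by blast
qed

lemma tube_compact: "compact {x. Q y x \<le> r\<^sup>2 \<and> T y x \<le> s\<^sup>2}"
proof -
  have cQ: "continuous_on UNIV (Q y)" by (rule rpf_continuous[OF rpf_Q])
  have cT: "continuous_on UNIV (T y)" unfolding T_def by (intro continuous_intros cQ)
  have "norm (x - y) \<le> \<bar>r\<bar> + \<bar>s\<bar>" if "Q y x \<le> r\<^sup>2" "T y x \<le> s\<^sup>2" for x
  proof (rule power2_le_imp_le)
    have "(norm (x - y))\<^sup>2 \<le> r\<^sup>2 + s\<^sup>2" using that by (simp add: T_def power2_norm_eq_inner)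
    also have "\<dots> \<le> (\<bar>r\<bar> + \<bar>s\<bar>)\<^sup>2" by (simp add: power2_sum)
    finally show "(norm (x - y))\<^sup>2 \<le> (\<bar>r\<bar> + \<bar>s\<bar>)\<^sup>2" .
  qed simp
  then have "bounded {x. Q y x \<le> r\<^sup>2 \<and> T y x \<le> s\<^sup>2}"
    by (intro bounded_subset[OF bounded_cball[of y "\<bar>r\<bar> + \<bar>s\<bar>"]])
      (auto simp: dist_norm norm_minus_commute)
  moreover have "closed {x. Q y x \<le> r\<^sup>2 \<and> T y x \<le> s\<^sup>2}"
    by (intro closed_Collect_conj closed_Collect_le cQ cT continuous_intros)
  ultimately show ?thesis by (simp add: compact_eq_bounded_closed)
qed

text \<open>The Hessian of \<open>T\<close> vanishes on \<open>span B\<close>, so adding a large multiple of \<open>T\<close> to a test function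
  confines the contact points to a thin tube around the disc without changing \<open>lap\<close>.\<close>

lemma subharmonic_on_imp_subharmonic_B:
  assumes X: "open X" and F: "\<And>A. A \<in> F \<Longrightarrow> 0 \<le> (\<Sum>b\<in>B. A b b)"
    and w: "subharmonic_on F X (\<lambda>x. ereal (w x))" "continuous_on X w"
  shows "subharmonic_B X w"
  unfolding subharmonic_B_def
proof (intro allI impI ballI, elim conjE, rule ccontr)
  fix y r h x0
  assume r: "r > 0" and h: "harm h" and D: "disc y r \<subseteq> X" and c: "\<forall>x\<in>circ y r. w x \<le> h x"
    and x0: "x0 \<in> disc y r" and neg: "\<not> w x0 \<le> h x0"
  define g where "g x = w x - h x" for x
  define \<alpha> where "\<alpha> = g x0"
  \<comment> \<open>Keeps \<open>\<eta> * Q\<close> at most \<open>\<alpha> / 4\<close> on the tube,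
    a fraction of the excess \<open>\<alpha>\<close> at \<open>x0\<close>.\<close>
  define \<eta> where "\<eta> = \<alpha> / (4 * r\<^sup>2)"
  have \<alpha>: "\<alpha> > 0" using neg by (simp add: \<alpha>_def g_def)
  have \<eta>: "\<eta> > 0" "\<eta> * r\<^sup>2 = \<alpha> / 4" using \<alpha> r by (auto simp: \<eta>_def)
  obtain s where s: "s > 0" "(\<Union>x\<in>disc y r. cball x s) \<subseteq> X"
    using compact_subset_open_imp_cball_epsilon_subset[OF disc_compact X D] by blast
  define E where "E = {x. Q y x \<le> r\<^sup>2 \<and> T y x \<le> s\<^sup>2}"
  have EX: "E \<subseteq> X" unfolding E_def by (rule tube_subset[OF s(2) r s(1)])
  have cE: "compact E" unfolding E_def by (rule tube_compact)
  have hr: "rpf h" using h by (simp add: harm_def)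
  have cg: "continuous_on E g" unfolding g_def
    by (intro continuous_on_diff rpf_continuous[OF hr] continuous_on_subset[OF w(2) EX])
  have cQ: "continuous_on S (Q y)" for S by (rule rpf_continuous[OF rpf_Q])
  have cT: "continuous_on S (T y)" for S unfolding T_def by (intro continuous_intros cQ)
  have Q0: "Q y x \<ge> 0" and T0: "T y x \<ge> 0" for x by (simp_all add: Q_norm T_norm)
  have x0E: "x0 \<in> E" "T y x0 = 0"
    using x0 T_span[of x0 y] Q_norm_span[of x0 y] r by (auto simp: E_def disc_def)
  \<comment> \<open>The part of the lateral boundary of the tube where \<open>g\<close> is not
    small. It misses the plane of the disc, since \<open>g \<le> 0\<close> on the circle, so by
    compactness \<open>T\<close> has a positive lower bound on it.\<close>
  define A where "A = {x \<in> E. Q y x = r\<^sup>2 \<and> \<alpha> / 2 \<le> g x}"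
  obtain \<tau> where \<tau>: "\<tau> > 0" "\<And>x. x \<in> A \<Longrightarrow> \<tau> \<le> T y x"
  proof (cases "A = {}")
    case True
    then show ?thesis using that[of 1] by auto
  next
    case False
    have "closed A"
    proof -
      have "A = (E \<inter> Q y -` {r\<^sup>2}) \<inter> (E \<inter> g -` {\<alpha> / 2..})" by (auto simp: A_def)
      moreover have "closed (E \<inter> Q y -` {r\<^sup>2})" "closed (E \<inter> g -` {\<alpha> / 2..})"
        by (intro continuous_closed_preimage cQ cg compact_imp_closed[OF cE] closed_singleton closed_atLeast)+
      ultimately show ?thesis by auto
    qed
    moreover have "A = E \<inter> A" by (auto simp: A_def)
    ultimately have "compact A" using compact_Int_closed[OF cE] by metis
    then obtain a where a: "a \<in> A" "\<And>x. x \<in> A \<Longrightarrow> T y a \<le> T y x"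
      using continuous_attains_inf[of A "T y"] False cT by blast
    have "T y a \<noteq> 0"
    proof
      assume "T y a = 0"
      then have sp: "a - y \<in> span B" by (rule T_eq_0)
      then have "(norm (a - y))\<^sup>2 = r\<^sup>2" using a(1) Q_norm_span by (auto simp: A_def)
      then have "a \<in> circ y r" using sp r by (simp add: circ_def power2_eq_iff_nonneg)
      then show False using c a(1) \<alpha> by (force simp: A_def g_def)
    qed
    then show ?thesis using that[of "T y a"] a(2) T0[of a] by force
  qed
  obtain x2 where x2: "x2 \<in> E" "\<And>x. x \<in> E \<Longrightarrow> g x \<le> g x2"
    using continuous_attains_sup[OF cE _ cg] x0E by blast
  define M where "M = g x2 + \<alpha>"
  have M: "\<And>x. x \<in> E \<Longrightarrow> g x \<le> M" "M > 0"
    using x2 \<alpha> x2(2)[OF x0E(1)] by (force simp: M_def \<alpha>_def)+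
  \<comment> \<open>One summand makes \<open>k * T\<close> at least \<open>M + \<alpha>\<close> on
    \<open>A\<close>, the other where \<open>T = s\<^sup>2\<close>. This outweighs
    \<open>g + \<eta> * Q\<close> there, so the maximum of \<open>G\<close> lies in the open
    tube.\<close>
  define k where "k = (M + \<alpha>) / \<tau> + (M + \<alpha>) / s\<^sup>2"
  have k0: "k > 0" unfolding k_def using M(2) \<alpha> \<tau>(1) s(1) by (intro add_pos_pos divide_pos_pos) auto
  have "k * \<tau> = M + \<alpha> + (M + \<alpha>) / s\<^sup>2 * \<tau>" "k * s\<^sup>2 = (M + \<alpha>) / \<tau> * s\<^sup>2 + (M + \<alpha>)"
    unfolding k_def distrib_right[of "(M + \<alpha>) / \<tau>"] using \<tau>(1) s(1) by simp_all
  moreover have "(M + \<alpha>) / s\<^sup>2 * \<tau> \<ge> 0" "(M + \<alpha>) / \<tau> * s\<^sup>2 \<ge> 0"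
    using M(2) \<alpha> \<tau>(1) s(1) by (intro mult_nonneg_nonneg divide_nonneg_nonneg; simp)+
  ultimately have k1: "k * \<tau> \<ge> M + \<alpha>" and k2: "k * s\<^sup>2 \<ge> M + \<alpha>" by linarith+
  define G where "G x = g x + \<eta> * Q y x - k * T y x" for x
  have "continuous_on E G" unfolding G_def by (intro continuous_intros cg cQ cT)
  then obtain x1 where x1: "x1 \<in> E" "\<And>x. x \<in> E \<Longrightarrow> G x \<le> G x1"
    using continuous_attains_sup[OF cE] x0E by blast
  have G1: "G x1 \<ge> \<alpha>"
    using x1(2)[OF x0E(1)] x0E(2) Q0[of x0] \<eta>(1) by (simp add: G_def \<alpha>_def) (smt (verit) mult_nonneg_nonneg)
  have \<eta>Q: "\<eta> * Q y x1 \<le> \<alpha> / 4" using x1(1) \<eta> mult_left_mono[of "Q y x1" "r\<^sup>2" \<eta>] by (auto simp: E_def)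
  have kT: "k * T y x1 \<ge> 0" using k0 T0 by simp
  have "T y x1 \<noteq> s\<^sup>2"
    using G1 M(1)[OF x1(1)] \<eta>Q k2 \<alpha> by (auto simp: G_def)
  moreover have "Q y x1 \<noteq> r\<^sup>2"
  proof
    assume q: "Q y x1 = r\<^sup>2"
    show False
    proof (cases "\<alpha> / 2 \<le> g x1")
      case True
      then have "\<tau> \<le> T y x1" using q x1(1) \<tau>(2) by (auto simp: A_def)
      then have "k * T y x1 \<ge> M + \<alpha>" using k0 k1 mult_left_mono[of \<tau> "T y x1" k] by linarith
      then show ?thesis using G1 M(1)[OF x1(1)] \<eta>Q \<alpha> by (auto simp: G_def)
    next
      case False
      then show ?thesis using G1 \<eta>Q kT \<alpha> by (auto simp: G_def)
    qed
  qed
  ultimately have x1V: "Q y x1 < r\<^sup>2" "T y x1 < s\<^sup>2" using x1(1) by (auto simp: E_def)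
  define V where "V = {x. Q y x < r\<^sup>2} \<inter> {x. T y x < s\<^sup>2}"
  have V: "open V" "x1 \<in> V" "V \<subseteq> E"
    using x1V unfolding V_def E_def by (auto intro!: open_Int open_Collect_less cQ cT continuous_intros)
  let ?n = "\<lambda>x. (x - y) \<bullet> (x - y)"
  \<comment> \<open>This is \<open>h - \<eta> * Q + k * T\<close> plus a constant, with
    \<open>T\<close> expanded into polynomials. It touches \<open>w\<close> from above at
    \<open>x1\<close>; the two parts of \<open>k * T\<close> cancel in the Laplacian and
    \<open>- 2 * \<eta> * card B\<close> remains.\<close>
  define \<phi> where "\<phi> x = h x + (- (\<eta> + k) * Q y x + (k * ?n x + G x1))" for x
  have p1: "rpf (\<lambda>x. k * ?n x + G x1)"
    by (intro rpf_add rpf_cmult rpf_norm2 real_polynomial_function.intros(2))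
  have p2: "rpf (\<lambda>x. - (\<eta> + k) * Q y x)" by (rule rpf_cmult[OF rpf_Q])
  have p\<phi>: "rpf \<phi>" unfolding \<phi>_def by (rule rpf_add[OF hr rpf_add[OF p2 p1]])
  have \<phi>_eq: "\<phi> x = w x + (G x1 - G x)" for x
    by (simp add: \<phi>_def G_def g_def T_def algebra_simps)
  have "hessian \<phi> x1 \<in> F"
  proof -
    have "open V \<and> x1 \<in> V \<and> V \<subseteq> X \<and> smooth_on \<phi> V \<and>
        (\<forall>x\<in>V. ereal (w x) \<le> ereal (\<phi> x)) \<and> ereal (w x1) = ereal (\<phi> x1)"
      using V EX smooth_on_polynomial[OF V(1) p\<phi>] x1(2) by (auto simp: \<phi>_eq)
    then show ?thesis using w(1) V EX unfolding subharmonic_on_def by blast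
  qed
  then have "0 \<le> lap \<phi> x1" using F by (simp add: lap_def)
  moreover have "lap \<phi> x1 = lap h x1 + (- (\<eta> + k) * lap (Q y) x1 + (k * lap ?n x1 + lap (\<lambda>x. G x1) x1))"
    unfolding \<phi>_def
    by (simp only: lap_rpf_add[OF hr rpf_add[OF p2 p1]] lap_rpf_add[OF p2 p1] lap_rpf_cmult[OF rpf_Q]
        lap_rpf_add[OF rpf_cmult[OF rpf_norm2] real_polynomial_function.intros(2)] lap_rpf_cmult[OF rpf_norm2])
  then have "lap \<phi> x1 = - 2 * \<eta> * card B"
    using h by (simp only: lap_Q lap_norm2 lap_const harm_def) (simp add: algebra_simps)
  ultimately show False using \<eta>(1) card_pos by (simp add: mult_less_0_iff mult_le_0_iff zero_le_mult_iff)
qed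

section \<open>Limits of harmonic polynomials are smooth\<close>

lemma harm_pd:
  assumes h: "harm h" shows "harm (pd v h)"
proof -
  have r: "rpf h" using h by (simp add: harm_def)
  have comm: "pd a (pd b p) = pd b (pd a p)" if "rpf p" for a b p
    using pd_commute[OF open_UNIV UNIV_I rpf_smooth[OF that]] by (simp add: fun_eq_iff)
  have "hessian (pd v h) x b b = pd v (\<lambda>x. hessian h x b b) x" for x b
    using comm[OF r, of b v] comm[OF rpf_pd[OF r], of b v] by (simp add: hessian_eq_pd[abs_def])
  moreover have "pd v (lap h) x = (\<Sum>b\<in>B. pd v (\<lambda>x. hessian h x b b) x)" for x
    unfolding lap_def[abs_def]
    by (rule pd_eqI) (auto intro!: derivative_eq_intros has_derivative_pd rpf_differentiable rpf_pd r
        simp: hessian_eq_pd[abs_def])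
  moreover have "lap h = (\<lambda>x. 0)" using h by (auto simp: harm_def)
  ultimately show ?thesis using rpf_pd[OF r] by (simp add: harm_def lap_def pd_const)
qed

text \<open>Bernstein's argument: with \<open>w = pd b h\<close> the function \<open>(d\<^sup>2 - Q)\<^sup>2 w\<^sup>2 + C h\<^sup>2\<close> is subharmonic
  for \<open>C\<close> large, because \<open>lap (h\<^sup>2)\<close> dominates \<open>2 w\<^sup>2\<close>.\<close>

lemma harm_gradient_bound:
  fixes M :: real
  assumes h: "harm h" and d: "d > 0" and b: "b \<in> B" and M: "\<And>x. x \<in> circ y d \<Longrightarrow> \<bar>h x\<bar> \<le> M"
  shows "(d * pd b h y)\<^sup>2 \<le> (2 * real (card B) + 16) * M\<^sup>2"
proof -
  \<comment> \<open>\<open>2 * C\<close> has to dominate \<open>24 * Q + 4 * card B * \<eta>\<close>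
    on the disc, where \<open>Q\<close> and \<open>\<eta>\<close> are both at most
    \<open>d\<^sup>2\<close>.\<close>
  define C where "C = (2 * real (card B) + 16) * d\<^sup>2"
  define w where "w = pd b h"
  define \<eta> where "\<eta> x = d\<^sup>2 + (- 1) * Q y x" for x
  have hr: "rpf h" and hl: "\<And>x. lap h x = 0" using h by (auto simp: harm_def)
  have wr: "rpf w" and wl: "\<And>x. lap w x = 0" using harm_pd[OF h, of b] by (auto simp: harm_def w_def)
  have mr: "rpf (\<lambda>x. (- 1) * Q y x)" by (rule rpf_cmult[OF rpf_Q])
  have \<eta>r: "rpf \<eta>" unfolding \<eta>_def by (rule rpf_add[OF real_polynomial_function.intros(2) mr])
  have \<eta>l: "lap \<eta> x = - 2 * card B" for x
    unfolding \<eta>_def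
    by (simp add: lap_rpf_add[OF real_polynomial_function.intros(2) mr, simplified]
        lap_rpf_cmult[OF rpf_Q, of "- 1", simplified] lap_Q lap_const)
  have \<eta>d: "pd c \<eta> x = - pd c (Q y) x" for c x
    unfolding \<eta>_def
    using pd_add[OF _ rpf_differentiable[OF mr], of "\<lambda>x. d\<^sup>2" x c]
      pd_cmult[OF rpf_differentiable[OF rpf_Q], of c "- 1"] by (simp add: pd_const)
  have \<eta>q: "(\<Sum>c\<in>B. (pd c \<eta> x)\<^sup>2) = 4 * Q y x" for x
    by (simp add: \<eta>d pd_Q Q_def power_mult_distrib sum_distrib_left)
  have sq: "lap (\<lambda>x. p x ^ 2) x = 2 * p x * lap p x + 2 * (\<Sum>c\<in>B. (pd c p x)\<^sup>2)" if "rpf p" for p x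
    using lap_power[OF that, of 2 x] by simp
  have ps: "pd c (\<lambda>x. p x ^ 2) x = 2 * p x * pd c p x" if "rpf p" for p c x
    using pd_power[OF rpf_differentiable[OF that], of c 2] by simp
  define \<psi> where "\<psi> x = \<eta> x ^ 2 * w x ^ 2 + C * h x ^ 2" for x
  have r1: "rpf (\<lambda>x. \<eta> x ^ 2 * w x ^ 2)" and r2: "rpf (\<lambda>x. C * h x ^ 2)"
    by (intro real_polynomial_function.intros(4) real_polynomial_function_power \<eta>r wr)
      (intro rpf_cmult real_polynomial_function_power hr)
  have l\<psi>: "lap \<psi> x = (\<eta> x)\<^sup>2 * (2 * (\<Sum>c\<in>B. (pd c w x)\<^sup>2))
      + 2 * (\<Sum>c\<in>B. (2 * \<eta> x * pd c \<eta> x) * (2 * w x * pd c w x))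
      + (2 * \<eta> x * (- 2 * card B) + 2 * (4 * Q y x)) * (w x)\<^sup>2 + C * (2 * (\<Sum>c\<in>B. (pd c h x)\<^sup>2))" for x
    unfolding \<psi>_def
    by (simp only: lap_rpf_add[OF r1 r2] lap_rpf_cmult[OF real_polynomial_function_power[OF hr]]
        lap_mult[OF real_polynomial_function_power[OF \<eta>r] real_polynomial_function_power[OF wr]]
        sq[OF \<eta>r] sq[OF wr] sq[OF hr] ps[OF \<eta>r] ps[OF wr] \<eta>l \<eta>q hl wl)
      simp
  have "\<psi> y \<le> C * M\<^sup>2"
  proof (rule max_principle[OF open_UNIV subset_UNIV rpf_smooth])
    show "rpf \<psi>" unfolding \<psi>_def by (rule rpf_add[OF r1 r2])
    show "y \<in> disc y d" using d by (simp add: disc_def span_zero)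
    show "\<psi> x \<le> C * M\<^sup>2" if x: "x \<in> circ y d" for x
    proof -
      have "\<eta> x = 0" using x Q_norm_span by (auto simp: circ_def \<eta>_def)
      moreover have "(h x)\<^sup>2 \<le> M\<^sup>2" using M[OF x] by (simp add: abs_le_square_iff[symmetric])
      ultimately show ?thesis using mult_left_mono[of "(h x)\<^sup>2" "M\<^sup>2" C] by (simp add: \<psi>_def C_def)
    qed
    show "0 \<le> lap \<psi> x" if x: "x \<in> disc y d" for x
    proof -
      have q: "Q y x \<le> d\<^sup>2" "Q y x \<ge> 0"
        using x Q_norm_span[of x y] by (auto simp: disc_def intro: power_mono)
      then have e: "0 \<le> \<eta> x" "\<eta> x \<le> d\<^sup>2" by (auto simp: \<eta>_def)
      define S where "S = (\<Sum>c\<in>B. (pd c h x)\<^sup>2)"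
      have S: "(w x)\<^sup>2 \<le> S" unfolding S_def w_def using b finB by (intro member_le_sum) auto
      \<comment> \<open>Completing the square absorbs the mixed gradient term at the cost of
        \<open>32 * Q y x * (w x)\<^sup>2\<close>, of which the Laplacian of
        \<open>\<eta>\<^sup>2\<close> gives back a quarter.\<close>
      have "0 \<le> 2 * (\<Sum>c\<in>B. (\<eta> x * pd c w x + 2 * w x * pd c \<eta> x)\<^sup>2)"
        by (intro mult_nonneg_nonneg sum_nonneg) auto
      also have "(\<Sum>c\<in>B. (\<eta> x * pd c w x + 2 * w x * pd c \<eta> x)\<^sup>2)
        = (\<eta> x)\<^sup>2 * (\<Sum>c\<in>B. (pd c w x)\<^sup>2) + (\<Sum>c\<in>B. (2 * \<eta> x * pd c \<eta> x) * (2 * w x * pd c w x))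
          + 4 * (w x)\<^sup>2 * (\<Sum>c\<in>B. (pd c \<eta> x)\<^sup>2)"
        by (simp add: sum_distrib_left sum.distrib[symmetric]) (intro sum.cong refl, simp add: power2_sum power_mult_distrib)
      finally have "lap \<psi> x \<ge> (w x)\<^sup>2 * (- 24 * Q y x - 4 * card B * \<eta> x) + 2 * C * S"
        unfolding l\<psi> \<eta>q S_def[symmetric] by (simp add: algebra_simps)
      moreover have "2 * C * S \<ge> 2 * C * (w x)\<^sup>2"
        using S by (intro mult_left_mono) (auto simp: C_def)
      moreover have "(w x)\<^sup>2 * (24 * Q y x + 4 * card B * \<eta> x) \<le> (w x)\<^sup>2 * (2 * C)"
      proof (rule mult_left_mono)
        have "4 * real (card B) * \<eta> x \<le> 4 * real (card B) * d\<^sup>2" using e by (intro mult_left_mono) auto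
        then show "24 * Q y x + 4 * card B * \<eta> x \<le> 2 * C" using q by (simp add: C_def distrib_right)
      qed simp
      ultimately show ?thesis by (simp add: algebra_simps)
    qed
  qed
  moreover have "\<eta> y = d\<^sup>2" by (simp add: \<eta>_def Q_def)
  moreover have "C * (h y)\<^sup>2 \<ge> 0" by (simp add: C_def)
  ultimately have "(d\<^sup>2)\<^sup>2 * (w y)\<^sup>2 \<le> C * M\<^sup>2" by (simp add: \<psi>_def)
  then have "d\<^sup>2 * (d * w y)\<^sup>2 \<le> d\<^sup>2 * ((2 * real (card B) + 16) * M\<^sup>2)"
    by (simp add: C_def power2_eq_square algebra_simps)
  then show ?thesis using d by (simp add: w_def)
qed

end

interpretation euclid: orthonormal_frame "Basis :: 'a::euclidean_space set"
  by unfold_locales (auto simp: pairwise_def orthogonal_def inner_not_same_Basis)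

lemma euclid_disc: "euclid.disc y r = cball y r"
  by (auto simp: euclid.disc_def dist_norm norm_minus_commute)

text \<open>The linear dependence on \<open>M\<close> is the point: applied to differences of
  approximants, it turns uniform convergence into uniform convergence of the derivatives on smaller
  balls. The constant is a crude sum of the coordinate bounds.\<close>

lemma harm_directional_bound:
  fixes h :: "'a::euclidean_space \<Rightarrow> real"
  assumes h: "euclid.harm h" and d: "d > 0" and M: "\<And>x. x \<in> cball y d \<Longrightarrow> \<bar>h x\<bar> \<le> M" "M \<ge> 0"
  shows "d * \<bar>pd v h y\<bar> \<le> real DIM('a) * sqrt (2 * real DIM('a) + 16) * M * norm v"
proof -
  let ?C = "sqrt (2 * real DIM('a) + 16)"
  have b: "d * \<bar>pd b h y\<bar> \<le> ?C * M" if "b \<in> Basis" for b :: 'a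
  proof (rule power2_le_imp_le)
    have "(d * pd b h y)\<^sup>2 \<le> (2 * real DIM('a) + 16) * M\<^sup>2"
      using euclid.harm_gradient_bound[OF h d that, where M = M and y = y] M euclid.circ_disc[of y d]
      by (simp add: euclid_disc subset_iff)
    then show "(d * \<bar>pd b h y\<bar>)\<^sup>2 \<le> (?C * M)\<^sup>2" by (simp add: power_mult_distrib)
  qed (use M in simp)
  have "h differentiable (at y)" using h by (simp add: euclid.harm_def rpf_differentiable)
  then have lin: "linear (\<lambda>v. pd v h y)" using has_derivative_linear has_derivative_pd by blast
  have "pd v h y = pd (\<Sum>b\<in>Basis. (v \<bullet> b) *\<^sub>R b) h y" by (simp add: euclidean_representation)
  also have "\<dots> = (\<Sum>b\<in>Basis. (v \<bullet> b) * pd b h y)"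
    by (simp only: linear_sum[OF lin] linear_cmul[OF lin] real_scaleR_def)
  finally have "d * \<bar>pd v h y\<bar> = d * \<bar>\<Sum>b\<in>Basis. (v \<bullet> b) * pd b h y\<bar>" by simp
  also have "\<dots> \<le> d * (\<Sum>b\<in>Basis. \<bar>(v \<bullet> b) * pd b h y\<bar>)" using d by (intro mult_left_mono sum_abs) auto
  also have "\<dots> = (\<Sum>b\<in>Basis. \<bar>v \<bullet> b\<bar> * (d * \<bar>pd b h y\<bar>))"
    by (simp add: sum_distrib_left abs_mult mult_ac)
  also have "\<dots> \<le> (\<Sum>b\<in>(Basis :: 'a set). norm v * (?C * M))"
  proof (rule sum_mono)
    fix i :: 'a assume i: "i \<in> Basis"
    show "\<bar>v \<bullet> i\<bar> * (d * \<bar>pd i h y\<bar>) \<le> norm v * (?C * M)"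
      by (rule mult_mono[OF Basis_le_norm[OF i] b[OF i]]) (use d in auto)
  qed
  finally show ?thesis by (simp add: mult_ac)
qed

text \<open>The radius is chosen before \<open>e\<close>, so that one ball carries a whole sequence
  of approximating polynomials. It may depend on the point and may shrink when passing to
  derivatives, as \<open>smooth_on_coinduct\<close> requires no uniformity.\<close>

definition locally_harmonic :: "'a::euclidean_space set \<Rightarrow> ('a \<Rightarrow> real) \<Rightarrow> bool" where
  "locally_harmonic U f \<longleftrightarrow> (\<forall>x\<in>U. \<exists>r>0. \<forall>e>0. \<exists>h. euclid.harm h \<and> (\<forall>z\<in>cball x r. \<bar>f z - h z\<bar> \<le> e))"

lemma locally_harmonic_derivative_at:
  fixes f :: "'a::euclidean_space \<Rightarrow> real"
  assumes r: "r > 0" and f: "\<And>e. e > 0 \<Longrightarrow> \<exists>h. euclid.harm h \<and> (\<forall>z\<in>cball x r. \<bar>f z - h z\<bar> \<le> e)"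
  shows "f differentiable (at x)"
    and "\<forall>e>0. \<exists>h. euclid.harm h \<and> (\<forall>z\<in>cball x (r / 4). \<bar>pd v f z - h z\<bar> \<le> e)"
proof -
  have "\<exists>h. \<forall>n. euclid.harm (h n) \<and> (\<forall>z\<in>cball x r. \<bar>f z - h n z\<bar> \<le> 1 / real (Suc n))"
  proof (rule choice, rule allI)
    fix n :: nat
    show "\<exists>h. euclid.harm h \<and> (\<forall>z\<in>cball x r. \<bar>f z - h z\<bar> \<le> 1 / real (Suc n))" by (rule f) simp
  qed
  then obtain h where h: "\<And>n. euclid.harm (h n)"
    and hf: "\<And>n z. z \<in> cball x r \<Longrightarrow> \<bar>f z - h n z\<bar> \<le> 1 / real (Suc n)" by blast
  define S where "S = cball x (r / 2)"
  \<comment> \<open>Approximants of index at least \<open>n\<close> differ by at most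
    \<open>2 / Suc n\<close>, and the derivative bound is used on balls of radius
    \<open>r / 2\<close>; together these give the factor \<open>4 / r\<close>.\<close>
  define C where "C = real DIM('a) * sqrt (2 * real DIM('a) + 16) * 4 / r"
  have C: "C \<ge> 0" using r by (simp add: C_def)
  have S: "cball z (r / 2) \<subseteq> cball x r" if "z \<in> S" for z
  proof
    fix y assume "y \<in> cball z (r / 2)"
    then show "y \<in> cball x r" using that dist_triangle[of x y z] by (auto simp: S_def)
  qed
  have cauchy: "\<bar>pd v (h m) z - pd v (h n) z\<bar> \<le> C * norm v / real (Suc n)" if "m \<ge> n" "z \<in> S" for m n z v
  proof -
    let ?g = "\<lambda>x. h m x - h n x"
    have "(r / 2) * \<bar>pd v ?g z\<bar> \<le> real DIM('a) * sqrt (2 * real DIM('a) + 16) * (2 / real (Suc n)) * norm v"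
    proof (rule harm_directional_bound)
      show "euclid.harm ?g" by (intro euclid.harm_diff h)
      show "\<bar>?g y\<bar> \<le> 2 / real (Suc n)" if y: "y \<in> cball z (r / 2)" for y
      proof -
        have "y \<in> cball x r" using S[OF \<open>z \<in> S\<close>] y by blast
        then have "\<bar>f y - h m y\<bar> \<le> 1 / real (Suc m)" "\<bar>f y - h n y\<bar> \<le> 1 / real (Suc n)" using hf by auto
        moreover have "1 / real (Suc m) \<le> 1 / real (Suc n)" using \<open>m \<ge> n\<close> by (simp add: frac_le)
        ultimately show ?thesis by linarith
      qed
    qed (use r in auto)
    moreover have "pd v ?g z = pd v (h m) z - pd v (h n) z"
      by (rule pd_eqI)
        (intro has_derivative_diff has_derivative_pd smooth_on_differentiable[OF euclid.harm_smooth[OF h]] UNIV_I)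
    ultimately have "\<bar>pd v (h m) z - pd v (h n) z\<bar>
        \<le> (real DIM('a) * sqrt (2 * real DIM('a) + 16) * (2 / real (Suc n)) * norm v) / (r / 2)"
      using r by (simp only: pos_le_divide_eq mult.commute half_gt_zero)
    also have "\<dots> = C * norm v / real (Suc n)" by (simp add: C_def mult_ac)
    finally show ?thesis .
  qed
  have ev: "\<forall>\<^sub>F n in sequentially. c / real (Suc n) \<le> e" if "e > 0" for c e :: real
  proof -
    have "(\<lambda>n. c / real (Suc n)) \<longlonglongrightarrow> 0" by (rule LIMSEQ_Suc[OF lim_const_over_n])
    from order_tendstoD(2)[OF this that] show ?thesis by (rule eventually_mono) simp
  qed
  define g' where "g' z v = lim (\<lambda>n. pd v (h n) z)" for z v
  have conv: "(\<lambda>n. pd v (h n) z) \<longlonglongrightarrow> g' z v" if z: "z \<in> S" for z v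
  proof -
    have "Cauchy (\<lambda>n. pd v (h n) z)"
    proof (rule metric_CauchyI)
      fix e :: real assume "e > 0"
      then have "e / 4 > 0" by simp
      from eventually_happens[OF ev[OF this, of "C * norm v"]]
      obtain N where N: "C * norm v / real (Suc N) \<le> e / 4" by auto
      have "dist (pd v (h m) z) (pd v (h n) z) < e" if "m \<ge> N" "n \<ge> N" for m n
        using cauchy[OF that(1) z, of v] cauchy[OF that(2) z, of v] N \<open>e > 0\<close> unfolding dist_real_def by linarith
      then show "\<exists>N. \<forall>m\<ge>N. \<forall>n\<ge>N. dist (pd v (h m) z) (pd v (h n) z) < e" by blast
    qed
    then show ?thesis unfolding g'_def by (simp add: Cauchy_convergent_iff convergent_LIMSEQ_iff)
  qed
  have rate: "\<bar>g' z v - pd v (h n) z\<bar> \<le> C * norm v / real (Suc n)" if z: "z \<in> S" for z v n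
  proof (rule LIMSEQ_le_const2)
    show "(\<lambda>m. \<bar>pd v (h m) z - pd v (h n) z\<bar>) \<longlonglongrightarrow> \<bar>g' z v - pd v (h n) z\<bar>"
      by (intro tendsto_intros conv z)
    show "\<exists>N. \<forall>m\<ge>N. \<bar>pd v (h m) z - pd v (h n) z\<bar> \<le> C * norm v / real (Suc n)"
      using cauchy[OF _ z] by blast
  qed
  have "\<exists>g. \<forall>z\<in>S. (\<lambda>n. h n z) \<longlonglongrightarrow> g z \<and> (g has_derivative g' z) (at z within S)"
  proof (rule has_derivative_sequence)
    show "convex S" "x \<in> S" using r by (auto simp: S_def)
    show "(h n has_derivative (\<lambda>v. pd v (h n) z)) (at z within S)" for n z
      by (rule has_derivative_at_withinI[OF has_derivative_pd[OF
              smooth_on_differentiable[OF euclid.harm_smooth[OF h] UNIV_I]]])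
    show "\<forall>\<^sub>F n in sequentially. \<forall>z\<in>S. \<forall>v. norm (pd v (h n) z - g' z v) \<le> e * norm v" if "e > 0" for e
      using ev[OF that, of C]
    proof (rule eventually_mono)
      fix n assume n: "C / real (Suc n) \<le> e"
      have "norm (pd v (h n) z - g' z v) \<le> e * norm v" if "z \<in> S" for z v
        using rate[OF that, of v n] mult_right_mono[OF n, of "norm v"]
        by (simp add: abs_minus_commute)
      then show "\<forall>z\<in>S. \<forall>v. norm (pd v (h n) z - g' z v) \<le> e * norm v" by blast
    qed
    show "(\<lambda>n. h n x) \<longlonglongrightarrow> f x"
    proof (rule LIMSEQ_I)
      fix e :: real assume "e > 0"
      then have "\<forall>\<^sub>F n in sequentially. 1 / real (Suc n) \<le> e / 2" by (intro ev) simp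
      then obtain N where N: "\<And>n. n \<ge> N \<Longrightarrow> 1 / real (Suc n) \<le> e / 2"
        unfolding eventually_sequentially by blast
      have "norm (h n x - f x) < e" if "n \<ge> N" for n
      proof -
        have "\<bar>f x - h n x\<bar> \<le> 1 / real (Suc n)" using r by (intro hf) auto
        then show ?thesis using N[OF that] \<open>e > 0\<close> unfolding real_norm_def by linarith
      qed
      then show "\<exists>N. \<forall>n\<ge>N. norm (h n x - f x) < e" by blast
    qed
  qed
  then obtain g where g: "\<And>z. z \<in> S \<Longrightarrow> (\<lambda>n. h n z) \<longlonglongrightarrow> g z"
    "\<And>z. z \<in> S \<Longrightarrow> (g has_derivative g' z) (at z within S)" by blast
  have gf: "g z = f z" if z: "z \<in> S" for z
  proof -
    have zr: "z \<in> cball x r" using z r by (auto simp: S_def)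
    have "\<bar>f z - g z\<bar> \<le> e" if "e > 0" for e
    proof (rule tendsto_upperbound)
      show "(\<lambda>n. \<bar>f z - h n z\<bar>) \<longlonglongrightarrow> \<bar>f z - g z\<bar>" by (intro tendsto_intros g z)
      show "\<forall>\<^sub>F n in sequentially. \<bar>f z - h n z\<bar> \<le> e"
        using ev[OF that, of 1] by (rule eventually_mono) (use hf[OF zr] order_trans in blast)
    qed simp
    then have "\<bar>f z - g z\<bar> \<le> 0" by (rule field_le_epsilon[of _ 0, simplified])
    then show ?thesis by simp
  qed
  have D: "(f has_derivative g' z) (at z)" if z: "z \<in> ball x (r / 2)" for z
  proof -
    have "z \<in> S" using z by (auto simp: S_def)
    have "(g has_derivative g' z) (at z within ball x (r / 2))"
      by (rule has_derivative_subset[OF g(2)[OF \<open>z \<in> S\<close>]]) (auto simp: S_def)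
    then have "(g has_derivative g' z) (at z)" using z at_within_open[of z "ball x (r / 2)"] by simp
    then show ?thesis
      by (rule has_derivative_transform_within_open[OF _ open_ball z]) (auto simp: gf S_def)
  qed
  show "f differentiable (at x)" using D[of x] r by (auto simp: differentiable_def)
  \<comment> \<open>The derivative has been identified only on the open ball of radius
    \<open>r / 2\<close>, hence the smaller closed ball.\<close>
  show "\<forall>e>0. \<exists>h. euclid.harm h \<and> (\<forall>z\<in>cball x (r / 4). \<bar>pd v f z - h z\<bar> \<le> e)"
  proof (intro allI impI)
    fix e :: real assume "e > 0"
    from eventually_happens[OF ev[OF this, of "C * norm v"]]
    obtain n where n: "C * norm v / real (Suc n) \<le> e" by auto
    have "\<bar>pd v f z - pd v (h n) z\<bar> \<le> e" if z: "z \<in> cball x (r / 4)" for z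
    proof -
      have "z \<in> ball x (r / 2)" "z \<in> S" using z r by (auto simp: S_def)
      then show ?thesis using pd_eqI[OF D, of z v] rate[of z v n] n by simp
    qed
    then show "\<exists>h. euclid.harm h \<and> (\<forall>z\<in>cball x (r / 4). \<bar>pd v f z - h z\<bar> \<le> e)"
      using euclid.harm_pd[OF h] by blast
  qed
qed

lemma locally_harmonic_derivative:
  assumes f: "locally_harmonic U f"
  shows "x \<in> U \<Longrightarrow> f differentiable (at x)" and "locally_harmonic U (pd v f)"
proof -
  have ex: "\<exists>r>0. \<forall>e>0. \<exists>h. euclid.harm h \<and> (\<forall>z\<in>cball x r. \<bar>f z - h z\<bar> \<le> e)" if "x \<in> U" for x
    using f that unfolding locally_harmonic_def by blast
  show "f differentiable (at x)" if "x \<in> U"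
    using ex[OF that] locally_harmonic_derivative_at(1)[of _ x f] by blast
  show "locally_harmonic U (pd v f)"
    unfolding locally_harmonic_def
  proof
    fix x assume "x \<in> U"
    then obtain r where r: "r > 0" "\<And>e. e > 0 \<Longrightarrow> \<exists>h. euclid.harm h \<and> (\<forall>z\<in>cball x r. \<bar>f z - h z\<bar> \<le> e)"
      using ex by blast
    show "\<exists>r>0. \<forall>e>0. \<exists>h. euclid.harm h \<and> (\<forall>z\<in>cball x r. \<bar>pd v f z - h z\<bar> \<le> e)"
      using locally_harmonic_derivative_at(2)[OF r] r(1) by (intro exI[of _ "r / 4"] conjI) auto
  qed
qed

lemma locally_harmonic_smooth:
  assumes U: "open U" and f: "locally_harmonic U f" shows "smooth_on f U"
proof (rule smooth_on_coinduct[where P = "locally_harmonic U"])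
  show "(\<forall>x\<in>U. g differentiable at x) \<and> (\<forall>v. \<exists>g'. locally_harmonic U g' \<and> (\<forall>x\<in>U. pd v g x = g' x))"
    if "locally_harmonic U g" for g
    using locally_harmonic_derivative[OF that] by auto
qed (rule U f)+

text \<open>Comparing \<open>f\<close> with a near optimal majorant \<open>h\<close>, and
  \<open>- f\<close> with \<open>- h + e\<close>, traps \<open>f\<close> within \<open>e\<close> of
  one harmonic polynomial on the whole ball.\<close>

lemma subharmonic_both_smooth:
  fixes f :: "'a::euclidean_space \<Rightarrow> real"
  assumes X: "open X" and f: "continuous_on X f"
    and sub: "euclid.subharmonic_B X f" "euclid.subharmonic_B X (\<lambda>x. - f x)"
  shows "smooth_on f X"
proof (rule locally_harmonic_smooth[OF X])
  show "locally_harmonic X f"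
    unfolding locally_harmonic_def
  proof
    fix x assume "x \<in> X"
    then obtain r where r: "r > 0" "cball x r \<subseteq> X" using X open_contains_cball by blast
    then have D: "euclid.disc x r \<subseteq> X" by (simp add: euclid_disc)
    have "\<exists>h. euclid.harm h \<and> (\<forall>z\<in>cball x r. \<bar>f z - h z\<bar> \<le> e)" if e: "e > 0" for e
    proof -
      obtain h where h: "euclid.harm h" "\<And>z. z \<in> euclid.circ x r \<Longrightarrow> f z \<le> h z \<and> h z \<le> f z + e"
        "\<And>z. z \<in> euclid.disc x r \<Longrightarrow> f z \<le> h z"
        using euclid.subharmonic_B_approx[OF sub(1) f r(1) D e] by blast
      have lower: "- f z \<le> - h z + e" if z: "z \<in> euclid.disc x r" for z
      proof (rule euclid.subharmonic_BD[OF sub(2) r(1) euclid.harm_add[OF euclid.harm_minus[OF h(1)] euclid.harm_const] D _ z])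
        fix y assume "y \<in> euclid.circ x r"
        from h(2)[OF this] show "- f y \<le> - h y + e" by linarith
      qed
      have "\<bar>f z - h z\<bar> \<le> e" if "z \<in> euclid.disc x r" for z
        using lower[OF that] h(3)[OF that] e by linarith
      then show ?thesis using h(1) unfolding euclid_disc by blast
    qed
    then show "\<exists>r>0. \<forall>e>0. \<exists>h. euclid.harm h \<and> (\<forall>z\<in>cball x r. \<bar>f z - h z\<bar> \<le> e)" using r(1) by blast
  qed
qed

section \<open>Lagrangian planes\<close>

lemma lag_frame:
  fixes W :: "(complex^'n) set"
  assumes "W \<in> LAG"
  obtains B where "orthonormal_frame B" "span B = W" "\<And>A. A \<in> Sym2 \<Longrightarrow> trace_on A W = (\<Sum>b\<in>B. A b b)"
proof -
  have W: "subspace W" "dim W = CARD('n)" using assms unfolding LAG_def by blast+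
  obtain B where B: "orthonormal_basis_of W B" using orthonormal_basis_of_exists[OF W(1)] by blast
  have sp: "span B = W" using B by (simp add: orthonormal_basis_of_def)
  have "B \<noteq> {}"
  proof
    assume "B = {}"
    then have "dim W = 0" using dim_span[of B] sp by simp
    then show False using W(2) by simp
  qed
  then have "orthonormal_frame B"
    using B unfolding orthonormal_basis_of_def orthonormal_frame_def by blast
  then show ?thesis
    by (rule that[OF _ sp]) (simp add: trace_on_eq[OF _ B] Sym2_def)
qed

lemma Im_plane_comp: "orthogonal_comp {z :: complex^'n. \<forall>k. Im (z $ k) = 0} = {z. \<forall>k. Re (z $ k) = 0}"
proof (intro equalityI subsetI)
  fix z :: "complex^'n" assume z: "z \<in> orthogonal_comp {z. \<forall>k. Im (z $ k) = 0}"
  have "Re (z $ k) = 0" for k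
  proof -
    have "axis k 1 \<bullet> z = 0" using z by (auto simp: orthogonal_comp_def orthogonal_def axis_def)
    then show ?thesis by (simp add: inner_axis' inner_complex_def)
  qed
  then show "z \<in> {z. \<forall>k. Re (z $ k) = 0}" by simp
qed (auto simp: orthogonal_comp_def orthogonal_def inner_vec_def inner_complex_def)

lemma Re_plane_comp: "orthogonal_comp {z :: complex^'n. \<forall>k. Re (z $ k) = 0} = {z. \<forall>k. Im (z $ k) = 0}"
proof (intro equalityI subsetI)
  fix z :: "complex^'n" assume z: "z \<in> orthogonal_comp {z. \<forall>k. Re (z $ k) = 0}"
  have "Im (z $ k) = 0" for k
  proof -
    have "axis k \<i> \<bullet> z = 0" using z by (auto simp: orthogonal_comp_def orthogonal_def axis_def)
    then show ?thesis by (simp add: inner_axis' inner_complex_def)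
  qed
  then show "z \<in> {z. \<forall>k. Im (z $ k) = 0}" by simp
qed (auto simp: orthogonal_comp_def orthogonal_def inner_vec_def inner_complex_def)

lemma complex_structure_planes:
  "complex_structure ` {z :: complex^'n. \<forall>k. Im (z $ k) = 0} = {z. \<forall>k. Re (z $ k) = 0}"
  "complex_structure ` {z :: complex^'n. \<forall>k. Re (z $ k) = 0} = {z. \<forall>k. Im (z $ k) = 0}"
proof -
  have J: "z = complex_structure (- (\<i> *s z))" for z :: "complex^'n"
    by (simp add: complex_structure_def vec_eq_iff flip: mult.assoc)
  show "complex_structure ` {z :: complex^'n. \<forall>k. Im (z $ k) = 0} = {z. \<forall>k. Re (z $ k) = 0}"
  proof (intro equalityI subsetI)
    fix z :: "complex^'n" assume "z \<in> {z. \<forall>k. Re (z $ k) = 0}"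
    then show "z \<in> complex_structure ` {z. \<forall>k. Im (z $ k) = 0}"
      by (intro image_eqI[of z complex_structure, OF J]) auto
  qed (auto simp: complex_structure_def)
  show "complex_structure ` {z :: complex^'n. \<forall>k. Re (z $ k) = 0} = {z. \<forall>k. Im (z $ k) = 0}"
  proof (intro equalityI subsetI)
    fix z :: "complex^'n" assume "z \<in> {z. \<forall>k. Im (z $ k) = 0}"
    then show "z \<in> complex_structure ` {z. \<forall>k. Re (z $ k) = 0}"
      by (intro image_eqI[of z complex_structure, OF J]) auto
  qed (auto simp: complex_structure_def)
qed

text \<open>Serves the real plane with \<open>c = 1\<close> and the imaginary plane with
  \<open>c = \<i>\<close> by one argument.\<close>

lemma orthonormal_axis:
  fixes c :: complex
  assumes c: "norm c = 1" and W: "W = {z :: complex^'n. \<forall>k. \<exists>t. z $ k = t *\<^sub>R c}"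
  shows "orthonormal_basis_of W (range (\<lambda>k. axis k c))" "inj (\<lambda>k. axis k c :: complex^'n)"
    "subspace W" "dim W = CARD('n)"
proof -
  let ?B = "range (\<lambda>k. axis k c :: complex^'n)"
  have cc: "c \<bullet> c = 1" using c by (simp add: dot_square_norm)
  have ax: "axis k c \<bullet> (axis j c :: complex^'n) = (if k = j then 1 else 0)" for k j
    using cc by (simp add: inner_axis_axis)
  show inj: "inj (\<lambda>k. axis k c :: complex^'n)"
  proof (rule injI)
    fix k j assume "axis k c = (axis j c :: complex^'n)"
    then show "k = j" using ax[of k j] ax[of k k] by (auto split: if_splits)
  qed
  have pw: "pairwise orthogonal ?B" by (auto simp: pairwise_def orthogonal_def ax)
  have nrm: "norm b = 1" if "b \<in> ?B" for b using that ax by (auto simp: norm_eq_1)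
  have sp: "span ?B = W"
  proof (intro equalityI subsetI)
    fix z assume "z \<in> W"
    then obtain t where t: "\<And>k. z $ k = t k *\<^sub>R c" unfolding W by (auto simp: choice_iff)
    have "z = (\<Sum>k\<in>UNIV. t k *\<^sub>R axis k c)"
      by (simp add: vec_eq_iff t axis_def if_distrib cong: if_cong)
    also have "\<dots> \<in> span ?B" by (intro span_sum span_scale span_base) auto
    finally show "z \<in> span ?B" .
  next
    have sub: "subspace W"
      unfolding W
    proof (rule subspaceI)
      show "0 \<in> {z :: complex^'n. \<forall>k. \<exists>t. z $ k = t *\<^sub>R c}" by (auto intro: exI[of _ 0])
      fix p q :: "complex^'n" and s :: real
      assume "p \<in> {z. \<forall>k. \<exists>t. z $ k = t *\<^sub>R c}" "q \<in> {z. \<forall>k. \<exists>t. z $ k = t *\<^sub>R c}"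
      then obtain a b where ab: "\<And>k. p $ k = a k *\<^sub>R c" "\<And>k. q $ k = b k *\<^sub>R c"
        by (auto simp: choice_iff)
      have "(p + q) $ k = (a k + b k) *\<^sub>R c" "(s *\<^sub>R p) $ k = (s * a k) *\<^sub>R c" for k
        by (simp_all add: ab scaleR_left_distrib)
      then show "p + q \<in> {z. \<forall>k. \<exists>t. z $ k = t *\<^sub>R c}" "s *\<^sub>R p \<in> {z. \<forall>k. \<exists>t. z $ k = t *\<^sub>R c}"
        by blast+
    qed
    have "\<exists>t. axis j c $ k = t *\<^sub>R c" for j k :: 'n
      by (cases "j = k") (auto simp: axis_def intro: exI[of _ 1] exI[of _ 0])
    then have "?B \<subseteq> W" unfolding W by blast
    then show "z \<in> W" if "z \<in> span ?B" for z using that span_minimal[OF _ sub] by blast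
  qed
  then show ob: "orthonormal_basis_of W ?B" using pw nrm by (simp add: orthonormal_basis_of_def)
  show "subspace W" using sp subspace_span by metis
  have "0 \<notin> ?B" using nrm[of 0] by auto
  then have "independent ?B" using pw pairwise_orthogonal_independent by blast
  then have "dim W = card ?B" using sp dim_span_eq_card_independent by metis
  then show "dim W = CARD('n)" using card_image[OF inj] by simp
qed

text \<open>The bases of the real and the imaginary plane together form the standard basis, so the
  two nonnegative traces add up to the full trace.\<close>

lemma P_LAG_trace:
  fixes A :: "complex^'n \<Rightarrow> complex^'n \<Rightarrow> real"
  assumes "A \<in> P_LAG" shows "0 \<le> (\<Sum>b\<in>Basis. A b b)"
proof -
  have bil: "bilinear A" using assms by (auto simp: P_LAG_def Sym2_def)
  have R: "{z :: complex^'n. \<forall>k. Im (z $ k) = 0} = {z. \<forall>k. \<exists>t. z $ k = t *\<^sub>R (1::complex)}"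
    by (auto simp: complex_eq_iff)
  have I: "{z :: complex^'n. \<forall>k. Re (z $ k) = 0} = {z. \<forall>k. \<exists>t. z $ k = t *\<^sub>R \<i>}"
    by (auto simp: complex_eq_iff)
  note R' = orthonormal_axis[OF norm_one R]
  note I' = orthonormal_axis[OF norm_ii I]
  have "{z :: complex^'n. \<forall>k. Im (z $ k) = 0} \<in> LAG" "{z :: complex^'n. \<forall>k. Re (z $ k) = 0} \<in> LAG"
    using R'(3,4) I'(3,4) by (auto simp: LAG_def complex_structure_planes Im_plane_comp Re_plane_comp)
  then have "0 \<le> trace_on A {z :: complex^'n. \<forall>k. Im (z $ k) = 0} + trace_on A {z :: complex^'n. \<forall>k. Re (z $ k) = 0}"
    using assms by (auto simp: P_LAG_def)
  also have "\<dots> = (\<Sum>k\<in>UNIV. A (axis k 1) (axis k 1)) + (\<Sum>k\<in>UNIV. A (axis k \<i>) (axis k \<i>))"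
    unfolding trace_on_eq[OF bil R'(1)] trace_on_eq[OF bil I'(1)] sum.reindex[OF R'(2)] sum.reindex[OF I'(2)]
    by simp
  also have "\<dots> = (\<Sum>b\<in>range (\<lambda>k. axis k 1) \<union> range (\<lambda>k. axis k \<i>). A b b)"
    by (subst sum.union_disjoint) (auto simp: sum.reindex[OF R'(2)] sum.reindex[OF I'(2)] axis_eq_axis)
  also have "range (\<lambda>k. axis k 1) \<union> range (\<lambda>k. axis k \<i>) = (Basis :: (complex^'n) set)"
    by (auto simp: Basis_vec_def Basis_complex_def)
  finally show ?thesis .
qed

text \<open>A smooth function is its own test function at every point.\<close>

lemma lag_psh_hessian:
  assumes "open X" "smooth_on g X" "lag_psh X (\<lambda>x. ereal (g x))" "x \<in> X"
  shows "hessian g x \<in> P_LAG"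
  using assms unfolding lag_psh_def subharmonic_on_def by blast

lemma lag_pluriharmonic_smooth:
  assumes X: "open X" and f: "lag_pluriharmonic X f" shows "smooth_on f X"
proof -
  have c: "continuous_on X f" "continuous_on X (\<lambda>x. - f x)"
    and s: "subharmonic_on P_LAG X (\<lambda>x. ereal (f x))" "subharmonic_on P_LAG X (\<lambda>x. ereal (- f x))"
    using f by (auto simp: lag_pluriharmonic_def lag_psh_def intro: continuous_intros)
  show ?thesis
    by (rule subharmonic_both_smooth[OF X c(1)])
      (rule euclid.subharmonic_on_imp_subharmonic_B[OF X, of P_LAG], rule P_LAG_trace, assumption, fact, fact)+
qed

section \<open>The contact set lies in the hull of its boundary part\<close>

lemma hessian_trace_add:
  assumes "open U" "x \<in> U" "smooth_on f U" "smooth_on g U"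
  shows "trace_on (hessian (\<lambda>x. f x + g x) x) W = trace_on (hessian f x) W + trace_on (hessian g x) W"
  by (simp add: trace_on_def hessian_add[OF assms] sum.distrib)

lemma hessian_trace_cmult:
  assumes "open U" "x \<in> U" "smooth_on f U"
  shows "trace_on (hessian (\<lambda>x. c * f x) x) W = c * trace_on (hessian f x) W"
  by (simp add: trace_on_def hessian_cmult[OF assms] sum_distrib_left)

lemma hessian_trace_const: "trace_on (hessian (\<lambda>x. c) x) W = 0"
  by (simp add: trace_on_def hessian_const)

lemma trace_norm2:
  fixes W :: "(complex^'n) set"
  assumes "W \<in> LAG" shows "trace_on (hessian (\<lambda>x. x \<bullet> x) x) W > 0"
proof -
  obtain B where B: "orthonormal_frame B" "\<And>A. A \<in> Sym2 \<Longrightarrow> trace_on A W = (\<Sum>b\<in>B. A b b)"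
    using lag_frame[OF assms] by metis
  have "smooth_on (\<lambda>x :: complex^'n. x \<bullet> x) UNIV" using rpf_smooth[OF rpf_norm2[of 0]] by simp
  then have "hessian (\<lambda>x. x \<bullet> x) x \<in> Sym2" by (rule hessian_Sym2[OF open_UNIV UNIV_I])
  then have "trace_on (hessian (\<lambda>x. x \<bullet> x) x) W = orthonormal_frame.lap B (\<lambda>x. (x - 0) \<bullet> (x - 0)) x"
    using B by (simp add: orthonormal_frame.lap_def)
  then show ?thesis
    using orthonormal_frame.lap_norm2[OF B(1), of 0 x] orthonormal_frame.card_pos[OF B(1)] by simp
qed

lemma lag_psh_trace:
  assumes "open X" "smooth_on g X" "lag_psh X (\<lambda>x. ereal (g x))" "x \<in> X" "W \<in> LAG"
  shows "0 \<le> trace_on (hessian g x) W"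
  using lag_psh_hessian[OF assms(1-4)] assms(5) by (auto simp: P_LAG_def)

text \<open>The bound is an arbitrary real \<open>m\<close> rather than a supremum, so that an empty
  set of boundary contact points is included.\<close>

lemma contact_maximum_principle:
  fixes X K :: "(complex^'n) set" and H f g :: "complex^'n \<Rightarrow> real"
  assumes X: "open X" and K: "compact K" "K \<subseteq> X"
    and H: "continuous_on X H" "dually_lag_psh X (\<lambda>x. ereal (- H x))"
    and f: "smooth_on f X" "\<And>x W. x \<in> X \<Longrightarrow> W \<in> LAG \<Longrightarrow> 0 \<le> trace_on (hessian f x) W"
    and g: "smooth_on g X" "\<And>x W. x \<in> X \<Longrightarrow> W \<in> LAG \<Longrightarrow> 0 \<le> trace_on (hessian g x) W"
    and fH: "\<And>x. x \<in> K \<Longrightarrow> f x \<le> H x"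
    and x0: "x0 \<in> K" "f x0 = H x0"
    and m: "\<And>x. x \<in> frontier K \<Longrightarrow> f x = H x \<Longrightarrow> g x \<le> m"
  shows "g x0 \<le> m"
proof (rule ccontr)
  assume "\<not> g x0 \<le> m"
  then have gm: "m < g x0" by simp
  then have x0i: "x0 \<notin> frontier K" using m x0 by fastforce
  \<comment> \<open>Frontier points with \<open>g \<ge> m'\<close> are not contact points, because
    contact there forces \<open>g \<le> m\<close>; on the compact set of these points
    \<open>H - f\<close> is therefore at least some \<open>c > 0\<close>.\<close>
  define m' where "m' = (m + g x0) / 2"
  have m': "m < m'" "m' < g x0" using gm by (auto simp: m'_def)
  have cf: "continuous_on K f" and cg: "continuous_on K g" and cH: "continuous_on K H"
    using smooth_on_continuous[OF f(1)] smooth_on_continuous[OF g(1)] H(1) K(2) continuous_on_subset by blast+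
  have fK: "frontier K \<subseteq> K" using K(1) compact_imp_closed frontier_subset_closed by blast
  have cfr: "compact (frontier K)" using K(1) by (rule compact_frontier)
  define A where "A = frontier K \<inter> g -` {m'..}"
  have "closed A" unfolding A_def
    by (rule continuous_closed_preimage[OF continuous_on_subset[OF cg fK] compact_imp_closed[OF cfr] closed_atLeast])
  then have cA: "compact A" using compact_Int_closed[OF cfr, of A] by (simp add: A_def Int_assoc)
  have A: "f x < H x" if "x \<in> A" for x
  proof -
    have "x \<in> frontier K" "m' \<le> g x" using that by (auto simp: A_def)
    then show ?thesis using m[of x] m' fH[of x] fK by force
  qed
  obtain c where c: "c > 0" "\<And>x. x \<in> A \<Longrightarrow> c \<le> H x - f x"
  proof (cases "A = {}")
    case True
    then show ?thesis using that[of 1] by auto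
  next
    case False
    have "A \<subseteq> K" using fK by (auto simp: A_def)
    then have "continuous_on A (\<lambda>x. H x - f x)"
      by (intro continuous_on_diff continuous_on_subset[OF cH] continuous_on_subset[OF cf])
    then obtain a where a: "a \<in> A" "\<And>x. x \<in> A \<Longrightarrow> H a - f a \<le> H x - f x"
      using continuous_attains_inf[OF cA False] by blast
    then show ?thesis using that[of "H a - f a"] A[OF a(1)] by simp
  qed
  obtain xm where xm: "xm \<in> K" "\<And>x. x \<in> K \<Longrightarrow> g x \<le> g xm"
    using continuous_attains_sup[OF K(1) _ cg] x0(1) by blast
  define M where "M = g xm + 1 - g x0"
  have M: "M > 0" "\<And>x. x \<in> K \<Longrightarrow> g x - g x0 < M" using xm(2) xm(2)[OF x0(1)] by (force simp: M_def)+
  obtain R where R: "R > 0" "\<And>x. x \<in> K \<Longrightarrow> x \<bullet> x < R"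
  proof -
    have "continuous_on K (\<lambda>x. x \<bullet> x)" by (intro continuous_intros)
    then obtain a where "a \<in> K" "\<And>x. x \<in> K \<Longrightarrow> x \<bullet> x \<le> a \<bullet> a"
      using continuous_attains_sup[OF K(1)] x0(1) by blast
    then show ?thesis using that[of "a \<bullet> a + 1"] inner_ge_zero[of a] by force
  qed
  \<comment> \<open>On \<open>A\<close>, half of the gap \<open>c\<close> pays for the variation of
    \<open>g\<close> and the other half for the quadratic term. On the rest of the frontier the
    quadratic term is paid for by the loss \<open>\<epsilon> * (g x0 - m')\<close>. Hence the
    maximum is not on the frontier.\<close>
  define \<epsilon> where "\<epsilon> = c / (2 * M)"
  have \<epsilon>: "\<epsilon> > 0" "\<epsilon> * M = c / 2" using c(1) M(1) by (auto simp: \<epsilon>_def)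
  define \<delta> where "\<delta> = min (c / 2) (\<epsilon> * (g x0 - m')) / R"
  have \<delta>: "\<delta> > 0" "\<delta> * R \<le> c / 2" "\<delta> * R \<le> \<epsilon> * (g x0 - m')"
    using c(1) \<epsilon>(1) m' R(1) by (auto simp: \<delta>_def)
  define p where "p x = f x + (\<epsilon> * g x + \<delta> * (x \<bullet> x))" for x
  define u where "u x = p x - H x" for x
  have "continuous_on K u" unfolding u_def p_def by (intro continuous_intros cf cg cH)
  then obtain x1 where x1: "x1 \<in> K" "\<And>x. x \<in> K \<Longrightarrow> u x \<le> u x1"
    using continuous_attains_sup[OF K(1)] x0(1) by blast
  have "u x0 \<ge> \<epsilon> * g x0" using x0(2) \<delta>(1) by (simp add: u_def p_def)
  then have u1: "u x1 \<ge> \<epsilon> * g x0" using x1(2)[OF x0(1)] by simp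
  have "x1 \<notin> frontier K"
  proof
    assume fr: "x1 \<in> frontier K"
    have d: "\<delta> * (x1 \<bullet> x1) < \<delta> * R" using R(2)[OF x1(1)] \<delta>(1) by simp
    show False
    proof (cases "x1 \<in> A")
      case True
      have "\<epsilon> * (g x1 - g x0) \<le> \<epsilon> * M" using M(2)[OF x1(1)] \<epsilon>(1) by (intro mult_left_mono) auto
      then have "\<epsilon> * g x1 - \<epsilon> * g x0 \<le> c / 2" using \<epsilon>(2) by (simp add: right_diff_distrib)
      then show ?thesis using c(2)[OF True] u1 d \<delta>(2) by (simp add: u_def p_def)
    next
      case False
      then have "\<epsilon> * g x1 \<le> \<epsilon> * m'" using fr \<epsilon>(1) by (intro mult_left_mono) (auto simp: A_def)
      then show ?thesis using fH[OF x1(1)] u1 d \<delta>(3) by (simp add: u_def p_def right_diff_distrib)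
    qed
  qed
  then have x1i: "x1 \<in> interior K" using x1(1) closure_subset by (auto simp: frontier_def)
  let ?V = "interior K"
  have V: "open ?V" "?V \<subseteq> X" using interior_subset K(2) by auto
  have sf: "smooth_on f ?V" and sg: "smooth_on g ?V"
    using smooth_on_subset[OF f(1) V(2)] smooth_on_subset[OF g(1) V(2)] by auto
  have sn: "smooth_on (\<lambda>x :: complex^'n. x \<bullet> x) ?V"
    using smooth_on_subset[OF rpf_smooth[OF rpf_norm2[of 0]]] by simp
  have s2: "smooth_on (\<lambda>x. \<epsilon> * g x) ?V" "smooth_on (\<lambda>x. \<delta> * (x \<bullet> x)) ?V"
    using smooth_on_cmult[OF V(1)] sg sn by auto
  have s3: "smooth_on (\<lambda>x. \<epsilon> * g x + \<delta> * (x \<bullet> x)) ?V" by (rule smooth_on_add[OF V(1) s2])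
  have sp: "smooth_on p ?V" unfolding p_def by (rule smooth_on_add[OF V(1) sf s3])
  define \<phi> where "\<phi> x = (- 1) * p x + u x1" for x
  have s4: "smooth_on (\<lambda>x. (- 1) * p x) ?V" by (rule smooth_on_cmult[OF V(1) sp])
  have s\<phi>: "smooth_on \<phi> ?V" unfolding \<phi>_def by (rule smooth_on_add[OF V(1) s4 smooth_on_const[OF V(1)]])
  have "open ?V \<and> x1 \<in> ?V \<and> ?V \<subseteq> X \<and> smooth_on \<phi> ?V \<and>
      (\<forall>x\<in>?V. ereal (- H x) \<le> ereal (\<phi> x)) \<and> ereal (- H x1) = ereal (\<phi> x1)"
    using V x1i s\<phi> x1(2) interior_subset[of K] by (fastforce simp: \<phi>_def u_def)
  then have "hessian \<phi> x1 \<in> dual_P_LAG"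
    using H(2) V(2) x1i unfolding dually_lag_psh_def subharmonic_on_def by blast
  then obtain W where W: "W \<in> LAG" "0 \<le> trace_on (hessian \<phi> x1) W" by (auto simp: dual_P_LAG_def)
  have "trace_on (hessian p x1) W = trace_on (hessian f x1) W
      + (\<epsilon> * trace_on (hessian g x1) W + \<delta> * trace_on (hessian (\<lambda>x. x \<bullet> x) x1) W)"
    unfolding p_def hessian_trace_add[OF V(1) x1i sf s3] hessian_trace_add[OF V(1) x1i s2]
      hessian_trace_cmult[OF V(1) x1i sg] hessian_trace_cmult[OF V(1) x1i sn] ..
  moreover have "trace_on (hessian \<phi> x1) W = (- 1) * trace_on (hessian p x1) W"
    unfolding \<phi>_def hessian_trace_add[OF V(1) x1i s4 smooth_on_const[OF V(1)]] hessian_trace_cmult[OF V(1) x1i sp]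
    by (simp add: hessian_trace_const)
  moreover have "x1 \<in> X" using x1(1) K(2) by blast
  then have "0 \<le> trace_on (hessian f x1) W" "0 \<le> trace_on (hessian g x1) W"
    using f(2) g(2) W(1) by auto
  moreover have "0 < \<delta> * trace_on (hessian (\<lambda>x. x \<bullet> x) x1) W"
    using trace_norm2[OF W(1)] \<delta>(1) by simp
  moreover have "0 \<le> \<epsilon> * trace_on (hessian g x1) W" using \<epsilon>(1) calculation(4) by simp
  ultimately show False using W(2) by linarith
qed

lemma contact_subset_hull:
  fixes X K :: "(complex^'n) set" and H f :: "complex^'n \<Rightarrow> real"
  assumes X: "open X" and H: "lag_harmonic X H" and f: "lag_pluriharmonic X f"
    and K: "compact K" "K \<subseteq> X" and fH: "\<forall>x\<in>K. f x \<le> H x"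
  shows "{x \<in> K. f x = H x} \<subseteq> lag_hull X ({x \<in> K. f x = H x} \<inter> frontier K)"
proof
  fix x assume x: "x \<in> {x \<in> K. f x = H x}"
  let ?L = "{x \<in> K. f x = H x} \<inter> frontier K"
  have fs: "smooth_on f X" by (rule lag_pluriharmonic_smooth[OF X f])
  have fp: "lag_psh X (\<lambda>x. ereal (f x))" using f by (simp add: lag_pluriharmonic_def)
  have fK: "frontier K \<subseteq> K" using K(1) compact_imp_closed frontier_subset_closed by blast
  have "ereal (g x) \<le> (SUP y\<in>?L. ereal (g y))" if g: "smooth_on g X" "lag_psh X (\<lambda>y. ereal (g y))" for g
  proof (rule ccontr)
    assume "\<not> ereal (g x) \<le> (SUP y\<in>?L. ereal (g y))"
    \<comment> \<open>The supremum may be minus infinity, so a real number strictly between it and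
      \<open>g x\<close> is used as the bound.\<close>
    then obtain m where m: "(SUP y\<in>?L. ereal (g y)) < ereal m" "ereal m < ereal (g x)"
      using ereal_dense2 by (meson not_le)
    have "g x \<le> m"
    proof (rule contact_maximum_principle[OF X K _ _ fs lag_psh_trace[OF X fs fp] g(1) lag_psh_trace[OF X g]])
      show "continuous_on X H" "dually_lag_psh X (\<lambda>x. ereal (- H x))" using H by (auto simp: lag_harmonic_def)
      show "g y \<le> m" if "y \<in> frontier K" "f y = H y" for y
      proof -
        have "y \<in> ?L" using that fK by auto
        then have "ereal (g y) \<le> (SUP y\<in>?L. ereal (g y))" by (rule SUP_upper)
        then have "ereal (g y) < ereal m" using m(1) by (rule le_less_trans)
        then show ?thesis by simp
      qed
    qed (use fH x in auto)
    then show False using m(2) by simp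
  qed
  then show "x \<in> lag_hull X ?L" using x K(2) by (auto simp: lag_hull_def)
qed

section \<open>Mollification\<close>

lemma pd_translate:
  assumes "f differentiable (at (x + z))" shows "pd v (\<lambda>x. f (x + z)) x = pd v f (x + z)"
proof (rule pd_eqI)
  have "((\<lambda>x. x + z) has_derivative (\<lambda>v. v)) (at x)" by (auto intro!: derivative_eq_intros)
  from diff_chain_at[OF this has_derivative_pd[OF assms]]
  show "((\<lambda>x. f (x + z)) has_derivative (\<lambda>v. pd v f (x + z))) (at x)" by (simp add: o_def)
qed

lemma rpf_translate: "rpf p \<Longrightarrow> rpf (\<lambda>x. p (x + z))"
  using real_polynomial_function_compose[of "\<lambda>x. x + z" p]
  by (simp add: o_def polynomial_function_add polynomial_function_id)

context orthonormal_frame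
begin

lemma harm_translate:
  assumes h: "harm h" shows "harm (\<lambda>x. h (x + z))"
proof -
  have r: "rpf h" using h by (simp add: harm_def)
  have "pd v (\<lambda>x. h (x + z)) = (\<lambda>x. pd v h (x + z))" for v
    by (intro ext pd_translate rpf_differentiable r)
  moreover have "pd u (\<lambda>x. pd v h (x + z)) x = pd u (pd v h) (x + z)" for u v x
    by (intro pd_translate rpf_differentiable rpf_pd r)
  ultimately have "lap (\<lambda>x. h (x + z)) x = lap h (x + z)" for x
    by (simp add: lap_def hessian_eq_pd)
  then show ?thesis using h rpf_translate[OF r] by (simp add: harm_def)
qed

lemma subharmonic_B_translate:
  assumes w: "subharmonic_B X w" and N: "\<And>x. x \<in> N \<Longrightarrow> x - z \<in> X \<and> v x = w (x - z)"
  shows "subharmonic_B N v"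
  unfolding subharmonic_B_def
proof (intro allI impI ballI, elim conjE)
  fix y r h x
  assume r: "r > 0" and h: "harm h" and D: "disc y r \<subseteq> N" and c: "\<forall>x\<in>circ y r. v x \<le> h x"
    and x: "x \<in> disc y r"
  have sh: "t + z \<in> disc y r \<longleftrightarrow> t \<in> disc (y - z) r" "t + z \<in> circ y r \<longleftrightarrow> t \<in> circ (y - z) r" for t
    by (simp_all add: disc_def circ_def algebra_simps)
  have "w (x - z) \<le> h ((x - z) + z)"
  proof (rule subharmonic_BD[OF w r harm_translate[OF h]])
    show "disc (y - z) r \<subseteq> X"
    proof
      fix t assume "t \<in> disc (y - z) r"
      then have "t + z \<in> N" using D sh(1) by blast
      then show "t \<in> X" using N[of "t + z"] by simp
    qed
    show "w t \<le> h (t + z)" if "t \<in> circ (y - z) r" for t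
    proof -
      have t: "t + z \<in> circ y r" using that sh(2) by blast
      then have "t + z \<in> N" using D circ_disc by blast
      then show ?thesis using N[of "t + z"] c t by force
    qed
    show "x - z \<in> disc (y - z) r" using x sh(1)[of "x - z"] by simp
  qed
  then show "v x \<le> h x" using N[of x] x D by auto
qed

text \<open>The way back from comparison to second derivatives. If the Laplacian were below
  \<open>- \<kappa>\<close> near \<open>x\<close>, then \<open>h - v - s * Q\<close>, with a near
  optimal majorant \<open>h\<close>, would be subharmonic, nonnegative at the centre and negative on
  the circle.\<close>

lemma subharmonic_B_lap_nonneg:
  assumes X: "open X" and v: "smooth_on v X" "subharmonic_B X v" and x: "x \<in> X"
  shows "0 \<le> lap v x"
proof (rule ccontr)
  assume neg: "\<not> 0 \<le> lap v x"
  define \<kappa> where "\<kappa> = - lap v x / 2"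
  have \<kappa>: "\<kappa> > 0" using neg by (simp add: \<kappa>_def)
  have "continuous_on X (lap v)"
    unfolding lap_def[abs_def] hessian_eq_pd
    by (intro continuous_on_sum smooth_on_continuous smooth_on_pd v)
  then have "open (lap v -` {..< - \<kappa>} \<inter> X)" using X by (simp add: continuous_on_open_vimage)
  moreover have "x \<in> lap v -` {..< - \<kappa>} \<inter> X" using x neg by (simp add: \<kappa>_def)
  ultimately obtain r where r: "r > 0" "cball x r \<subseteq> lap v -` {..< - \<kappa>} \<inter> X"
    using open_contains_cball by blast
  have "disc x r \<subseteq> cball x r" by (auto simp: disc_def dist_norm norm_minus_commute)
  then have D: "disc x r \<subseteq> X" and l: "\<And>z. z \<in> disc x r \<Longrightarrow> lap v z < - \<kappa>" using r(2) by auto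
  define s where "s = \<kappa> / (2 * card B)"
  have s: "s > 0" "s * (2 * card B) = \<kappa>" using \<kappa> card_pos by (auto simp: s_def)
  \<comment> \<open>Half of the drop \<open>s * r\<^sup>2\<close> that the term \<open>s * Q\<close>
    causes on the circle.\<close>
  define e where "e = s * r\<^sup>2 / 2"
  have e: "e > 0" using s r by (simp add: e_def)
  obtain h where h: "harm h" "\<And>z. z \<in> circ x r \<Longrightarrow> v z \<le> h z \<and> h z \<le> v z + e"
    "\<And>z. z \<in> disc x r \<Longrightarrow> v z \<le> h z"
    using subharmonic_B_approx[OF v(2) smooth_on_continuous[OF v(1)] r(1) D e] by blast
  have hX: "smooth_on h X" and QX: "smooth_on (Q x) X"
    using h(1) rpf_Q smooth_on_polynomial[OF X] by (auto simp: harm_def)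
  note s1 = smooth_on_cmult[OF X v(1), of "- 1"] smooth_on_cmult[OF X QX, of "- s"]
  note s2 = smooth_on_add[OF X s1]
  have x_disc: "x \<in> disc x r" using r(1) by (simp add: disc_def span_zero)
  have "h x + (- 1 * v x + - s * Q x x) \<le> e - s * r\<^sup>2"
  proof (rule max_principle[OF X D smooth_on_add[OF X hX s2] _ _ x_disc])
    fix z assume z: "z \<in> circ x r"
    then have "Q x z = r\<^sup>2" using Q_norm_span by (auto simp: circ_def)
    then show "h z + (- 1 * v z + - s * Q x z) \<le> e - s * r\<^sup>2" using h(2)[OF z] by simp
  next
    fix z assume z: "z \<in> disc x r"
    then have zX: "z \<in> X" using D by blast
    have "lap (\<lambda>x'. h x' + (- 1 * v x' + - s * Q x x')) z = lap h z + (- 1 * lap v z + - s * lap (Q x) z)"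
      by (simp only: lap_add[OF X zX hX s2] lap_add[OF X zX s1] lap_cmult[OF X zX v(1)] lap_cmult[OF X zX QX])
    then show "0 \<le> lap (\<lambda>x'. h x' + (- 1 * v x' + - s * Q x x')) z"
      using h(1) l[OF z] s(2) by (simp add: harm_def lap_Q)
  qed
  moreover have "Q x x = 0" by (simp add: Q_def)
  ultimately show False using h(3)[OF x_disc] e by (simp add: e_def)
qed

end

text \<open>All derivatives fall on the kernel, and the box is fixed; so the convolutions of one
  continuous \<open>w\<close> with smooth kernels form a class closed under differentiation.\<close>

lemma convolution_smooth:
  fixes \<rho> w :: "'a::euclidean_space \<Rightarrow> real"
  assumes w: "continuous_on UNIV w" and \<rho>: "smooth_on \<rho> UNIV"
  shows "smooth_on (\<lambda>x. integral (cbox a b) (\<lambda>z. \<rho> (x - z) * w z)) UNIV"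
proof (rule smooth_on_coinduct[where P = "\<lambda>v. \<exists>\<rho>. smooth_on \<rho> UNIV \<and>
      v = (\<lambda>x. integral (cbox a b) (\<lambda>z. \<rho> (x - z) * w z))"])
  fix v assume "\<exists>\<rho>. smooth_on \<rho> UNIV \<and> v = (\<lambda>x. integral (cbox a b) (\<lambda>z. \<rho> (x - z) * w z))"
  then obtain \<rho> where \<rho>: "smooth_on \<rho> UNIV" and v: "v = (\<lambda>x. integral (cbox a b) (\<lambda>z. \<rho> (x - z) * w z))"
    by blast
  \<comment> \<open>\<open>leibniz_rule\<close> wants the derivative as a continuous map into
    bounded linear functionals. Expanding it in coordinates reduces its continuity to that of the
    partial derivatives.\<close>
  define F :: "'a \<Rightarrow> 'a \<Rightarrow> 'a \<Rightarrow>\<^sub>L real"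
    where "F x z = (\<Sum>b\<in>Basis. (pd b \<rho> (x - z) * w z) *\<^sub>R blinfun_inner_left b)" for x z
  have \<rho>d: "\<rho> differentiable (at x)" for x using smooth_on_differentiable[OF \<rho>] by simp
  have Fv: "blinfun_apply (F x z) u = pd u \<rho> (x - z) * w z" for x z u
  proof -
    have lin: "linear (\<lambda>u. pd u \<rho> (x - z))" using has_derivative_linear[OF has_derivative_pd[OF \<rho>d]] .
    have "pd u \<rho> (x - z) = pd (\<Sum>b\<in>Basis. (u \<bullet> b) *\<^sub>R b) \<rho> (x - z)" by (simp add: euclidean_representation)
    also have "\<dots> = (\<Sum>b\<in>Basis. (u \<bullet> b) * pd b \<rho> (x - z))"
      by (simp only: linear_sum[OF lin] linear_cmul[OF lin] real_scaleR_def)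
    finally show ?thesis
      by (simp add: F_def blinfun.sum_left blinfun.scaleR_left sum_distrib_right sum_distrib_left mult_ac)
  qed
  have c\<rho>: "continuous_on S \<rho>" for S using smooth_on_continuous[OF \<rho>] continuous_on_subset by blast
  have cpd: "continuous_on UNIV (pd b \<rho>)" for b using smooth_on_continuous[OF smooth_on_pd[OF \<rho>]] .
  have cw: "continuous_on S w" for S using w continuous_on_subset by blast
  have D: "(v has_derivative integral (cbox a b) (F x)) (at x)" for x
    unfolding v
  proof (rule leibniz_rule[where U = UNIV, simplified])
    show "((\<lambda>x. \<rho> (x - z) * w z) has_derivative blinfun_apply (F x z)) (at x)" for x z
    proof -
      have "((\<lambda>x. x - z) has_derivative (\<lambda>v. v)) (at x)" by (auto intro!: derivative_eq_intros)
      from diff_chain_at[OF this has_derivative_pd[OF \<rho>d]]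
      have "((\<lambda>x. \<rho> (x - z)) has_derivative (\<lambda>v. pd v \<rho> (x - z))) (at x)" by (simp add: o_def)
      then have "((\<lambda>x. \<rho> (x - z) * w z) has_derivative (\<lambda>v. pd v \<rho> (x - z) * w z)) (at x)"
        by (rule has_derivative_mult_left)
      then show ?thesis by (simp only: Fv[symmetric])
    qed
    show "(\<lambda>z. \<rho> (x - z) * w z) integrable_on cbox a b" for x
      by (intro integrable_continuous continuous_on_mult cw continuous_on_compose2[OF c\<rho>[of UNIV]] continuous_intros) auto
    show "continuous_on (UNIV \<times> cbox a b) (\<lambda>(x, z). F x z)"
      unfolding F_def split_beta
      by (intro continuous_on_sum continuous_on_scaleR continuous_on_mult continuous_on_const
          continuous_on_compose2[OF cpd] continuous_on_compose2[OF cw[of UNIV]] continuous_intros) auto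
  qed
  have intF: "F x integrable_on cbox a b" for x
  proof (rule integrable_continuous)
    show "continuous_on (cbox a b) (F x)" unfolding F_def
      by (intro continuous_on_sum continuous_on_scaleR continuous_on_mult continuous_on_const
          continuous_on_compose2[OF cpd] cw continuous_intros) auto
  qed
  have "pd u v x = integral (cbox a b) (\<lambda>z. pd u \<rho> (x - z) * w z)" for u x
    using pd_eqI[OF D, of u x] blinfun_apply_integral[OF intF, of x u] by (simp only: Fv)
  then show "(\<forall>x\<in>UNIV. v differentiable (at x)) \<and> (\<forall>u. \<exists>g. (\<exists>\<rho>. smooth_on \<rho> UNIV \<and>
      g = (\<lambda>x. integral (cbox a b) (\<lambda>z. \<rho> (x - z) * w z))) \<and> (\<forall>x\<in>UNIV. pd u v x = g x))"
    using D smooth_on_pd[OF \<rho>] unfolding differentiable_def by blast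
qed (use \<rho> in auto)

context orthonormal_frame
begin

text \<open>By uniform continuity the integral is a limit, uniform on compact sets, of Riemann sums.
  These are nonnegative combinations of slices, so closure under sums and limits applies.\<close>

lemma subharmonic_B_integral:
  assumes F: "continuous_on (N \<times> cbox a b) (\<lambda>(x, z). F x z)"
    and sub: "\<And>z. z \<in> cbox a b \<Longrightarrow> subharmonic_B N (\<lambda>x. F x z)"
  shows "subharmonic_B N (\<lambda>x. integral (cbox a b) (F x))"
proof (rule subharmonic_B_limit)
  fix D :: "'a set" and e :: real
  assume e: "e > 0" and D: "compact D" "D \<subseteq> N"
  let ?J = "cbox a b"
  \<comment> \<open>The summand 1 avoids division by 0 for a degenerate box.\<close>
  define \<eta> where "\<eta> = e / (measure lborel ?J + 1)"
  have \<eta>: "\<eta> > 0" "\<eta> * measure lborel ?J \<le> e"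
  proof -
    have c: "measure lborel ?J + 1 > 0" by (simp add: add_nonneg_pos)
    then show "\<eta> > 0" using e by (simp add: \<eta>_def)
    have "\<eta> * (measure lborel ?J + 1) = e" using c by (simp add: \<eta>_def)
    then show "\<eta> * measure lborel ?J \<le> e" using \<open>\<eta> > 0\<close> by (simp add: distrib_left)
  qed
  have FD: "continuous_on (D \<times> ?J) (\<lambda>(x, z). F x z)"
    by (rule continuous_on_subset[OF F]) (use D in auto)
  then have "uniformly_continuous_on (D \<times> ?J) (\<lambda>(x, z). F x z)"
    by (intro compact_uniformly_continuous compact_Times D compact_cbox)
  then obtain \<delta> where \<delta>: "\<delta> > 0" "\<And>p q. p \<in> D \<times> ?J \<Longrightarrow> q \<in> D \<times> ?J \<Longrightarrow> dist q p < \<delta> \<Longrightarrow>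
      dist (case q of (x, z) \<Rightarrow> F x z) (case p of (x, z) \<Rightarrow> F x z) < \<eta>"
    unfolding uniformly_continuous_on_def using \<eta>(1) by metis
  have close: "\<bar>F x t - F x z\<bar> \<le> \<eta>" if "x \<in> D" "t \<in> ?J" "z \<in> ?J" "dist t z < \<delta>" for x t z
    using \<delta>(2)[of "(x, z)" "(x, t)"] that by (simp add: dist_Pair_Pair dist_real_def)
  have "gauge (\<lambda>z. ball z \<delta>)" using \<delta>(1) by (simp add: gauge_ball)
  then obtain p where p: "p tagged_division_of ?J" "(\<lambda>z. ball z \<delta>) fine p"
    using fine_division_exists by blast
  have cz: "continuous_on N (\<lambda>x. F x z)" if "z \<in> ?J" for z
  proof -
    have "continuous_on N (\<lambda>x. (x, z))" by (intro continuous_intros)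
    then show ?thesis using continuous_on_compose2[OF F, of N "\<lambda>x. (x, z)"] that by auto
  qed
  define S where "S x = (\<Sum>q\<in>p. measure lborel (snd q) * F x (fst q))" for x
  have "subharmonic_B N S"
    unfolding S_def
  proof (rule subharmonic_B_sum)
    fix q assume "q \<in> p"
    then have "fst q \<in> ?J" using tag_in_interval[OF p(1), of "fst q" "snd q"] by simp
    then show "subharmonic_B N (\<lambda>x. measure lborel (snd q) * F x (fst q)) \<and>
        continuous_on N (\<lambda>x. measure lborel (snd q) * F x (fst q))"
      by (intro conjI subharmonic_B_cmult sub continuous_on_mult continuous_on_const cz measure_nonneg)
  qed
  moreover have "\<bar>integral ?J (F x) - S x\<bar> \<le> e" if x: "x \<in> D" for x
  proof -
    have FJ: "continuous_on ?J (F x)"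
    proof -
      have "continuous_on ?J (\<lambda>z. (x, z))" by (intro continuous_intros)
      then show ?thesis using continuous_on_compose2[OF FD, of ?J "\<lambda>z. (x, z)"] x by auto
    qed
    have "integral ?J (F x) = (\<Sum>(z, k)\<in>p. integral k (F x))"
      by (rule integral_combine_tagged_division_topdown[OF integrable_continuous[OF FJ] p(1)])
    then have "\<bar>integral ?J (F x) - S x\<bar> = \<bar>\<Sum>q\<in>p. integral (snd q) (F x) - measure lborel (snd q) * F x (fst q)\<bar>"
      by (simp add: S_def sum_subtractf split_beta)
    also have "\<dots> \<le> (\<Sum>q\<in>p. \<bar>integral (snd q) (F x) - measure lborel (snd q) * F x (fst q)\<bar>)" by (rule sum_abs)
    also have "\<dots> \<le> (\<Sum>q\<in>p. \<eta> * measure lborel (snd q))"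
    proof (rule sum_mono)
      fix q assume "q \<in> p"
      then obtain z k where q: "q = (z, k)" "(z, k) \<in> p" by (cases q) auto
      obtain c d where k: "k = cbox c d" using tagged_division_ofD(4)[OF p(1) q(2)] by blast
      have kJ: "k \<subseteq> ?J" and zk: "z \<in> k" using tagged_division_ofD(2,3)[OF p(1) q(2)] by auto
      have kb: "k \<subseteq> ball z \<delta>" using fineD[OF p(2) q(2)] .
      have int: "F x integrable_on cbox c d"
        using integrable_continuous[OF continuous_on_subset[OF FJ kJ[unfolded k]]] .
      have "integral k (F x) - measure lborel k * F x z = integral (cbox c d) (\<lambda>t. F x t - F x z)"
        using integral_diff[OF int integrable_const, of "F x z"] by (simp add: k)
      also have "\<bar>\<dots>\<bar> \<le> \<eta> * measure lborel (cbox c d)"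
      proof (rule has_integral_bound[of _ "\<lambda>t. F x t - F x z", unfolded real_norm_def])
        show "((\<lambda>t. F x t - F x z) has_integral integral (cbox c d) (\<lambda>t. F x t - F x z)) (cbox c d)"
          using int by (intro integrable_integral integrable_diff) auto
        show "\<bar>F x t - F x z\<bar> \<le> \<eta>" if "t \<in> cbox c d" for t
          using that kb kJ zk x by (intro close) (auto simp: k dist_commute subset_iff)
      qed (use \<eta> in simp)
      finally show "\<bar>integral (snd q) (F x) - measure lborel (snd q) * F x (fst q)\<bar> \<le> \<eta> * measure lborel (snd q)"
        by (simp add: q k)
    qed
    also have "\<dots> = \<eta> * measure lborel ?J"
      using additive_content_tagged_division[OF p(1)] by (simp add: split_beta flip: sum_distrib_left)
    also have "\<dots> \<le> e" by (rule \<eta>(2))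
    finally show ?thesis .
  qed
  ultimately show "\<exists>v. subharmonic_B N v \<and> (\<forall>x\<in>D. \<bar>integral ?J (F x) - v x\<bar> \<le> e)" by blast
qed

end

text \<open>A smooth convex substitute for the positive part. The factor \<open>t\<close> is
  essential: \<open>flat 0\<close> is bounded and not constant, so it is not convex, whereas here
  the slope \<open>(1 + 1 / t) * exp (- 1 / t)\<close> increases from 0 towards 1.\<close>

definition theta :: "real \<Rightarrow> real" where "theta t = t * flat 0 t"

lemma theta_nonpos: "t \<le> 0 \<Longrightarrow> theta t = 0"
  by (simp add: theta_def flat_def)

lemma theta_pos: "t > 0 \<Longrightarrow> theta t > 0"
  by (simp add: theta_def flat_def)

lemma theta_nonneg: "theta t \<ge> 0"
  by (simp add: theta_def flat_def)

lemma theta_strict_mono: "0 < s \<Longrightarrow> s < t \<Longrightarrow> theta s < theta t"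
  by (auto simp: theta_def flat_def intro!: mult_strict_mono frac_le divide_strict_left_mono)

lemma theta_mono: "s \<le> t \<Longrightarrow> theta s \<le> theta t"
  using theta_strict_mono[of s t] theta_nonpos[of s] theta_nonneg[of t] by (cases "s = t"; cases "s > 0") auto

text \<open>Convexity is used only through supporting lines. The bound \<open>l \<le> 1\<close> is
  what makes the supporting line of \<open>b + theta (a - b)\<close> a convex combination of
  \<open>a\<close> and \<open>b\<close> up to a constant.\<close>

lemma theta_tangent: "\<exists>l. 0 \<le> l \<and> l \<le> 1 \<and> (\<forall>s. theta t + l * (s - t) \<le> theta s)"
proof (cases "t > 0")
  case False
  then show ?thesis using theta_nonneg by (intro exI[of _ 0]) (simp add: theta_nonpos)
next
  case True
  define E where "E = exp (- 1 / t)"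
  define l where "l = (1 + 1 / t) * E"
  have E: "E > 0" by (simp add: E_def)
  have th: "theta t = t * E" using True by (simp add: theta_def flat_def E_def)
  have lt: "l * t = t * E + E" using True by (simp add: l_def field_simps)
  have l0: "l \<ge> 0" using True E by (simp add: l_def)
  have "1 + 1 / t \<le> exp (1 / t)" by (rule exp_ge_add_one_self)
  then have "l \<le> exp (1 / t) * E" unfolding l_def using E by (intro mult_right_mono) auto
  then have l1: "l \<le> 1" by (simp add: E_def flip: exp_add)
  have "theta t + l * (s - t) \<le> theta s" for s
  proof (cases "s > 0")
    case False
    have "l * s \<le> 0" using False l0 by (simp add: mult_nonneg_nonpos)
    then show ?thesis using lt th E False by (simp add: theta_nonpos right_diff_distrib)
  next
    case s: True
    \<comment> \<open>Multiplied by \<open>s * E\<close> this reads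
      \<open>l * s - E \<le> theta s\<close>; since \<open>l * t = theta t + E\<close>, it is the
      tangent inequality.\<close>
    have "1 + (1 / t - 1 / s) \<le> exp (1 / t - 1 / s)" by (rule exp_ge_add_one_self)
    then have "s * E * (1 + (1 / t - 1 / s)) \<le> s * E * exp (1 / t - 1 / s)"
      using s E by (intro mult_left_mono) auto
    also have "s * E * exp (1 / t - 1 / s) = theta s"
      using s by (simp add: theta_def flat_def E_def mult.assoc flip: exp_add)
    also have "s * E * (1 + (1 / t - 1 / s)) = l * s - E"
      using s True by (simp add: l_def field_simps)
    finally show ?thesis using lt th by (simp add: right_diff_distrib)
  qed
  then show ?thesis using l0 l1 by blast
qed

lemma smooth_on_theta: "open U \<Longrightarrow> smooth_on f U \<Longrightarrow> smooth_on (\<lambda>x. theta (f x)) U"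
  unfolding theta_def by (intro smooth_on_mult smooth_on_flat)

text \<open>Substitution of \<open>x - y\<close>. The reflected box moves with \<open>x\<close>, but
  the integrand vanishes outside it, so a fixed larger domain \<open>J\<close> can replace
  it.\<close>

lemma integral_reflect_translate:
  fixes f :: "'a::euclidean_space \<Rightarrow> real"
  assumes f: "f integrable_on cbox (- a) a" and z: "\<And>y. x - y \<notin> cbox (- a) a \<Longrightarrow> f (x - y) = 0"
    and J: "\<And>y. x - y \<in> cbox (- a) a \<Longrightarrow> y \<in> J"
  shows "integral J (\<lambda>y. f (x - y)) = integral (cbox (- a) a) f"
proof -
  let ?A = "(\<lambda>y. (1 / (- 1)) *\<^sub>R y + - ((1 / (- 1)) *\<^sub>R x)) ` cbox (- a) a"
  have "((\<lambda>y. f ((- 1) *\<^sub>R y + x)) has_integral (1 / (\<bar>- 1\<bar> ^ DIM('a))) *\<^sub>R integral (cbox (- a) a) f) ?A"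
    by (rule has_integral_affinity[OF integrable_integral[OF f]]) simp
  then have 1: "((\<lambda>y. f (x - y)) has_integral integral (cbox (- a) a) f) ?A" by simp
  have "y \<in> ?A \<longleftrightarrow> x - y \<in> cbox (- a) a" for y
  proof
    assume "x - y \<in> cbox (- a) a"
    then show "y \<in> ?A" by (intro image_eqI[of _ _ "x - y"]) auto
  qed auto
  then have "((\<lambda>y. f (x - y)) has_integral integral (cbox (- a) a) f) J"
    by (intro has_integral_on_superset[OF 1]) (use z J in auto)
  then show ?thesis by (rule integral_unique)
qed

text \<open>\<open>N\<close> and \<open>v\<close> do not depend on the frame, so one mollified
  function serves all Lagrangian planes. It is read in two ways: as an average of translates of
  \<open>w\<close> it inherits comparison, and as an integral against a translated kernel it is
  smooth.\<close>

lemma mollify: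
  fixes w :: "'a::euclidean_space \<Rightarrow> real"
  assumes X: "open X" and w: "continuous_on X w" and K: "compact K" "K \<subseteq> X" and e: "e > 0"
  obtains N v where "open N" "K \<subseteq> N" "N \<subseteq> X" "smooth_on v N" "\<And>x. x \<in> K \<Longrightarrow> \<bar>v x - w x\<bar> \<le> e"
    "\<And>B. orthonormal_frame B \<Longrightarrow> orthonormal_frame.subharmonic_B B X w \<Longrightarrow> orthonormal_frame.subharmonic_B B N v"
proof -
  obtain d where d: "d > 0" "(\<Union>x\<in>K. cball x d) \<subseteq> X"
    using compact_subset_open_imp_cball_epsilon_subset[OF K(1) X K(2)] by blast
  define D where "D = {x + y |x y. x \<in> K \<and> y \<in> cball (0::'a) d}"
  have cD: "compact D" unfolding D_def by (rule compact_sums[OF K(1) compact_cball])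
  have D_iff: "z \<in> D" if "x \<in> K" "dist x z \<le> d" for x z
    using that unfolding D_def mem_Collect_eq
    by (intro exI[of _ x] exI[of _ "z - x"]) (auto simp: dist_norm norm_minus_commute)
  have DX: "D \<subseteq> X"
  proof
    fix z assume "z \<in> D"
    then obtain x y where "z = x + y" "x \<in> K" "norm y \<le> d" by (auto simp: D_def)
    then have "z \<in> cball x d" by (simp add: dist_norm)
    then show "z \<in> X" using d(2) \<open>x \<in> K\<close> by blast
  qed
  have cwD: "continuous_on D w" using w DX continuous_on_subset by blast
  have "bounded (w ` D)" using compact_continuous_image[OF cwD cD] compact_imp_bounded by blast
  then obtain M where M: "M \<ge> 0" "\<And>x. x \<in> D \<Longrightarrow> norm (w x) \<le> M"
    unfolding bounded_iff by (metis abs_ge_zero image_eqI order_trans real_norm_def abs_ge_self)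
  \<comment> \<open>The extension makes all integrands continuous on full boxes. For
    \<open>x \<in> N\<close> only values on \<open>D\<close>, where it equals \<open>w\<close>,
    contribute.\<close>
  obtain w' where w': "continuous_on UNIV w'" "\<And>x. x \<in> D \<Longrightarrow> w' x = w x"
    by (rule Tietze[of D w UNIV M]) (use cwD cD M compact_imp_closed in auto)
  obtain r0 where r0: "r0 > 0" "\<And>p q. p \<in> D \<Longrightarrow> q \<in> D \<Longrightarrow> dist q p < r0 \<Longrightarrow> dist (w q) (w p) < e"
    using compact_uniformly_continuous[OF cwD cD] e unfolding uniformly_continuous_on_def by metis
  \<comment> \<open>Less than \<open>r0\<close> for the error \<open>e\<close>, and at most
    \<open>d / 2\<close> so that shifting a point of \<open>N\<close> by at most \<open>R\<close>
    stays within \<open>d\<close> of \<open>K\<close>.\<close>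
  define R where "R = min r0 d / 2"
  have R: "R > 0" "R < r0" "R \<le> d / 2" using r0(1) d(1) by (auto simp: R_def)
  define \<rho> where "\<rho> z = theta (R\<^sup>2 - z \<bullet> z)" for z :: 'a
  have \<rho>s: "smooth_on \<rho> UNIV"
    unfolding \<rho>_def
    by (intro smooth_on_theta open_UNIV smooth_on_diff smooth_on_const)
      (use rpf_smooth[OF rpf_norm2[of 0]] in simp)
  have c\<rho>: "continuous_on S \<rho>" for S using smooth_on_continuous[OF \<rho>s] continuous_on_subset by blast
  have \<rho>0: "\<rho> z \<ge> 0" for z by (simp add: \<rho>_def theta_nonneg)
  have \<rho>z: "\<rho> z = 0" if "norm z \<ge> R" for z
    using that R(1) power_mono[of R "norm z" 2] by (simp add: \<rho>_def theta_nonpos power2_norm_eq_inner)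
  obtain a where a: "cball (0::'a) R \<subseteq> cbox (- a) a"
    using bounded_subset_cbox_symmetric[OF bounded_cball] by blast
  let ?J = "cbox (- a) a"
  have cw': "continuous_on S w'" for S using w'(1) continuous_on_subset by blast
  define c where "c = integral ?J \<rho>"
  have int\<rho>: "\<rho> integrable_on ?J" by (intro integrable_continuous c\<rho>)
  have c: "c > 0"
  proof -
    have "(0::'a) \<in> ball 0 R" using R(1) by simp
    also have "ball (0::'a) R \<subseteq> interior ?J" using a interior_maximal[of "ball (0::'a) R" ?J] by (meson ball_subset_cball open_ball subset_trans)
    finally have "box (- a) a \<noteq> {}" by (auto simp: interior_cbox)
    moreover have "\<rho> 0 > 0" using R(1) by (simp add: \<rho>_def theta_pos)
    moreover have "0 \<in> ?J" using a R(1) by auto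
    ultimately have "integral ?J \<rho> \<noteq> 0" using integral_cbox_eq_0_iff[OF c\<rho>, of "- a" a] \<rho>0 by force
    moreover have "integral ?J \<rho> \<ge> 0" using \<rho>0 int\<rho> by (intro integral_nonneg) auto
    ultimately show ?thesis by (simp add: c_def)
  qed
  define F where "F x z = \<rho> z * w' (x - z)" for x z
  define v where "v x = (1 / c) * integral ?J (F x)" for x
  define N where "N = (\<Union>x\<in>K. ball x (d / 2))"
  have N: "open N" "K \<subseteq> N" using d(1) by (auto simp: N_def)
  have ND: "x - z \<in> D" if xN: "x \<in> N" and zR: "norm z \<le> R" for x z
  proof -
    obtain k where k: "k \<in> K" "dist k x < d / 2" using xN unfolding N_def UN_iff mem_ball by blast
    have "dist k (x - z) \<le> dist k x + dist x (x - z)" by (rule dist_triangle)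
    then show ?thesis using D_iff[OF k(1)] k(2) zR R(3) by (simp add: dist_norm)
  qed
  have "N \<subseteq> D" using ND[of _ 0] R(1) by auto
  then have NX: "N \<subseteq> X" using DX by blast
  have Fc: "continuous_on S (F x)" for S x
    unfolding F_def by (intro continuous_on_mult c\<rho> continuous_on_compose2[OF cw'[of UNIV]] continuous_intros) auto
  have approx: "\<bar>v x - w x\<bar> \<le> e" if x: "x \<in> K" for x
  proof -
    have xN: "x \<in> N" using x N by blast
    have "norm (integral ?J (\<lambda>z. F x z - w x * \<rho> z)) \<le> integral ?J (\<lambda>z. e * \<rho> z)"
    proof (rule integral_norm_bound_integral)
      show "(\<lambda>z. F x z - w x * \<rho> z) integrable_on ?J" "(\<lambda>z. e * \<rho> z) integrable_on ?J"
        by (intro integrable_continuous continuous_intros Fc c\<rho>)+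
      fix z assume "z \<in> ?J"
      show "norm (F x z - w x * \<rho> z) \<le> e * \<rho> z"
      proof (cases "norm z < R")
        case True
        then have "dist (w (x - z)) (w x) < e"
          using ND[OF xN, of z] ND[OF xN, of 0] R by (intro r0(2)) (auto simp: dist_norm)
        moreover have "F x z - w x * \<rho> z = \<rho> z * (w (x - z) - w x)"
          using w'(2)[OF ND[OF xN, of z]] True by (simp add: F_def algebra_simps)
        ultimately show ?thesis
          using \<rho>0[of z] mult_left_mono[of "\<bar>w (x - z) - w x\<bar>" e "\<rho> z"] by (simp add: abs_mult dist_real_def mult.commute)
      next
        case False
        then show ?thesis using \<rho>z[of z] by (simp add: F_def)
      qed
    qed
    also have "integral ?J (\<lambda>z. e * \<rho> z) = e * c" by (simp add: c_def)
    also have "integral ?J (\<lambda>z. F x z - w x * \<rho> z) = c * v x - c * w x"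
      using int\<rho> c integrable_continuous[OF Fc]
      by (subst integral_diff) (auto simp: v_def c_def intro!: integrable_continuous continuous_on_mult continuous_on_const c\<rho>)
    finally have "\<bar>c * (v x - w x)\<bar> \<le> e * c" by (simp add: right_diff_distrib)
    then have "c * \<bar>v x - w x\<bar> \<le> c * e" using c by (simp add: abs_mult mult.commute)
    then show ?thesis using c by simp
  qed
  have "bounded {x - z |x z. x \<in> D \<and> z \<in> ?J}"
    using compact_imp_bounded[OF compact_differences[OF cD compact_cbox]] .
  \<comment> \<open>A box containing \<open>D - ?J\<close>, so that the reflected integral has the
    same domain for all \<open>x \<in> N\<close>.\<close>
  then obtain b where b: "{x - z |x z. x \<in> D \<and> z \<in> ?J} \<subseteq> cbox (- b) b"
    using bounded_subset_cbox_symmetric by blast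
  have veq: "v x = (1 / c) * integral (cbox (- b) b) (\<lambda>z. \<rho> (x - z) * w' z)" if x: "x \<in> N" for x
  proof -
    have "integral (cbox (- b) b) (\<lambda>y. F x (x - y)) = integral ?J (F x)"
    proof (rule integral_reflect_translate[OF integrable_continuous[OF Fc]])
      show "F x (x - y) = 0" if "x - y \<notin> ?J" for y
      proof -
        have "x - y \<notin> cball 0 R" using that a by blast
        then show ?thesis using \<rho>z[of "x - y"] by (simp add: F_def)
      qed
      show "y \<in> cbox (- b) b" if "x - y \<in> ?J" for y
      proof -
        have "y = x - (x - y)" by simp
        then have "y \<in> {x - z |x z. x \<in> D \<and> z \<in> ?J}" using that x \<open>N \<subseteq> D\<close> by blast
        then show ?thesis using b by blast
      qed
    qed
    then show ?thesis by (simp add: v_def F_def)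
  qed
  have "smooth_on (\<lambda>x. (1 / c) * integral (cbox (- b) b) (\<lambda>z. \<rho> (x - z) * w' z)) N"
    using smooth_on_subset[OF smooth_on_cmult[OF open_UNIV convolution_smooth[OF w'(1) \<rho>s]]] by blast
  then have "smooth_on v N" by (rule smooth_on_cong[OF N(1), rotated]) (simp add: veq)
  moreover have "orthonormal_frame.subharmonic_B B N v"
    if "orthonormal_frame B" and sub: "orthonormal_frame.subharmonic_B B X w" for B
  proof -
    interpret orthonormal_frame B by fact
    have "subharmonic_B N (\<lambda>x. integral ?J (F x))"
    proof (rule subharmonic_B_integral)
      show "continuous_on (N \<times> ?J) (\<lambda>(x, z). F x z)"
        unfolding F_def split_beta
        by (intro continuous_on_mult continuous_on_compose2[OF c\<rho>[of UNIV]]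
            continuous_on_compose2[OF cw'[of UNIV]] continuous_intros) auto
      fix z
      show "subharmonic_B N (\<lambda>x. F x z)"
      proof (cases "norm z \<le> R")
        case True
        have "subharmonic_B N (\<lambda>x. w' (x - z))"
          by (rule subharmonic_B_translate[OF sub, of _ z]) (use ND[OF _ True] DX w'(2) in blast)
        then show ?thesis unfolding F_def by (rule subharmonic_B_cmult) (rule \<rho>0)
      next
        case False
        then show ?thesis using \<rho>z[of z] subharmonic_B_zero by (simp add: F_def)
      qed
    qed
    then show ?thesis unfolding v_def using c by (intro subharmonic_B_cmult) auto
  qed
  ultimately show ?thesis using that[OF N(1,2) NX _ approx] by blast
qed

section \<open>Gluing plurisubharmonic functions\<close>

text \<open>A pointwise certificate for plurisubharmonicity: a smooth lower support with nonnegative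
  traces. Unlike upper test functions, lower supports of several functions at one point can be
  combined.\<close>

definition touched_below :: "(complex^'n) set \<Rightarrow> (complex^'n \<Rightarrow> real) \<Rightarrow> complex^'n \<Rightarrow> bool" where
  "touched_below X u x \<longleftrightarrow> (\<exists>U p. open U \<and> x \<in> U \<and> U \<subseteq> X \<and> smooth_on p U \<and> p x = u x \<and>
     (\<forall>y\<in>U. p y \<le> u y) \<and> (\<forall>W\<in>LAG. 0 \<le> trace_on (hessian p x) W))"

text \<open>An upper test function minus the lower support has a minimum at the contact point, so
  its Hessian is larger on the diagonal, and traces see only diagonal entries.\<close>

lemma touched_below_lag_psh:
  fixes X :: "(complex^'n) set"
  assumes X: "open X" and u: "continuous_on X u" and t: "\<And>x. x \<in> X \<Longrightarrow> touched_below X u x"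
  shows "lag_psh X (\<lambda>x. ereal (u x))"
  unfolding lag_psh_def subharmonic_on_def
proof (intro conjI ballI allI impI)
  show "upper_semicontinuous_on X (\<lambda>x. ereal (u x))"
    unfolding upper_semicontinuous_on_def
  proof (intro ballI allI impI)
    fix x c assume "x \<in> X" "ereal (u x) < c"
    have "((\<lambda>y. ereal (u y)) \<longlongrightarrow> ereal (u x)) (at x within X)"
      using u \<open>x \<in> X\<close> by (auto simp: continuous_on_def intro!: tendsto_ereal)
    then show "\<forall>\<^sub>F y in at x within X. ereal (u y) < c" using \<open>ereal (u x) < c\<close> by (rule order_tendstoD)
  qed
next
  fix x V \<phi>
  assume x: "x \<in> X" and V: "open V \<and> x \<in> V \<and> V \<subseteq> X \<and> smooth_on \<phi> V \<and>
    (\<forall>y\<in>V. ereal (u y) \<le> ereal (\<phi> y)) \<and> ereal (u x) = ereal (\<phi> x)"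
  obtain U p where p: "open U" "x \<in> U" "U \<subseteq> X" "smooth_on p U" "p x = u x" "\<And>y. y \<in> U \<Longrightarrow> p y \<le> u y"
    "\<And>W. W \<in> LAG \<Longrightarrow> 0 \<le> trace_on (hessian p x) W"
    using t[OF x] unfolding touched_below_def by blast
  define D where "D = U \<inter> V"
  have D: "open D" "x \<in> D" using p V by (auto simp: D_def)
  have sp: "smooth_on p D" and s\<phi>: "smooth_on \<phi> D"
    using smooth_on_subset[OF p(4), of D] smooth_on_subset[of \<phi> V D] V by (auto simp: D_def)
  have sm: "smooth_on (\<lambda>y. - 1 * p y) D" by (rule smooth_on_cmult[OF D(1) sp])
  have diag: "hessian p x b b \<le> hessian \<phi> x b b" for b
  proof -
    have "0 \<le> hessian (\<lambda>y. \<phi> y + - 1 * p y) x b b"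
    proof (rule hessian_diag_nonneg_at_min[OF D smooth_on_add[OF D(1) s\<phi> sm]])
      fix s assume "x + s *\<^sub>R b \<in> D"
      then have "p (x + s *\<^sub>R b) \<le> u (x + s *\<^sub>R b)" "u (x + s *\<^sub>R b) \<le> \<phi> (x + s *\<^sub>R b)" "p x = \<phi> x"
        using p V by (auto simp: D_def)
      then show "\<phi> x + - 1 * p x \<le> \<phi> (x + s *\<^sub>R b) + - 1 * p (x + s *\<^sub>R b)" by simp
    qed
    then show ?thesis unfolding hessian_add[OF D s\<phi> sm] hessian_cmult[OF D sp] by simp
  qed
  have "0 \<le> trace_on (hessian \<phi> x) W" if "W \<in> LAG" for W
  proof -
    have "trace_on (hessian p x) W \<le> trace_on (hessian \<phi> x) W"
      unfolding trace_on_def by (intro sum_mono diag)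
    then show ?thesis using p(7)[OF that] by simp
  qed
  then show "hessian \<phi> x \<in> P_LAG" using hessian_Sym2[OF D s\<phi>] by (simp add: P_LAG_def)
qed simp

text \<open>\<open>v\<close> need only lie above the combination, with equality at \<open>x\<close>.
  Sums, \<open>theta\<close> and the regularised maximum are all instances, the supporting line of
  \<open>theta\<close> supplying the coefficients.\<close>

lemma touched_below_lincomb:
  assumes X: "open X" and a: "touched_below X a x" and b: "touched_below X b x" and l: "\<alpha> \<ge> 0" "\<beta> \<ge> 0"
    and v: "v x = \<alpha> * a x + \<beta> * b x + c" "\<And>y. y \<in> X \<Longrightarrow> \<alpha> * a y + \<beta> * b y + c \<le> v y"
  shows "touched_below X v x"
proof -
  obtain U p where p: "open U" "x \<in> U" "U \<subseteq> X" "smooth_on p U" "p x = a x" "\<And>y. y \<in> U \<Longrightarrow> p y \<le> a y"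
    "\<And>W. W \<in> LAG \<Longrightarrow> 0 \<le> trace_on (hessian p x) W"
    using a unfolding touched_below_def by blast
  obtain V q where q: "open V" "x \<in> V" "V \<subseteq> X" "smooth_on q V" "q x = b x" "\<And>y. y \<in> V \<Longrightarrow> q y \<le> b y"
    "\<And>W. W \<in> LAG \<Longrightarrow> 0 \<le> trace_on (hessian q x) W"
    using b unfolding touched_below_def by blast
  define D where "D = U \<inter> V"
  have D: "open D" "x \<in> D" "D \<subseteq> X" using p q by (auto simp: D_def)
  have sp: "smooth_on p D" and sq: "smooth_on q D"
    using smooth_on_subset[OF p(4), of D] smooth_on_subset[OF q(4), of D] by (auto simp: D_def)
  have s1: "smooth_on (\<lambda>y. \<alpha> * p y) D" "smooth_on (\<lambda>y. \<beta> * q y) D"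
    using smooth_on_cmult[OF D(1)] sp sq by auto
  have s2: "smooth_on (\<lambda>y. \<alpha> * p y + \<beta> * q y) D" by (rule smooth_on_add[OF D(1) s1])
  define f where "f y = \<alpha> * p y + \<beta> * q y + c" for y
  have sf: "smooth_on f D" unfolding f_def by (rule smooth_on_add[OF D(1) s2 smooth_on_const[OF D(1)]])
  have "trace_on (hessian f x) W = \<alpha> * trace_on (hessian p x) W + \<beta> * trace_on (hessian q x) W" for W
    unfolding f_def hessian_trace_add[OF D(1,2) s2 smooth_on_const[OF D(1)]] hessian_trace_add[OF D(1,2) s1]
      hessian_trace_cmult[OF D(1,2) sp] hessian_trace_cmult[OF D(1,2) sq] hessian_trace_const by simp
  then have "\<forall>W\<in>LAG. 0 \<le> trace_on (hessian f x) W" using p(7) q(7) l by simp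
  moreover have "f y \<le> v y" if "y \<in> D" for y
  proof -
    have "\<alpha> * p y \<le> \<alpha> * a y" "\<beta> * q y \<le> \<beta> * b y"
      using p(6)[of y] q(6)[of y] that l by (auto simp: D_def intro: mult_left_mono)
    then show ?thesis using v(2)[of y] that D by (force simp: f_def)
  qed
  moreover have "f x = v x" using v(1) p(5) q(5) by (simp add: f_def)
  ultimately show ?thesis unfolding touched_below_def using D sf by blast
qed

lemma touched_below_smooth:
  assumes "open X" "smooth_on g X" "x \<in> X" "\<And>W. W \<in> LAG \<Longrightarrow> 0 \<le> trace_on (hessian g x) W"
  shows "touched_below X g x"
  unfolding touched_below_def using assms by (intro exI[of _ X] exI[of _ g]) auto

lemma touched_below_theta:
  assumes X: "open X" and u: "touched_below X u x"
  shows "touched_below X (\<lambda>y. theta (u y + c)) x"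
proof -
  obtain l where l: "0 \<le> l" "\<And>s. theta (u x + c) + l * (s - (u x + c)) \<le> theta s"
    using theta_tangent by blast
  show ?thesis
    by (rule touched_below_lincomb[OF X u u l(1) order_refl, where c = "theta (u x + c) - l * u x"])
      (use l(2)[of "u y + c" for y] in \<open>auto simp: algebra_simps\<close>)
qed

lemma touched_below_glue:
  assumes X: "open X" and a: "touched_below X a x" and b: "touched_below X b x"
  shows "touched_below X (\<lambda>y. b y + theta (a y - b y)) x"
proof -
  obtain l where l: "0 \<le> l" "l \<le> 1" "\<And>s. theta (a x - b x) + l * (s - (a x - b x)) \<le> theta s"
    using theta_tangent by blast
  have l': "0 \<le> 1 - l" using l by simp
  show ?thesis
    by (rule touched_below_lincomb[OF X a b l(1) l', where c = "theta (a x - b x) - l * (a x - b x)"])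
      (use l(3)[of "a y - b y" for y] in \<open>auto simp: algebra_simps\<close>)
qed

lemma touched_below_cong:
  assumes u: "touched_below U u x" and "U \<subseteq> X" "\<And>y. y \<in> U \<Longrightarrow> v y = u y"
  shows "touched_below X v x"
proof -
  obtain V p where p: "open V" "x \<in> V" "V \<subseteq> U" "smooth_on p V" "p x = u x" "\<forall>y\<in>V. p y \<le> u y"
    "\<forall>W\<in>LAG. 0 \<le> trace_on (hessian p x) W"
    using u unfolding touched_below_def by blast
  have "p x = v x" "\<forall>y\<in>V. p y \<le> v y" using p assms(3) by auto
  then show ?thesis unfolding touched_below_def using p assms(2) by blast
qed

lemma touched_below_sum:
  assumes X: "open X" and x: "x \<in> X" and u: "\<And>i. i \<in> I \<Longrightarrow> touched_below X (u i) x"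
  shows "touched_below X (\<lambda>y. \<Sum>i\<in>I. u i y) x"
proof -
  have z: "touched_below X (\<lambda>y. 0) x"
    by (rule touched_below_smooth[OF X smooth_on_const[OF X] x]) (simp add: hessian_trace_const)
  show ?thesis
    using u
  proof (induction I rule: infinite_finite_induct)
    case (insert i I)
    then have 1: "touched_below X (u i) x" and 2: "touched_below X (\<lambda>y. \<Sum>i\<in>I. u i y) x" by auto
    show ?case
      by (rule touched_below_lincomb[OF X 1 2, of 1 1 _ 0]) (use insert in auto)
  qed (use z in auto)
qed

text \<open>The regularised maximum \<open>b + theta (v - b)\<close> extends a function \<open>v\<close> that is only defined near the
  convex set \<open>K\<close>: the global function \<open>b\<close> is very negative on \<open>K\<close> and exceeds \<open>v\<close> on a shell
  around \<open>K\<close>, outside of which the extension is \<open>b\<close>.\<close>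

lemma lag_convex_separation:
  fixes X K L :: "(complex^'n) set"
  assumes X: "open X" and K: "compact K" "K \<subseteq> X" and conv: "lag_hull X K = K"
    and N: "open N" "K \<subseteq> N" "N \<subseteq> X" and v: "smooth_on v N"
    and vt: "\<And>x W. x \<in> N \<Longrightarrow> W \<in> LAG \<Longrightarrow> 0 \<le> trace_on (hessian v x) W"
    and L: "L \<subseteq> K" and x0: "x0 \<in> K" and q: "\<And>y. y \<in> L \<Longrightarrow> v y \<le> q" "q < v x0"
  shows "x0 \<notin> lag_hull X L"
proof -
  have Kne: "K \<noteq> {}" using x0 by auto
  obtain d where d: "d > 0" "(\<Union>x\<in>K. cball x d) \<subseteq> N"
    using compact_subset_open_imp_cball_epsilon_subset[OF K(1) N(1,2)] by blast
  have inN: "z \<in> N" if z: "infdist z K \<le> d" for z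
  proof -
    obtain k where "k \<in> K" "infdist z K = dist z k"
      using infdist_attains_inf[OF compact_imp_closed[OF K(1)] Kne] by blast
    then have "z \<in> cball k d" using z by (simp add: dist_commute)
    then show ?thesis using d(2) \<open>k \<in> K\<close> by blast
  qed
  \<comment> \<open>A compact shell inside \<open>N\<close> and away from \<open>K\<close>; on it
    \<open>b\<close> has to overtake \<open>v\<close> before the domain of \<open>v\<close> is
    left.\<close>
  define Z where "Z = {z. infdist z K \<le> d} \<inter> {z. d / 2 \<le> infdist z K}"
  have "closed {z. d / 2 \<le> infdist z K}"
    by (intro closed_Collect_le continuous_intros continuous_on_infdist)
  then have cZ: "compact Z"
    unfolding Z_def by (intro compact_Int_closed compact_infdist_le Kne K(1) d(1))
  have ZX: "Z \<subseteq> X" using inN N(3) by (auto simp: Z_def)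
  have ZK: "z \<notin> K" if "z \<in> Z" for z using that d(1) by (auto simp: Z_def)
  define good where "good g \<longleftrightarrow> smooth_on g X \<and> lag_psh X (\<lambda>y. ereal (g y)) \<and> (\<forall>y\<in>K. g y \<le> 0)" for g
  \<comment> \<open>Here convexity of \<open>K\<close> enters: a point outside \<open>K\<close> is
    outside its hull, so some global function is larger there than its supremum over
    \<open>K\<close>. Subtracting a constant in between gives the signs required by
    \<open>good\<close>.\<close>
  have ex: "\<exists>g. good g \<and> g z > 0" if z: "z \<in> Z" for z
  proof -
    have "z \<in> X" "z \<notin> lag_hull X K" using z ZX ZK conv by auto
    then obtain g where g: "smooth_on g X" "lag_psh X (\<lambda>y. ereal (g y))"
      "(SUP y\<in>K. ereal (g y)) < ereal (g z)" by (auto simp: lag_hull_def not_le)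
    then obtain c where c: "(SUP y\<in>K. ereal (g y)) < ereal c" "ereal c < ereal (g z)"
      using ereal_dense2 by blast
    have sg: "smooth_on (\<lambda>y. g y + - c) X" by (rule smooth_on_add[OF X g(1) smooth_on_const[OF X]])
    have "lag_psh X (\<lambda>y. ereal (g y + - c))"
    proof (rule touched_below_lag_psh[OF X smooth_on_continuous[OF sg]])
      fix x assume x: "x \<in> X"
      have t: "touched_below X g x" by (rule touched_below_smooth[OF X g(1) x lag_psh_trace[OF X g(1,2) x]])
      show "touched_below X (\<lambda>y. g y + - c) x" by (rule touched_below_lincomb[OF X t t, of 1 0 _ "- c"]) auto
    qed
    moreover have "g y \<le> c" if "y \<in> K" for y
    proof -
      have "ereal (g y) \<le> (SUP y\<in>K. ereal (g y))" using that by (rule SUP_upper)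
      then have "ereal (g y) < ereal c" using c(1) by (rule le_less_trans)
      then show ?thesis by simp
    qed
    ultimately have "good (\<lambda>y. g y + - c)" using sg by (simp add: good_def)
    then show ?thesis using c(2) by (intro exI[of _ "\<lambda>y. g y + - c"]) simp
  qed
  define gz where "gz z = (SOME g. good g \<and> g z > 0)" for z
  have gz: "good (gz z) \<and> gz z z > 0" if "z \<in> Z" for z
    unfolding gz_def using someI_ex[OF ex[OF that]] .
  have op: "open (X \<inter> gz z -` {0<..})" if "z \<in> Z" for z
  proof (rule continuous_open_preimage[OF _ X open_greaterThan])
    show "continuous_on X (gz z)" using gz[OF that] by (simp add: good_def smooth_on_continuous)
  qed
  have cover_Z: "Z \<subseteq> (\<Union>z\<in>Z. X \<inter> gz z -` {0<..})" using gz ZX by auto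
  obtain I where I: "I \<subseteq> Z" "finite I" "Z \<subseteq> (\<Union>z\<in>I. X \<inter> gz z -` {0<..})"
    by (rule compactE_image[OF cZ _ cover_Z]) (use op in auto)
  \<comment> \<open>With \<open>theta\<close> applied first, the terms vanish on \<open>K\<close>
    and are nowhere negative, so they cannot cancel on the shell. The summand 0 matches the form of
    \<open>touched_below_theta\<close>.\<close>
  define \<psi> where "\<psi> y = (\<Sum>z\<in>I. theta (gz z y + 0))" for y
  have gI: "smooth_on (gz z) X" "lag_psh X (\<lambda>y. ereal (gz z y))" "\<And>y. y \<in> K \<Longrightarrow> gz z y \<le> 0"
    if "z \<in> I" for z using gz I(1) that by (auto simp: good_def)
  have s\<psi>: "smooth_on \<psi> X"
    unfolding \<psi>_def using gI(1) by (intro smooth_on_sum[OF X] smooth_on_theta[OF X]) simp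
  have t\<psi>: "touched_below X \<psi> x" if "x \<in> X" for x
    unfolding \<psi>_def
  proof (rule touched_below_sum[OF X that], rule touched_below_theta[OF X])
    fix z assume z: "z \<in> I"
    show "touched_below X (gz z) x"
      by (rule touched_below_smooth[OF X gI(1)[OF z] that lag_psh_trace[OF X gI(1,2)[OF z] that]])
  qed
  have \<psi>K: "\<psi> y = 0" if "y \<in> K" for y
    unfolding \<psi>_def using gI(3)[OF _ that] by (simp add: theta_nonpos)
  have \<psi>Z: "\<psi> y > 0" if y: "y \<in> Z" for y
  proof -
    obtain z where "z \<in> I" "gz z y > 0" using I(3) y by auto
    then show ?thesis unfolding \<psi>_def
      using I(2) by (intro sum_pos2[of I z]) (auto simp: theta_pos theta_nonneg)
  qed
  obtain \<tau> where \<tau>: "\<tau> > 0" "\<And>y. y \<in> Z \<Longrightarrow> \<tau> \<le> \<psi> y"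
  proof (cases "Z = {}")
    case True
    then show ?thesis using that[of 1] by auto
  next
    case False
    have "continuous_on Z \<psi>" using smooth_on_continuous[OF s\<psi>] ZX continuous_on_subset by blast
    then obtain a where "a \<in> Z" "\<And>y. y \<in> Z \<Longrightarrow> \<psi> a \<le> \<psi> y"
      using continuous_attains_inf[OF cZ False] by blast
    then show ?thesis using that[of "\<psi> a"] \<psi>Z by blast
  qed
  have cKZ: "compact (K \<union> Z)" using K(1) cZ by (rule compact_Un)
  have KZN: "K \<union> Z \<subseteq> N" using N(2) inN by (auto simp: Z_def)
  have "continuous_on (K \<union> Z) v" using smooth_on_continuous[OF v] KZN continuous_on_subset by blast
  then have "bounded (v ` (K \<union> Z))" using compact_continuous_image[OF _ cKZ] compact_imp_bounded by blast
  then obtain M where M: "\<And>y. y \<in> K \<union> Z \<Longrightarrow> \<bar>v y\<bar> \<le> M" by (auto simp: bounded_iff)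
  \<comment> \<open>\<open>m\<close> makes \<open>q + m\<close> positive, where \<open>theta\<close>
    is strictly increasing; \<open>C\<close> then gives \<open>v \<le> M \<le> b\<close> on the
    shell.\<close>
  define m where "m = M + 1 + \<bar>q\<bar>"
  define C where "C = (M + m) / \<tau>"
  have M0: "M \<ge> 0" using M[of x0] x0 by auto
  have C: "C \<ge> 0" "C * \<tau> = M + m" using M0 \<tau>(1) by (auto simp: C_def m_def)
  define b where "b y = C * \<psi> y + - m" for y
  have sb: "smooth_on b X"
    unfolding b_def by (rule smooth_on_add[OF X smooth_on_cmult[OF X s\<psi>] smooth_on_const[OF X]])
  have tb: "touched_below X b x" if "x \<in> X" for x
    unfolding b_def by (rule touched_below_lincomb[OF X t\<psi>[OF that] t\<psi>[OF that], of C 0 _ "- m"]) (use C in auto)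
  have bK: "b y = - m" if "y \<in> K" for y using \<psi>K[OF that] by (simp add: b_def)
  have bZ: "v y \<le> b y" if "y \<in> Z" for y
  proof -
    have "C * \<tau> \<le> C * \<psi> y" using \<tau>(2)[OF that] C(1) by (rule mult_left_mono)
    then show ?thesis using C(2) M[of y] that by (auto simp: b_def)
  qed
  define inner where "inner = {z. infdist z K < d}"
  define outer where "outer = X \<inter> {z. d / 2 < infdist z K}"
  have oi: "open inner" "open outer"
    unfolding inner_def outer_def
    by (intro open_Int X open_Collect_less continuous_intros continuous_on_infdist)+
  have iN: "inner \<subseteq> N" using inN by (auto simp: inner_def)
  have cover: "x \<in> inner \<or> x \<in> outer" if "x \<in> X" for x using that d(1) by (auto simp: inner_def outer_def)
  \<comment> \<open>The two formulas agree on the overlap of \<open>inner\<close> and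
    \<open>outer\<close>: it lies in the shell, where \<open>v \<le> b\<close> and
    \<open>theta\<close> contributes 0.\<close>
  define G where "G y = (if infdist y K < d then b y + theta (v y - b y) else b y)" for y
  have Gi: "G y = b y + theta (v y - b y)" if "y \<in> inner" for y using that by (simp add: G_def inner_def)
  have Go: "G y = b y" if "y \<in> outer" for y
  proof (cases "infdist y K < d")
    case True
    then have "y \<in> Z" using that by (auto simp: Z_def outer_def)
    then show ?thesis using bZ[of y] by (simp add: G_def theta_nonpos)
  qed (simp add: G_def)
  have vi: "smooth_on v inner" "smooth_on b inner"
    using smooth_on_subset[OF v iN] smooth_on_subset[OF sb] iN N(3) by auto
  have "smooth_on (\<lambda>y. b y + theta (v y - b y)) inner"
    by (intro smooth_on_add smooth_on_theta smooth_on_diff vi oi)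
  then have Gsi: "smooth_on G inner" by (rule smooth_on_cong[OF oi(1), rotated]) (simp add: Gi)
  have Gso: "smooth_on G outer"
    by (rule smooth_on_cong[OF oi(2), of b]) (use Go smooth_on_subset[OF sb] in \<open>auto simp: outer_def\<close>)
  have sG: "smooth_on G X"
  proof (rule smooth_on_local)
    fix x assume "x \<in> X"
    then show "\<exists>U. open U \<and> x \<in> U \<and> smooth_on G U" using cover oi Gsi Gso by blast
  qed
  have tG: "touched_below X G x" if x: "x \<in> X" for x
  proof (cases "x \<in> inner")
    case True
    have tv: "touched_below inner v x"
      by (rule touched_below_smooth[OF oi(1) vi(1) True vt]) (use iN True in auto)
    obtain U p where p: "open U" "x \<in> U" "U \<subseteq> X" "smooth_on p U" "p x = b x" "\<forall>y\<in>U. p y \<le> b y"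
      "\<forall>W\<in>LAG. 0 \<le> trace_on (hessian p x) W"
      using tb[OF x] unfolding touched_below_def by blast
    have "touched_below inner b x"
      unfolding touched_below_def
      by (intro exI[of _ "U \<inter> inner"] exI[of _ p] conjI)
        (use p True oi(1) smooth_on_subset[OF p(4)] in auto)
    then have "touched_below inner (\<lambda>y. b y + theta (v y - b y)) x"
      by (rule touched_below_glue[OF oi(1) tv])
    then show ?thesis by (rule touched_below_cong) (use Gi iN N(3) in auto)
  next
    case False
    then have xo: "x \<in> outer" using cover x by blast
    obtain U p where p: "open U" "x \<in> U" "U \<subseteq> X" "smooth_on p U" "p x = b x" "\<forall>y\<in>U. p y \<le> b y"
      "\<forall>W\<in>LAG. 0 \<le> trace_on (hessian p x) W"
      using tb[OF x] unfolding touched_below_def by blast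
    have "touched_below outer b x"
      unfolding touched_below_def
      by (intro exI[of _ "U \<inter> outer"] exI[of _ p] conjI)
        (use p xo oi(2) smooth_on_subset[OF p(4)] in auto)
    then show ?thesis by (rule touched_below_cong) (use Go in \<open>auto simp: outer_def\<close>)
  qed
  have pG: "lag_psh X (\<lambda>y. ereal (G y))"
    by (rule touched_below_lag_psh[OF X smooth_on_continuous[OF sG] tG])
  \<comment> \<open>Since \<open>\<psi>\<close> vanishes on \<open>K\<close>, there \<open>G\<close>
    is an increasing function of \<open>v\<close> alone and keeps the separation of
    \<open>x0\<close> from \<open>L\<close>.\<close>
  have GK: "G y = - m + theta (v y + m)" if "y \<in> K" for y
    using that d(1) bK[OF that] Gi[of y] by (simp add: inner_def)
  have "G y \<le> - m + theta (q + m)" if y: "y \<in> L" for y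
    using GK[of y] q(1)[OF y] L y theta_mono[of "v y + m" "q + m"] by auto
  then have "(SUP y\<in>L. ereal (G y)) \<le> ereal (- m + theta (q + m))" by (intro SUP_least) simp
  moreover have "theta (q + m) < theta (v x0 + m)"
    using q(2) M0 by (intro theta_strict_mono) (auto simp: m_def)
  then have "ereal (- m + theta (q + m)) < ereal (G x0)" using GK[OF x0] by simp
  ultimately have "\<not> ereal (G x0) \<le> (SUP y\<in>L. ereal (G y))" by (simp add: not_le le_less_trans)
  then show ?thesis using sG pG by (auto simp: lag_hull_def)
qed

lemma lag_hull_mono: "L \<subseteq> M \<Longrightarrow> lag_hull X L \<subseteq> lag_hull X M"
  unfolding lag_hull_def by (auto intro: order_trans[OF _ SUP_subset_mono])

lemma hull_subset_contact:
  fixes X K :: "(complex^'n) set" and H f :: "complex^'n \<Rightarrow> real"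
  assumes X: "open X" and H: "lag_harmonic X H" and f: "lag_pluriharmonic X f"
    and K: "compact K" "K \<subseteq> X" and fH: "\<forall>x\<in>K. f x \<le> H x" and conv: "lag_convex X K"
  shows "lag_hull X ({x \<in> K. f x = H x} \<inter> frontier K) \<subseteq> {x \<in> K. f x = H x}"
proof
  let ?L = "{x \<in> K. f x = H x} \<inter> frontier K"
  fix x0 assume hull: "x0 \<in> lag_hull X ?L"
  have hK: "lag_hull X K = K" using conv by (simp add: lag_convex_def)
  have x0: "x0 \<in> K" using hull lag_hull_mono[of ?L K X] hK by blast
  have fs: "smooth_on f X" by (rule lag_pluriharmonic_smooth[OF X f])
  have sub: "orthonormal_frame.subharmonic_B B X (\<lambda>x. H x + - f x)"
    if B: "orthonormal_frame B" and W: "span B \<in> LAG" for B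
  proof -
    interpret orthonormal_frame B by fact
    have tr: "0 \<le> (\<Sum>b\<in>B. A b b)" if "A \<in> P_LAG" for A
      using that W trace_on_eq[OF _ onb] by (auto simp: P_LAG_def Sym2_def)
    have c: "continuous_on X H" "continuous_on X (\<lambda>x. - f x)"
      using H f by (auto simp: lag_harmonic_def lag_pluriharmonic_def intro: continuous_intros)
    have "subharmonic_on P_LAG X (\<lambda>x. ereal (H x))" "subharmonic_on P_LAG X (\<lambda>x. ereal (- f x))"
      using H f by (auto simp: lag_harmonic_def lag_pluriharmonic_def lag_psh_def)
    then have "subharmonic_B X H" "subharmonic_B X (\<lambda>x. - f x)"
      using subharmonic_on_imp_subharmonic_B[OF X, of P_LAG] tr c by auto
    then show ?thesis using c by (intro subharmonic_B_add)
  qed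
  show "x0 \<in> {x \<in> K. f x = H x}"
  proof (rule ccontr)
    assume "x0 \<notin> {x \<in> K. f x = H x}"
    then have pos: "H x0 - f x0 > 0" using x0 fH by force
    \<comment> \<open>With error \<open>e\<close>, the mollified function is at most
      \<open>e\<close> on the contact set and at least \<open>2 * e\<close> at
      \<open>x0\<close>.\<close>
    define e where "e = (H x0 - f x0) / 3"
    have e: "e > 0" using pos by (simp add: e_def)
    have c: "continuous_on X (\<lambda>x. H x + - f x)"
      using H f by (auto simp: lag_harmonic_def lag_pluriharmonic_def intro: continuous_intros)
    obtain N v where N: "open N" "K \<subseteq> N" "N \<subseteq> X" "smooth_on v N"
      and v: "\<And>x. x \<in> K \<Longrightarrow> \<bar>v x - (H x + - f x)\<bar> \<le> e"
      and vB: "\<And>B. orthonormal_frame B \<Longrightarrow> orthonormal_frame.subharmonic_B B X (\<lambda>x. H x + - f x)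
        \<Longrightarrow> orthonormal_frame.subharmonic_B B N v"
      by (rule mollify[OF X c K e]) blast
    have vt: "0 \<le> trace_on (hessian v x) W" if x: "x \<in> N" and W: "W \<in> LAG" for x W
    proof -
      obtain B where B: "orthonormal_frame B" "span B = W"
        "\<And>A. A \<in> Sym2 \<Longrightarrow> trace_on A W = (\<Sum>b\<in>B. A b b)"
        using lag_frame[OF W] by metis
      interpret orthonormal_frame B by (rule B(1))
      have "subharmonic_B N v" using vB[OF B(1) sub[OF B(1)]] B(2) W by simp
      then have "0 \<le> lap v x" by (rule subharmonic_B_lap_nonneg[OF N(1,4) _ x])
      then show ?thesis using B(3)[OF hessian_Sym2[OF N(1) x N(4)]] by (simp add: lap_def)
    qed
    have "x0 \<notin> lag_hull X ?L"
    proof (rule lag_convex_separation[OF X K hK N vt _ x0, of ?L e])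
      show "v y \<le> e" if "y \<in> ?L" for y using v[of y] that by auto
      have "H x0 + - f x0 = 3 * e" by (simp add: e_def)
      then show "e < v x0" using v[OF x0] e by (auto simp: abs_le_iff)
    qed auto
    then show False using hull by simp
  qed
qed

theorem theorem4p8:
  fixes X K \<Sigma> :: "(complex^'n) set" and H f :: "complex^'n \<Rightarrow> real"
  assumes "open X" and "connected X"
    and "lag_harmonic X H"
    and "lag_pluriharmonic X f"
    and "compact K" and "K \<subseteq> X"
    and "\<forall>x\<in>K. f x \<le> H x"
  defines "\<Sigma> \<equiv> {x \<in> K. f x = H x}"
  shows "\<Sigma> \<subseteq> lag_hull X (\<Sigma> \<inter> frontier K) \<and>
         (lag_convex X K \<longrightarrow> \<Sigma> = lag_hull X (\<Sigma> \<inter> frontier K))"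
  using contact_subset_hull[OF assms(1,3-7)] hull_subset_contact[OF assms(1,3-7)]
  unfolding \<Sigma>_def by blast

end
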